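(* Let $\mathcal{E}$ be a regular ($\mathsf{Pos}$-enriched) category. Then the category $\mathcal{E}_{ex/reg}$ is exact.
   Context: All categories are enriched over the cartesian closed category $\mathsf{Pos}$ of posets and monotone maps: each hom-set is partially ordered and composition is monotone in each variable. Limits are weighted ($\mathsf{Pos}$-enriched); in particular the projections of products and pullbacks are jointly order-monomorphic, where a family $(p_i)$ with common domain is jointly order-monomorphic if $p_iu\le p_iv$ for all $i$ implies $u\le v$. A morphism $m\colon X\to Y$ is an $\mathsf{ff}$-morphism if $mf\le mg$ implies $f\le g$ for all $f,g\colon Z\to X$. A morphism $e\colon A\to B$ of a category $\mathcal{C}$ is an $\mathsf{so}$-morphism if for every $\mathsf{ff}$-morphism $m\colon X\to Y$ the canonical square from $\mathcal{C}(B,X)$ to $\mathcal{C}(A,X)$, $\mathcal{C}(B,Y)$ over $\mathcal{C}(A,Y)$ (composing with $e$ and $m$) is a pullback in $\mathsf{Pos}$. The comma object $f/g$ of $f\colon X\to Z$, $g\colon Y\to Z$ is given by jointly order-monomorphic $c_0\colon f/g\to X$, $c_1\colon f/g\to Y$ with $fc_0\le gc_1$, such that any $u_0,u_1$ with $fu_0\le gu_1$ factor as $u_0=c_0u$, $u_1=c_1u$. A category is regular if it has all finite weighted limits, every morphism factors as an $\mathsf{so}$-morphism followed by an $\mathsf{ff}$-morphism, and $\mathsf{so}$-morphisms are stable under pullback. A relation $R\colon X\looparrowright Y$ in a regular category is a subobject of $X\times Y$ represented by an $\mathsf{ff}$-morphism $\langle r_0,r_1\rangle\colon R\rightarrowtail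 X\times Y$; relations are ordered by inclusion. For $x\colon A\to X$, $y\colon A\to Y$ write $(x,y)\in_A R$ if $\langle x,y\rangle$ factors through $\langle r_0,r_1\rangle$. The composite $SR\colon X\looparrowright Z$ of $R\colon X\looparrowright Y$ and $S\colon Y\looparrowright Z$ is the $\mathsf{ff}$-part of the $(\mathsf{so},\mathsf{ff})$-factorization of $\langle r_0t_0,s_1t_1\rangle$, where $(T,t_0,t_1)$ is the pullback of $r_1$ and $s_0$. $R$ is weakening-closed if $x'\le x$, $(x,y)\in_A R$, $y\le y'$ imply $(x',y')\in_A R$. $I_X:=1_X/1_X$. A congruence on $X$ is a weakening-closed relation $E\colon X\looparrowright X$ that is reflexive and transitive (equivalently $EE\subseteq E$ and $I_X\subseteq E$). It is effective if $E=f/f$ for some morphism $f\colon X\to Y$. A regular category is exact if every congruence in it is effective. $Q_w(\mathcal{E})$ is the locally posetal bicategory with objects the pairs $(X,E)$, $E$ a congruence on $X\in\mathcal{E}$; morphisms $(X,E)\to(Y,F)$ the relations $\Phi\colon X\looparrowright Y$ in $\mathcal{E}$ with $F\Phi E=\Phi$, ordered by inclusion; composition that of relations; identity on $(X,E)$ the relation $E$. The category $\mathcal{E}_{ex/reg}$ has the same objects; its morphisms $(X,E)\to(Y,F)$ are the morphisms $R_*\colon(X,E)\to(Y,F)$ of $Q_w(\mathcal{E})$ having a right adjoint, i.e. for which there is $R^*\colon(Y,F)\to(X,E)$ in $Q_w(\mathcal{E})$ with $R^*R_*\supseteq E$ and $R_*R^*\subseteq F$; the order is $R_*\le S_*:\iff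 R_*\supseteq S_*$. *)

theory Defs
  imports Main
begin

section \<open>Categories enriched in posets\<close>

text \<open>\<open>Leq\<close> is only ever used to compare parallel arrows.\<close>

record ('o, 'a) poscat =
  Obj :: "'o set"
  Arr :: "'a set"
  Dom :: "'a \<Rightarrow> 'o"
  Cod :: "'a \<Rightarrow> 'o"
  Idn :: "'o \<Rightarrow> 'a"
  Cmp :: "'a \<Rightarrow> 'a \<Rightarrow> 'a"  (infixr \<open>\<cdot>\<index>\<close> 70)
  Leq :: "'a \<Rightarrow> 'a \<Rightarrow> bool"  (infix \<open>\<preceq>\<index>\<close> 50)

definition hom :: "('o, 'a) poscat \<Rightarrow> 'o \<Rightarrow> 'o \<Rightarrow> 'a set" where
  "hom C X Y = {f \<in> Arr C. Dom C f = X \<and> Cod C f = Y}"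

locale pos_category =
  fixes C :: "('o, 'a) poscat" (structure)
  assumes Dom_Obj: "f \<in> Arr C \<Longrightarrow> Dom C f \<in> Obj C"
    and Cod_Obj: "f \<in> Arr C \<Longrightarrow> Cod C f \<in> Obj C"
    and Idn_hom: "X \<in> Obj C \<Longrightarrow> Idn C X \<in> hom C X X"
    and Cmp_hom: "\<lbrakk>f \<in> hom C X Y; g \<in> hom C Y Z\<rbrakk> \<Longrightarrow> g \<cdot> f \<in> hom C X Z"
    and Cmp_Idn_left: "f \<in> hom C X Y \<Longrightarrow> Idn C Y \<cdot> f = f"
    and Cmp_Idn_right: "f \<in> hom C X Y \<Longrightarrow> f \<cdot> Idn C X = f"
    and Cmp_assoc: "\<lbrakk>f \<in> hom C X Y; g \<in> hom C Y Z; h \<in> hom C Z W\<rbrakk>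
      \<Longrightarrow> (h \<cdot> g) \<cdot> f = h \<cdot> (g \<cdot> f)"
    and Leq_refl: "f \<in> hom C X Y \<Longrightarrow> f \<preceq> f"
    and Leq_antisym: "\<lbrakk>f \<in> hom C X Y; g \<in> hom C X Y; f \<preceq> g; g \<preceq> f\<rbrakk> \<Longrightarrow> f = g"
    and Leq_trans: "\<lbrakk>f \<in> hom C X Y; g \<in> hom C X Y; h \<in> hom C X Y; f \<preceq> g; g \<preceq> h\<rbrakk>
      \<Longrightarrow> f \<preceq> h"
    and Cmp_mono_left: "\<lbrakk>f \<in> hom C X Y; g \<in> hom C Y Z; g' \<in> hom C Y Z; g \<preceq> g'\<rbrakk>
      \<Longrightarrow> g \<cdot> f \<preceq> g' \<cdot> f"
    and Cmp_mono_right: "\<lbrakk>f \<in> hom C X Y; f' \<in> hom C X Y; g \<in> hom C Y Z; f \<preceq> f'\<rbrakk>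
      \<Longrightarrow> g \<cdot> f \<preceq> g \<cdot> f'"


section \<open>Finite weighted limits\<close>

locale pos_functor = D: pos_category D + C: pos_category C
  for D :: "('p, 'b) poscat" and C :: "('o, 'a) poscat" +
  fixes Fo :: "'p \<Rightarrow> 'o" and Fa :: "'b \<Rightarrow> 'a"
  assumes Fo_Obj: "d \<in> Obj D \<Longrightarrow> Fo d \<in> Obj C"
    and Fa_hom: "f \<in> hom D d e \<Longrightarrow> Fa f \<in> hom C (Fo d) (Fo e)"
    and Fa_Idn: "d \<in> Obj D \<Longrightarrow> Fa (Idn D d) = Idn C (Fo d)"
    and Fa_Cmp: "\<lbrakk>f \<in> hom D c d; g \<in> hom D d e\<rbrakk> \<Longrightarrow> Fa (g \<cdot>\<^bsub>D\<^esub> f) = Fa g \<cdot>\<^bsub>C\<^esub> Fa f"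
    and Fa_mono: "\<lbrakk>f \<in> hom D d e; g \<in> hom D d e; f \<preceq>\<^bsub>D\<^esub> g\<rbrakk> \<Longrightarrow> Fa f \<preceq>\<^bsub>C\<^esub> Fa g"

text \<open>
  A finite weight: an enriched functor from a finite \<open>Pos\<close>-category \<open>D\<close> to finite posets.
  The poset \<open>W d\<close> is given by its order relation \<open>Wo d\<close>; since the order is reflexive, the
  carrier is \<open>Field (Wo d)\<close>. Indexing by natural numbers is no restriction, as every finite
  \<open>Pos\<close>-category and every finite poset has an isomorphic copy on natural numbers.
\<close>

locale finite_weight = pos_category D
  for D :: "(nat, nat) poscat" +
  fixes Wo :: "nat \<Rightarrow> nat rel" and Wa :: "nat \<Rightarrow> nat \<Rightarrow> nat"
  assumes finite_Obj: "finite (Obj D)"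
    and finite_Arr: "finite (Arr D)"
    and finite_Wo: "d \<in> Obj D \<Longrightarrow> finite (Wo d)"
    and Wo_poset: "d \<in> Obj D \<Longrightarrow> Partial_order (Wo d)"
    and Wa_mono: "\<lbrakk>f \<in> hom D d e; (v, w) \<in> Wo d\<rbrakk> \<Longrightarrow> (Wa f v, Wa f w) \<in> Wo e"
    and Wa_Idn: "\<lbrakk>d \<in> Obj D; w \<in> Field (Wo d)\<rbrakk> \<Longrightarrow> Wa (Idn D d) w = w"
    and Wa_Cmp: "\<lbrakk>f \<in> hom D c d; g \<in> hom D d e; w \<in> Field (Wo c)\<rbrakk>
      \<Longrightarrow> Wa (g \<cdot>\<^bsub>D\<^esub> f) w = Wa g (Wa f w)"
    and Wa_Leq: "\<lbrakk>f \<in> hom D d e; g \<in> hom D d e; f \<preceq>\<^bsub>D\<^esub> g; w \<in> Field (Wo d)\<rbrakk>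
      \<Longrightarrow> (Wa f w, Wa g w) \<in> Wo e"

text \<open>Enriched natural transformations from \<open>W\<close> to \<open>C(Z, F -)\<close>.\<close>

definition weighted_cone ::
  "(nat, nat) poscat \<Rightarrow> (nat \<Rightarrow> nat rel) \<Rightarrow> (nat \<Rightarrow> nat \<Rightarrow> nat) \<Rightarrow> ('o, 'a) poscat \<Rightarrow>
   (nat \<Rightarrow> 'o) \<Rightarrow> (nat \<Rightarrow> 'a) \<Rightarrow> 'o \<Rightarrow> (nat \<Rightarrow> nat \<Rightarrow> 'a) \<Rightarrow> bool" where
  "weighted_cone D Wo Wa C Fo Fa Z \<mu> \<longleftrightarrow>
     Z \<in> Obj C \<and>
     (\<forall>d\<in>Obj D. \<forall>w\<in>Field (Wo d). \<mu> d w \<in> hom C Z (Fo d)) \<and>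
     (\<forall>d\<in>Obj D. \<forall>(v, w)\<in>Wo d. \<mu> d v \<preceq>\<^bsub>C\<^esub> \<mu> d w) \<and>
     (\<forall>d\<in>Obj D. \<forall>e\<in>Obj D. \<forall>f\<in>hom D d e. \<forall>w\<in>Field (Wo d).
        Fa f \<cdot>\<^bsub>C\<^esub> \<mu> d w = \<mu> e (Wa f w))"

text \<open>
  The cone \<open>\<kappa>\<close> with vertex \<open>L\<close> induces isomorphisms of posets
  \<open>C(Z, L) \<cong> [D, Pos](W, C(Z, F -))\<close>: the two quantified conditions say that \<open>u \<mapsto> \<kappa> u\<close>
  is surjective and reflects the order.
\<close>

definition is_weighted_limit ::
  "(nat, nat) poscat \<Rightarrow> (nat \<Rightarrow> nat rel) \<Rightarrow> (nat \<Rightarrow> nat \<Rightarrow> nat) \<Rightarrow> ('o, 'a) poscat \<Rightarrow>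
   (nat \<Rightarrow> 'o) \<Rightarrow> (nat \<Rightarrow> 'a) \<Rightarrow> 'o \<Rightarrow> (nat \<Rightarrow> nat \<Rightarrow> 'a) \<Rightarrow> bool" where
  "is_weighted_limit D Wo Wa C Fo Fa L \<kappa> \<longleftrightarrow>
     weighted_cone D Wo Wa C Fo Fa L \<kappa> \<and>
     (\<forall>Z \<mu>. weighted_cone D Wo Wa C Fo Fa Z \<mu> \<longrightarrow>
        (\<exists>u\<in>hom C Z L. \<forall>d\<in>Obj D. \<forall>w\<in>Field (Wo d). \<kappa> d w \<cdot>\<^bsub>C\<^esub> u = \<mu> d w)) \<and>
     (\<forall>Z\<in>Obj C. \<forall>u\<in>hom C Z L. \<forall>v\<in>hom C Z L.
        (\<forall>d\<in>Obj D. \<forall>w\<in>Field (Wo d). \<kappa> d w \<cdot>\<^bsub>C\<^esub> u \<preceq>\<^bsub>C\<^esub> \<kappa> d w \<cdot>\<^bsub>C\<^esub> v) \<longrightarrow> u \<preceq>\<^bsub>C\<^esub> v)"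

definition has_finite_weighted_limits :: "('o, 'a) poscat \<Rightarrow> bool" where
  "has_finite_weighted_limits C \<longleftrightarrow>
     (\<forall>D Wo Wa Fo Fa. finite_weight D Wo Wa \<and> pos_functor D C Fo Fa \<longrightarrow>
        (\<exists>L \<kappa>. is_weighted_limit D Wo Wa C Fo Fa L \<kappa>))"


section \<open>Morphisms, limits and relations in a \<open>Pos\<close>-category\<close>

context
  fixes C :: "('o, 'a) poscat" (structure)
begin

definition ff :: "'a \<Rightarrow> bool" where
  "ff m \<longleftrightarrow> m \<in> Arr C \<and>
     (\<forall>Z\<in>Obj C. \<forall>f\<in>hom C Z (Dom C m). \<forall>g\<in>hom C Z (Dom C m).
        m \<cdot> f \<preceq> m \<cdot> g \<longrightarrow> f \<preceq> g)"

text \<open>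
  For \<open>e : A \<rightarrow> B\<close> and every ff-morphism \<open>m : X \<rightarrow> Y\<close>, the map
  \<open>d \<mapsto> (d e, m d)\<close> from \<open>C(B, X)\<close> to the pullback of \<open>C(A, X)\<close> and \<open>C(B, Y)\<close> over
  \<open>C(A, Y)\<close>, ordered componentwise, is bijective and reflects the order.
\<close>

definition so :: "'a \<Rightarrow> bool" where
  "so e \<longleftrightarrow> e \<in> Arr C \<and>
     (\<forall>m. ff m \<longrightarrow>
        (\<forall>a\<in>hom C (Dom C e) (Dom C m). \<forall>b\<in>hom C (Cod C e) (Cod C m).
           m \<cdot> a = b \<cdot> e \<longrightarrow>
           (\<exists>!d. d \<in> hom C (Cod C e) (Dom C m) \<and> d \<cdot> e = a \<and> m \<cdot> d = b)) \<and>
        (\<forall>d\<in>hom C (Cod C e) (Dom C m). \<forall>d'\<in>hom C (Cod C e) (Dom C m).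
           d \<cdot> e \<preceq> d' \<cdot> e \<and> m \<cdot> d \<preceq> m \<cdot> d' \<longrightarrow> d \<preceq> d'))"

definition jointly_order_mono :: "'a \<Rightarrow> 'a \<Rightarrow> bool" where
  "jointly_order_mono p q \<longleftrightarrow> p \<in> Arr C \<and> q \<in> Arr C \<and> Dom C p = Dom C q \<and>
     (\<forall>Z\<in>Obj C. \<forall>u\<in>hom C Z (Dom C p). \<forall>v\<in>hom C Z (Dom C p).
        p \<cdot> u \<preceq> p \<cdot> v \<and> q \<cdot> u \<preceq> q \<cdot> v \<longrightarrow> u \<preceq> v)"

definition is_product :: "'o \<Rightarrow> 'o \<Rightarrow> 'a \<Rightarrow> 'a \<Rightarrow> bool" where
  "is_product X Y p q \<longleftrightarrow> jointly_order_mono p q \<and> Cod C p = X \<and> Cod C q = Y \<and>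
     (\<forall>Z\<in>Obj C. \<forall>u\<in>hom C Z X. \<forall>v\<in>hom C Z Y.
        \<exists>w\<in>hom C Z (Dom C p). p \<cdot> w = u \<and> q \<cdot> w = v)"

definition is_pullback :: "'a \<Rightarrow> 'a \<Rightarrow> 'a \<Rightarrow> 'a \<Rightarrow> bool" where
  "is_pullback f g p q \<longleftrightarrow> f \<in> Arr C \<and> g \<in> Arr C \<and> Cod C f = Cod C g \<and>
     jointly_order_mono p q \<and> Cod C p = Dom C f \<and> Cod C q = Dom C g \<and> f \<cdot> p = g \<cdot> q \<and>
     (\<forall>Z\<in>Obj C. \<forall>u\<in>hom C Z (Dom C f). \<forall>v\<in>hom C Z (Dom C g). f \<cdot> u = g \<cdot> v \<longrightarrow>
        (\<exists>w\<in>hom C Z (Dom C p). p \<cdot> w = u \<and> q \<cdot> w = v))"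

definition is_comma :: "'a \<Rightarrow> 'a \<Rightarrow> 'a \<Rightarrow> 'a \<Rightarrow> bool" where
  "is_comma f g p q \<longleftrightarrow> f \<in> Arr C \<and> g \<in> Arr C \<and> Cod C f = Cod C g \<and>
     jointly_order_mono p q \<and> Cod C p = Dom C f \<and> Cod C q = Dom C g \<and> f \<cdot> p \<preceq> g \<cdot> q \<and>
     (\<forall>Z\<in>Obj C. \<forall>u\<in>hom C Z (Dom C f). \<forall>v\<in>hom C Z (Dom C g). f \<cdot> u \<preceq> g \<cdot> v \<longrightarrow>
        (\<exists>w\<in>hom C Z (Dom C p). p \<cdot> w = u \<and> q \<cdot> w = v))"

definition chosen_product :: "'o \<Rightarrow> 'o \<Rightarrow> 'a \<times> 'a" where
  "chosen_product X Y = (SOME (p, q). is_product X Y p q)"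

definition proj0 :: "'o \<Rightarrow> 'o \<Rightarrow> 'a" where
  "proj0 X Y = fst (chosen_product X Y)"

definition proj1 :: "'o \<Rightarrow> 'o \<Rightarrow> 'a" where
  "proj1 X Y = snd (chosen_product X Y)"

definition product :: "'o \<Rightarrow> 'o \<Rightarrow> 'o" where
  "product X Y = Dom C (proj0 X Y)"

definition pair :: "'a \<Rightarrow> 'a \<Rightarrow> 'a" where
  "pair x y = (THE u. u \<in> hom C (Dom C x) (product (Cod C x) (Cod C y)) \<and>
     proj0 (Cod C x) (Cod C y) \<cdot> u = x \<and> proj1 (Cod C x) (Cod C y) \<cdot> u = y)"

definition factors :: "'a \<Rightarrow> 'a \<Rightarrow> bool" where
  "factors f m \<longleftrightarrow> (\<exists>k\<in>hom C (Dom C f) (Dom C m). m \<cdot> k = f)"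

text \<open>
  Subobjects are equivalence classes of ff-morphisms, so a relation is a set of arrows into
  the product, namely of all its representatives. Inclusion of relations is therefore
  \<open>rel_le\<close>, not set inclusion.
\<close>

definition subobject_of :: "'a \<Rightarrow> 'a set" where
  "subobject_of m = {n. ff n \<and> Cod C n = Cod C m \<and> factors m n \<and> factors n m}"

definition relation :: "'o \<Rightarrow> 'o \<Rightarrow> 'a set \<Rightarrow> bool" where
  "relation X Y R \<longleftrightarrow> X \<in> Obj C \<and> Y \<in> Obj C \<and>
     (\<exists>m. ff m \<and> Cod C m = product X Y \<and> R = subobject_of m)"

definition rel_le :: "'a set \<Rightarrow> 'a set \<Rightarrow> bool" where
  "rel_le R S \<longleftrightarrow> (\<exists>r\<in>R. \<exists>s\<in>S. factors r s)"

definition rel_mem :: "'a \<Rightarrow> 'a \<Rightarrow> 'a set \<Rightarrow> bool" where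
  "rel_mem x y R \<longleftrightarrow> (\<exists>r\<in>R. factors (pair x y) r)"

text \<open>
  The composite of \<open>R\<close> from \<open>X\<close> to \<open>Y\<close> with \<open>S\<close> from \<open>Y\<close> to \<open>Z\<close>: the ff-parts of all
  (so, ff)-factorizations, for all representatives and pullbacks, make up one subobject of
  the product of \<open>X\<close> and \<open>Z\<close>. Likewise for the comma objects in \<open>comma_rel\<close>.
\<close>

definition rel_comp :: "'o \<Rightarrow> 'o \<Rightarrow> 'o \<Rightarrow> 'a set \<Rightarrow> 'a set \<Rightarrow> 'a set" where
  "rel_comp X Y Z S R =
     {m. ff m \<and> (\<exists>r\<in>R. \<exists>s\<in>S. \<exists>t0 t1 e.
        is_pullback (proj1 X Y \<cdot> r) (proj0 Y Z \<cdot> s) t0 t1 \<and>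
        so e \<and> Cod C e = Dom C m \<and>
        m \<cdot> e = pair ((proj0 X Y \<cdot> r) \<cdot> t0) ((proj1 Y Z \<cdot> s) \<cdot> t1))}"

definition comma_rel :: "'a \<Rightarrow> 'a \<Rightarrow> 'a set" where
  "comma_rel f g = {pair c0 c1 | c0 c1. is_comma f g c0 c1}"

definition weakening_closed :: "'o \<Rightarrow> 'o \<Rightarrow> 'a set \<Rightarrow> bool" where
  "weakening_closed X Y R \<longleftrightarrow>
     (\<forall>A\<in>Obj C. \<forall>x\<in>hom C A X. \<forall>x'\<in>hom C A X. \<forall>y\<in>hom C A Y. \<forall>y'\<in>hom C A Y.
        x' \<preceq> x \<and> rel_mem x y R \<and> y \<preceq> y' \<longrightarrow> rel_mem x' y' R)"

text \<open>Reflexivity and transitivity in the form \<open>I\<^sub>X \<subseteq> E\<close> and \<open>E E \<subseteq> E\<close>.\<close>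

definition congruence :: "'o \<Rightarrow> 'a set \<Rightarrow> bool" where
  "congruence X E \<longleftrightarrow> relation X X E \<and> weakening_closed X X E \<and>
     rel_le (comma_rel (Idn C X) (Idn C X)) E \<and> rel_le (rel_comp X X X E E) E"

definition effective :: "'o \<Rightarrow> 'a set \<Rightarrow> bool" where
  "effective X E \<longleftrightarrow> (\<exists>f\<in>Arr C. Dom C f = X \<and> E = comma_rel f f)"

end


section \<open>Regular and exact categories\<close>

locale regular_category = pos_category C for C :: "('o, 'a) poscat" (structure) +
  assumes finite_weighted_limits: "has_finite_weighted_limits C"
    and so_ff_factorization: "f \<in> Arr C \<Longrightarrow>
      \<exists>e m. so C e \<and> ff C m \<and> Dom C e = Dom C f \<and> Cod C e = Dom C m \<and> m \<cdot> e = f"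
    and so_pullback_stable: "\<lbrakk>is_pullback C f g p q; so C g\<rbrakk> \<Longrightarrow> so C p"

locale exact_category = regular_category +
  assumes congruence_effective: "congruence C X E \<Longrightarrow> effective C X E"


section \<open>The exact completion of a regular category\<close>

text \<open>Arrows are triples consisting of the domain, the underlying relation and the codomain.\<close>

type_synonym ('o, 'a) cobj = "'o \<times> 'a set"
type_synonym ('o, 'a) carr = "('o, 'a) cobj \<times> 'a set \<times> ('o, 'a) cobj"

definition Qw :: "('o, 'a) poscat \<Rightarrow> (('o, 'a) cobj, ('o, 'a) carr) poscat" where
  "Qw C = \<lparr>
     Obj = {(X, E). congruence C X E},
     Arr = {((X, E), \<Phi>, (Y, F)) | X E \<Phi> Y F.
        congruence C X E \<and> congruence C Y F \<and> relation C X Y \<Phi> \<and>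
        rel_comp C X Y Y F (rel_comp C X X Y \<Phi> E) = \<Phi>},
     Dom = (\<lambda>(A, \<Phi>, B). A),
     Cod = (\<lambda>(A, \<Phi>, B). B),
     Idn = (\<lambda>(X, E). ((X, E), E, (X, E))),
     Cmp = (\<lambda>((Y, F), \<Psi>, (Z, G)) ((X, E), \<Phi>, (Y', F')).
        ((X, E), rel_comp C X Y Z \<Psi> \<Phi>, (Z, G))),
     Leq = (\<lambda>(A, \<Phi>, B) (A', \<Psi>, B'). rel_le C \<Phi> \<Psi>)\<rparr>"

definition has_right_adjoint :: "('o, 'a) poscat \<Rightarrow> 'a \<Rightarrow> bool" where
  "has_right_adjoint Q f \<longleftrightarrow> (\<exists>g\<in>hom Q (Cod Q f) (Dom Q f).
     Idn Q (Dom Q f) \<preceq>\<^bsub>Q\<^esub> g \<cdot>\<^bsub>Q\<^esub> f \<and> f \<cdot>\<^bsub>Q\<^esub> g \<preceq>\<^bsub>Q\<^esub> Idn Q (Cod Q f))"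

definition exreg :: "('o, 'a) poscat \<Rightarrow> (('o, 'a) cobj, ('o, 'a) carr) poscat" where
  "exreg C = (Qw C)\<lparr>
     Arr := {f \<in> Arr (Qw C). has_right_adjoint (Qw C) f},
     Leq := (\<lambda>f g. g \<preceq>\<^bsub>Qw C\<^esub> f)\<rparr>"

end

theory Submission
  imports Defs
begin

text \<open>
  A relation in a regular category is treated as a predicate on pairs of generalized elements
  \<open>x : A \<rightarrow> X\<close>, \<open>y : A \<rightarrow> Y\<close> that is stable under restriction and local along so-morphisms;
  composition of relations is then existence after passing to a cover. An object \<open>(X, E)\<close> of the
  completion is the object \<open>X\<close> preordered by \<open>E\<close>, and an arrow is the same as a definable,
  \<open>E\<close>-monotone graph \<open>f x = y\<close> that is total after passing to covers: the graph of the left adjoint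
  \<open>\<Phi>\<close> with right adjoint \<open>\<Psi>\<close> consists of the pairs with \<open>\<Phi>(x, y)\<close> and \<open>\<Psi>(y, x)\<close>.

  In these terms the ff-morphisms are those reflecting the preorders, the so-morphisms are the locally
  surjective ones, and an arrow \<open>f\<close> factors through \<open>X\<close> preordered by \<open>f x \<le> f x'\<close>. A weighted limit
  is the object of compatible families with the componentwise preorder. A congruence on \<open>(X, E)\<close>
  restricts along arrows from discrete objects to a congruence \<open>K \<supseteq> E\<close> on \<open>X\<close>, and it is the comma
  congruence of the arrow from \<open>(X, E)\<close> to \<open>(X, K)\<close>.
\<close>

section \<open>Pos-categories\<close>

text \<open>Elements are arrows of \<open>C\<close> with varying domain, and an existential
  statement holds only over a cover. Values of an arrow of the completion therefore exist locally
  and are unique only up to the congruence of the codomain. This shapes almost every argument: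
  choose values over a common cover, compare them there, and descend, because membership in a
  relation is local along so-morphisms. Equality of arrows is accordingly shown by mutual inequality
  of values and antisymmetry. Antisymmetry is a true equality because a relation is the saturated
  set of all representatives of its subobject. Adjoint pairs serve to show that arrows and monotone,
  locally total graphs amount to the same, and to describe kernels; everything else is done with
  values. The order on arrows reverses inclusion since \<open>\<Phi>(x, y)\<close> says that the
  value at \<open>x\<close> lies below \<open>y\<close>: a larger relation has smaller
  values.\<close>

context pos_category
begin

lemma homD: "f \<in> hom C X Y \<Longrightarrow> f \<in> Arr C \<and> Dom C f = X \<and> Cod C f = Y"
  by (simp add: hom_def)

declare Dom_Obj [simp] Cod_Obj [simp]

lemma Leq_refl_Arr [simp]: "f \<in> Arr C \<Longrightarrow> f \<preceq> f"
  by (rule Leq_refl) (simp add: hom_def)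

lemma hom_Obj: "f \<in> hom C X Y \<Longrightarrow> X \<in> Obj C" "f \<in> hom C X Y \<Longrightarrow> Y \<in> Obj C"
  using Dom_Obj Cod_Obj by (auto simp: hom_def)

lemma Arr_hom: "f \<in> Arr C \<Longrightarrow> f \<in> hom C (Dom C f) (Cod C f)"
  by (simp add: hom_def)

lemma Cmp_Arr [simp]:
  assumes "f \<in> Arr C" "g \<in> Arr C" "Cod C f = Dom C g"
  shows "g \<cdot> f \<in> Arr C" "Dom C (g \<cdot> f) = Dom C f" "Cod C (g \<cdot> f) = Cod C g"
  using Cmp_hom[of f "Dom C f" "Cod C f" g "Cod C g"] assms by (simp_all add: hom_def)

lemma Cmp_assoc_Arr [simp]:
  "\<lbrakk>f \<in> Arr C; g \<in> Arr C; h \<in> Arr C; Cod C f = Dom C g; Cod C g = Dom C h\<rbrakk>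
   \<Longrightarrow> (h \<cdot> g) \<cdot> f = h \<cdot> (g \<cdot> f)"
  by (rule Cmp_assoc) (simp_all add: hom_def)

lemma Idn_Arr [simp]:
  assumes "X \<in> Obj C"
  shows "Idn C X \<in> Arr C" "Dom C (Idn C X) = X" "Cod C (Idn C X) = X"
  using Idn_hom[OF assms] by (simp_all add: hom_def)

lemma Cmp_Idn_Arr [simp]:
  assumes "f \<in> Arr C"
  shows "Cod C f = X \<Longrightarrow> Idn C X \<cdot> f = f" "Dom C f = X \<Longrightarrow> f \<cdot> Idn C X = f"
  using assms by (auto simp: hom_def intro: Cmp_Idn_left Cmp_Idn_right)

lemma ffD: "\<lbrakk>ff C m; f \<in> hom C Z (Dom C m); g \<in> hom C Z (Dom C m); m \<cdot> f \<preceq> m \<cdot> g\<rbrakk> \<Longrightarrow> f \<preceq> g"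
  unfolding ff_def using hom_Obj by blast

lemma ff_cancel:
  assumes "ff C m" "f \<in> hom C Z (Dom C m)" "g \<in> hom C Z (Dom C m)" "m \<cdot> f = m \<cdot> g"
  shows "f = g"
proof -
  have m: "m \<in> hom C (Dom C m) (Cod C m)" using assms(1) by (simp add: ff_def hom_def)
  have "m \<cdot> f \<preceq> m \<cdot> g" "m \<cdot> g \<preceq> m \<cdot> f"
    using Leq_refl Cmp_hom[OF assms(2) m] Cmp_hom[OF assms(3) m] assms(4) by auto
  then show ?thesis using ffD assms Leq_antisym by metis
qed

lemma ff_Arr: "ff C m \<Longrightarrow> m \<in> Arr C" by (simp add: ff_def)

lemma so_Arr: "so C m \<Longrightarrow> m \<in> Arr C" by (simp add: so_def)

text \<open>An ff-morphism reflects the order and is left-cancellable, which yields the uniqueness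
  and order clauses of \<open>so\<close>; what remains is the existence of a diagonal.\<close>

lemma soI:
  assumes e: "e \<in> Arr C"
    and lift: "\<And>m a b. \<lbrakk>ff C m; a \<in> hom C (Dom C e) (Dom C m); b \<in> hom C (Cod C e) (Cod C m);
      m \<cdot> a = b \<cdot> e\<rbrakk> \<Longrightarrow> \<exists>d\<in>hom C (Cod C e) (Dom C m). d \<cdot> e = a \<and> m \<cdot> d = b"
  shows "so C e"
  unfolding so_def
proof (intro conjI allI impI ballI)
  fix m a b assume m: "ff C m" and "a \<in> hom C (Dom C e) (Dom C m)"
    "b \<in> hom C (Cod C e) (Cod C m)" "m \<cdot> a = b \<cdot> e"
  then obtain d where "d \<in> hom C (Cod C e) (Dom C m)" "d \<cdot> e = a" "m \<cdot> d = b"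
    using lift by blast
  then show "\<exists>!d. d \<in> hom C (Cod C e) (Dom C m) \<and> d \<cdot> e = a \<and> m \<cdot> d = b"
    using ff_cancel[OF m] by blast
qed (use e ffD in auto)

lemma so_lift:
  assumes "so C e" "ff C m" "a \<in> hom C (Dom C e) (Dom C m)" "b \<in> hom C (Cod C e) (Cod C m)"
    "m \<cdot> a = b \<cdot> e"
  obtains d where "d \<in> hom C (Cod C e) (Dom C m)" "d \<cdot> e = a" "m \<cdot> d = b"
  using assms unfolding so_def by blast

lemma so_Cmp:
  assumes "so C e" "so C e'" "Cod C e' = Dom C e"
  shows "so C (e \<cdot> e')"
proof (rule soI)
  have [simp]: "e \<in> Arr C" "e' \<in> Arr C" using assms so_Arr by auto
  show "e \<cdot> e' \<in> Arr C" using assms by simp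
  fix m a b
  assume m: "ff C m" and a: "a \<in> hom C (Dom C (e \<cdot> e')) (Dom C m)"
    and b: "b \<in> hom C (Cod C (e \<cdot> e')) (Cod C m)" and eq: "m \<cdot> a = b \<cdot> e \<cdot> e'"
  have [simp]: "m \<in> Arr C" using m ff_Arr by auto
  have b': "b \<cdot> e \<in> hom C (Cod C e') (Cod C m)" using b assms by (simp add: hom_def)
  obtain d where d: "d \<in> hom C (Cod C e') (Dom C m)" "d \<cdot> e' = a" "m \<cdot> d = b \<cdot> e"
    using so_lift[OF assms(2) m, of a "b \<cdot> e"] a b b' eq assms(3) by (auto simp: hom_def)
  obtain d' where d': "d' \<in> hom C (Cod C e) (Dom C m)" "d' \<cdot> e = d" "m \<cdot> d' = b"
    using so_lift[OF assms(1) m, of d b] d(1,3) b assms(3) by (auto simp: hom_def)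
  have "d' \<cdot> (e \<cdot> e') = a" using d d' assms(3) by (simp add: hom_def flip: Cmp_assoc_Arr)
  then show "\<exists>d\<in>hom C (Cod C (e \<cdot> e')) (Dom C m). d \<cdot> (e \<cdot> e') = a \<and> m \<cdot> d = b"
    using d' assms(3) by auto
qed

text \<open>The diagonal is \<open>a \<cdot> k'\<close>. The purpose is a change of representatives
  in composites of relations: an so-part followed by an isomorphism is again an so-part.\<close>

lemma iso_so:
  assumes "k \<in> hom C X Y" "k' \<in> hom C Y X" "k' \<cdot> k = Idn C X" "k \<cdot> k' = Idn C Y"
  shows "so C k"
proof (rule soI)
  show "k \<in> Arr C" using assms by (simp add: hom_def)
  fix m a b
  assume m: "ff C m" and a: "a \<in> hom C (Dom C k) (Dom C m)"
    and b: "b \<in> hom C (Cod C k) (Cod C m)" and eq: "m \<cdot> a = b \<cdot> k"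
  have [simp]: "m \<in> Arr C" using m ff_Arr by auto
  have "m \<cdot> (a \<cdot> k') = (m \<cdot> a) \<cdot> k'" using a assms by (simp add: hom_def)
  also have "\<dots> = b \<cdot> (k \<cdot> k')" using a b assms eq by (simp add: hom_def)
  also have "\<dots> = b" using b assms by (simp add: hom_def)
  finally have "m \<cdot> (a \<cdot> k') = b" .
  moreover have "(a \<cdot> k') \<cdot> k = a" using a assms by (simp add: hom_def)
  ultimately show "\<exists>d\<in>hom C (Cod C k) (Dom C m). d \<cdot> k = a \<and> m \<cdot> d = b"
    using a assms by (intro bexI[of _ "a \<cdot> k'"]) (auto simp: hom_def)
qed

lemma so_Idn: "X \<in> Obj C \<Longrightarrow> so C (Idn C X)"
  by (rule iso_so[of _ X X "Idn C X"]) (auto simp: hom_def)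

lemma jointly_order_monoD:
  "\<lbrakk>jointly_order_mono C p q; u \<in> hom C Z (Dom C p); v \<in> hom C Z (Dom C p);
    p \<cdot> u \<preceq> p \<cdot> v; q \<cdot> u \<preceq> q \<cdot> v\<rbrakk> \<Longrightarrow> u \<preceq> v"
  unfolding jointly_order_mono_def using hom_Obj by blast

lemma jointly_order_mono_cancel:
  assumes "jointly_order_mono C p q" "u \<in> hom C Z (Dom C p)" "v \<in> hom C Z (Dom C p)"
    "p \<cdot> u = p \<cdot> v" "q \<cdot> u = q \<cdot> v"
  shows "u = v"
proof -
  have pq: "p \<in> hom C (Dom C p) (Cod C p)" "q \<in> hom C (Dom C p) (Cod C q)"
    using assms(1) by (auto simp: jointly_order_mono_def hom_def)
  have "p \<cdot> u \<preceq> p \<cdot> v" "q \<cdot> u \<preceq> q \<cdot> v" "p \<cdot> v \<preceq> p \<cdot> u" "q \<cdot> v \<preceq> q \<cdot> u"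
    using Leq_refl Cmp_hom[OF assms(2) pq(1)] Cmp_hom[OF assms(2) pq(2)] assms(4,5) by auto
  then show ?thesis using jointly_order_monoD assms Leq_antisym by metis
qed

end

section \<open>Limits from weighted limits\<close>

text \<open>A cospan with legs \<open>3\<close> from \<open>0\<close> and \<open>4\<close> from
  \<open>1\<close> into \<open>2\<close>; the arrows \<open>0\<close>, \<open>1\<close>,
  \<open>2\<close> are identities. One factor of any composite is an identity, which explains
  \<open>Cmp\<close>: if \<open>f\<close> is a leg then \<open>g\<close> is the identity of
  \<open>2\<close>, and otherwise \<open>f\<close> is an identity and the composite is
  \<open>g\<close>.\<close>

definition cospan_cat :: "(nat, nat) poscat" where
  "cospan_cat = \<lparr>Obj = {0, 1, 2}, Arr = {0, 1, 2, 3, 4},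
     Dom = (\<lambda>f. if f = 3 then 0 else if f = 4 then 1 else f),
     Cod = (\<lambda>f. if f = 3 \<or> f = 4 then 2 else f),
     Idn = (\<lambda>d. d), Cmp = (\<lambda>g f. if f = 3 \<or> f = 4 then f else g), Leq = (=)\<rparr>"

text \<open>For \<open>c = 0\<close> this weight describes pullbacks, for \<open>c = 1\<close> comma objects.\<close>

definition cospan_Wo :: "nat \<Rightarrow> nat \<Rightarrow> nat rel" where
  "cospan_Wo c d = (if d = 2 then {(0, 0), (0, c), (c, c)} else {(0, 0)})"

text \<open>Leg \<open>3\<close> picks the lower point \<open>0\<close> of the weight at
  \<open>2\<close> and leg \<open>4\<close> the upper point \<open>c\<close>. So a cone is an
  inequality between the composites with the legs, and for \<open>c = 0\<close>, where the two
  points coincide, an equation.\<close>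

definition cospan_Wa :: "nat \<Rightarrow> nat \<Rightarrow> nat \<Rightarrow> nat" where
  "cospan_Wa c f v = (if f = 4 then c else if f = 3 then 0 else v)"

lemma Field_cospan_Wo: "Field (cospan_Wo c d) = (if d = 2 then {0, c} else {0})"
  by (auto simp: cospan_Wo_def Field_def)

lemma finite_weight_cospan: "finite_weight cospan_cat (cospan_Wo c) (cospan_Wa c)"
proof
  show "Partial_order (cospan_Wo c d)" for d
    by (auto simp: cospan_Wo_def partial_order_on_def preorder_on_def refl_on_def trans_def
        antisym_def Field_def split: if_splits)
qed (auto simp: cospan_cat_def cospan_Wo_def cospan_Wa_def hom_def Field_def split: if_splits)

context regular_category
begin

text \<open>Naturality forces the components of a cone at \<open>2\<close> to be the composites with
  \<open>f\<close> and \<open>g\<close>, so a cone is a pair \<open>u\<close>, \<open>v\<close>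
  subject to the order of the weight at \<open>2\<close>. For the same reason order reflection by
  all components reduces to the components at \<open>0\<close> and \<open>1\<close>.\<close>

lemma ex_cospan_limit:
  fixes c :: nat
  assumes f: "f \<in> hom C X Z" and g: "g \<in> hom C Y Z"
  shows "\<exists>p q. jointly_order_mono C p q \<and> Cod C p = X \<and> Cod C q = Y \<and>
    f \<cdot> p \<preceq> g \<cdot> q \<and> (c = 0 \<longrightarrow> f \<cdot> p = g \<cdot> q) \<and>
    (\<forall>A\<in>Obj C. \<forall>u\<in>hom C A X. \<forall>v\<in>hom C A Y. f \<cdot> u \<preceq> g \<cdot> v \<and> (c = 0 \<longrightarrow> f \<cdot> u = g \<cdot> v)
      \<longrightarrow> (\<exists>w\<in>hom C A (Dom C p). p \<cdot> w = u \<and> q \<cdot> w = v))"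
proof -
  define Fo where "Fo d = (if d = 0 then X else if d = 1 then Y else Z)" for d :: nat
  define Fa where "Fa h = (if h = 0 then Idn C X else if h = 1 then Idn C Y
    else if h = 2 then Idn C Z else if h = 3 then f else g)" for h :: nat
  have o [simp]: "X \<in> Obj C" "Y \<in> Obj C" "Z \<in> Obj C" using f g hom_Obj by auto
  interpret w: finite_weight cospan_cat "cospan_Wo c" "cospan_Wa c"
    by (rule finite_weight_cospan)
  have fa: "f \<in> Arr C" "Dom C f = X" "Cod C f = Z" "g \<in> Arr C" "Dom C g = Y" "Cod C g = Z"
    using f g by (auto simp: hom_def)
  have "pos_functor cospan_cat C Fo Fa"
  proof
    show "Fa k \<preceq> Fa h" if "k \<in> hom cospan_cat d e" "h \<in> hom cospan_cat d e" "k \<preceq>\<^bsub>cospan_cat\<^esub> h"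
      for k h d e
      using that fa by (auto simp: cospan_cat_def hom_def Fo_def Fa_def)
  qed (use fa in \<open>auto simp: cospan_cat_def hom_def Fo_def Fa_def split: if_splits\<close>)
  then obtain L \<kappa> where lim: "is_weighted_limit cospan_cat (cospan_Wo c) (cospan_Wa c) C Fo Fa L \<kappa>"
    using finite_weighted_limits w.finite_weight_axioms unfolding has_finite_weighted_limits_def
    by meson
  have objs: "Obj cospan_cat = {0, 1, 2}" by (simp add: cospan_cat_def)
  have h3: "3 \<in> hom cospan_cat 0 2" and h4: "4 \<in> hom cospan_cat 1 2"
    by (auto simp: cospan_cat_def hom_def)
  have cone: "weighted_cone cospan_cat (cospan_Wo c) (cospan_Wa c) C Fo Fa L \<kappa>"
    using lim by (simp add: is_weighted_limit_def)
  then have hms: "\<forall>d\<in>{0,1,2}. \<forall>w\<in>Field (cospan_Wo c d). \<kappa> d w \<in> hom C L (Fo d)"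
    and ord: "\<forall>d\<in>{0,1,2}. \<forall>(v, w)\<in>cospan_Wo c d. \<kappa> d v \<preceq> \<kappa> d w"
    and nat: "\<forall>d\<in>{0,1,2}. \<forall>e\<in>{0,1,2}. \<forall>f\<in>hom cospan_cat d e. \<forall>w\<in>Field (cospan_Wo c d).
        Fa f \<cdot> \<kappa> d w = \<kappa> e (cospan_Wa c f w)"
    unfolding weighted_cone_def objs by blast+
  have p: "\<kappa> 0 0 \<in> hom C L X" and q: "\<kappa> 1 0 \<in> hom C L Y"
    using hms by (auto simp: Field_cospan_Wo Fo_def)
  have e3: "f \<cdot> \<kappa> 0 0 = \<kappa> 2 0" using nat h3 by (force simp: Field_cospan_Wo Fa_def cospan_Wa_def)
  have e4: "g \<cdot> \<kappa> 1 0 = \<kappa> 2 c" using nat h4 by (force simp: Field_cospan_Wo Fa_def cospan_Wa_def)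
  have l: "\<kappa> 2 0 \<preceq> \<kappa> 2 c" using ord by (auto simp: cospan_Wo_def)
  have refl: "u \<preceq> v" if u: "u \<in> hom C A L" and v: "v \<in> hom C A L"
    and 0: "\<kappa> 0 0 \<cdot> u \<preceq> \<kappa> 0 0 \<cdot> v" and 1: "\<kappa> 1 0 \<cdot> u \<preceq> \<kappa> 1 0 \<cdot> v" for A u v
  proof -
    have A: "A \<in> Obj C" using u hom_Obj by auto
    have "(f \<cdot> \<kappa> 0 0) \<cdot> u = f \<cdot> (\<kappa> 0 0 \<cdot> u)" "(f \<cdot> \<kappa> 0 0) \<cdot> v = f \<cdot> (\<kappa> 0 0 \<cdot> v)"
      "(g \<cdot> \<kappa> 1 0) \<cdot> u = g \<cdot> (\<kappa> 1 0 \<cdot> u)" "(g \<cdot> \<kappa> 1 0) \<cdot> v = g \<cdot> (\<kappa> 1 0 \<cdot> v)"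
      using f g p q u v by (simp_all add: hom_def)
    moreover have "f \<cdot> (\<kappa> 0 0 \<cdot> u) \<preceq> f \<cdot> (\<kappa> 0 0 \<cdot> v)"
      using Cmp_mono_right[OF Cmp_hom[OF u p] Cmp_hom[OF v p] f 0] .
    moreover have "g \<cdot> (\<kappa> 1 0 \<cdot> u) \<preceq> g \<cdot> (\<kappa> 1 0 \<cdot> v)"
      using Cmp_mono_right[OF Cmp_hom[OF u q] Cmp_hom[OF v q] g 1] .
    ultimately have "\<kappa> 2 0 \<cdot> u \<preceq> \<kappa> 2 0 \<cdot> v" "\<kappa> 2 c \<cdot> u \<preceq> \<kappa> 2 c \<cdot> v"
      unfolding e3 e4 by auto
    then have "\<forall>d\<in>Obj cospan_cat. \<forall>w\<in>Field (cospan_Wo c d). \<kappa> d w \<cdot> u \<preceq> \<kappa> d w \<cdot> v"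
      using 0 1 by (auto simp: objs Field_cospan_Wo)
    then show ?thesis using lim A u v unfolding is_weighted_limit_def by blast
  qed
  have jom: "jointly_order_mono C (\<kappa> 0 0) (\<kappa> 1 0)"
    unfolding jointly_order_mono_def using p q refl by (auto simp: hom_def)
  have univ: "\<exists>w\<in>hom C A L. \<kappa> 0 0 \<cdot> w = u \<and> \<kappa> 1 0 \<cdot> w = v"
    if A: "A \<in> Obj C" and u: "u \<in> hom C A X" and v: "v \<in> hom C A Y"
      and le: "f \<cdot> u \<preceq> g \<cdot> v" and eq: "c = 0 \<longrightarrow> f \<cdot> u = g \<cdot> v" for A u v
  proof -
    \<comment> \<open>For \<open>c = 0\<close> the weight at \<open>2\<close> has the single point
      \<open>0\<close>, and \<open>f \<cdot> u\<close> and \<open>g \<cdot> v\<close> agree by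
      assumption, so the case split on \<open>w\<close> does no harm.\<close>
    define \<mu> where "\<mu> d w = (if d = 0 then u else if d = 1 then v
      else if w = 0 then f \<cdot> u else g \<cdot> v)" for d w :: nat
    have fu: "f \<cdot> u \<in> hom C A Z" "g \<cdot> v \<in> hom C A Z" using Cmp_hom u v f g by auto
    have lr: "u \<preceq> u" "v \<preceq> v" "f \<cdot> u \<preceq> f \<cdot> u" "g \<cdot> v \<preceq> g \<cdot> v"
      using u v fu Leq_refl by blast+
    have uA: "u \<in> Arr C" "Cod C u = X" "v \<in> Arr C" "Cod C v = Y" using u v by (auto simp: hom_def)
    have "weighted_cone cospan_cat (cospan_Wo c) (cospan_Wa c) C Fo Fa A \<mu>"
      unfolding weighted_cone_def
    proof (intro conjI)
      show "A \<in> Obj C" by fact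
      show "\<forall>d\<in>Obj cospan_cat. \<forall>w\<in>Field (cospan_Wo c d). \<mu> d w \<in> hom C A (Fo d)"
        using u v fu by (auto simp: objs Field_cospan_Wo \<mu>_def Fo_def)
      show "\<forall>d\<in>Obj cospan_cat. \<forall>(v, w)\<in>cospan_Wo c d. \<mu> d v \<preceq> \<mu> d w"
        using lr le eq by (auto simp: objs cospan_Wo_def \<mu>_def)
      show "\<forall>d\<in>Obj cospan_cat. \<forall>e\<in>Obj cospan_cat. \<forall>f\<in>hom cospan_cat d e.
        \<forall>w\<in>Field (cospan_Wo c d). Fa f \<cdot> \<mu> d w = \<mu> e (cospan_Wa c f w)"
        using eq uA fa by (auto simp: objs Field_cospan_Wo \<mu>_def Fa_def cospan_Wa_def hom_def
            cospan_cat_def)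
    qed
    then obtain w where "w \<in> hom C A L"
      "\<forall>d\<in>Obj cospan_cat. \<forall>w'\<in>Field (cospan_Wo c d). \<kappa> d w' \<cdot> w = \<mu> d w'"
      using lim unfolding is_weighted_limit_def by blast
    then show ?thesis by (intro bexI[of _ w]) (auto simp: objs Field_cospan_Wo \<mu>_def)
  qed
  show ?thesis
    using jom p q e3 e4 l univ by (intro exI[of _ "\<kappa> 0 0"] exI[of _ "\<kappa> 1 0"]) (auto simp: hom_def)
qed

lemma ex_pullback:
  assumes f: "f \<in> hom C X Z" and g: "g \<in> hom C Y Z"
  obtains p q where "is_pullback C f g p q"
proof -
  obtain p q where pq: "jointly_order_mono C p q" "Cod C p = X" "Cod C q = Y" "f \<cdot> p = g \<cdot> q"
    and univ: "\<And>A u v. \<lbrakk>A \<in> Obj C; u \<in> hom C A X; v \<in> hom C A Y; f \<cdot> u \<preceq> g \<cdot> v; f \<cdot> u = g \<cdot> v\<rbrakk>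
      \<Longrightarrow> \<exists>w\<in>hom C A (Dom C p). p \<cdot> w = u \<and> q \<cdot> w = v"
    using ex_cospan_limit[OF f g, of 0] by auto
  have "f \<cdot> u \<preceq> g \<cdot> v" if "u \<in> hom C A X" "f \<cdot> u = g \<cdot> v" for A u v
    using that Leq_refl[OF Cmp_hom[OF that(1) f]] by auto
  then have "is_pullback C f g p q"
    using pq univ homD[OF f] homD[OF g] unfolding is_pullback_def by auto
  then show ?thesis by (rule that)
qed

lemma ex_comma:
  assumes f: "f \<in> hom C X Z" and g: "g \<in> hom C Y Z"
  obtains p q where "is_comma C f g p q"
proof -
  obtain p q where pq: "jointly_order_mono C p q" "Cod C p = X" "Cod C q = Y" "f \<cdot> p \<preceq> g \<cdot> q"
    and univ: "\<And>A u v. \<lbrakk>A \<in> Obj C; u \<in> hom C A X; v \<in> hom C A Y; f \<cdot> u \<preceq> g \<cdot> v\<rbrakk>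
      \<Longrightarrow> \<exists>w\<in>hom C A (Dom C p). p \<cdot> w = u \<and> q \<cdot> w = v"
    using ex_cospan_limit[OF f g, of 1] by auto
  have "is_comma C f g p q"
    using pq univ homD[OF f] homD[OF g] unfolding is_comma_def by auto
  then show ?thesis by (rule that)
qed

text \<open>The limit of the empty diagram: every object is the vertex of an empty cone, and order
  reflection has an empty premise, so parallel arrows into the limit lie below each other and
  antisymmetry makes them equal.\<close>

lemma ex_terminal:
  "\<exists>T\<in>Obj C. (\<forall>A\<in>Obj C. \<exists>u. u \<in> hom C A T) \<and> (\<forall>A u v. u \<in> hom C A T \<longrightarrow> v \<in> hom C A T \<longrightarrow> u = v)"
proof -
  define D :: "(nat, nat) poscat" where "D = \<lparr>Obj = {}, Arr = {}, Dom = (\<lambda>f. f), Cod = (\<lambda>f. f),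
     Idn = (\<lambda>d. d), Cmp = (\<lambda>g f. f), Leq = (=)\<rparr>"
  have D: "Obj D = {}" "Arr D = {}" by (simp_all add: D_def)
  interpret D: pos_category D by standard (auto simp: D hom_def)
  have "finite_weight D (\<lambda>_. {}) (\<lambda>_ v. v)" by standard (auto simp: D hom_def)
  moreover have "pos_functor D C (\<lambda>_. undefined) (\<lambda>_. undefined)"
    by standard (auto simp: D hom_def)
  ultimately obtain L \<kappa> where
    lim: "is_weighted_limit D (\<lambda>_. {}) (\<lambda>_ v. v) C (\<lambda>_. undefined) (\<lambda>_. undefined) L \<kappa>"
    using finite_weighted_limits unfolding has_finite_weighted_limits_def by meson
  have L: "L \<in> Obj C" using lim by (simp add: is_weighted_limit_def weighted_cone_def)
  have ex: "\<exists>u. u \<in> hom C A L" if "A \<in> Obj C" for A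
    using lim that by (auto simp: is_weighted_limit_def weighted_cone_def D)
  have le: "u \<preceq> v" if "u \<in> hom C A L" "v \<in> hom C A L" for A u v
    using lim that hom_Obj(1)[OF that(1)] by (simp add: is_weighted_limit_def D)
  have "u = v" if "u \<in> hom C A L" "v \<in> hom C A L" for A u v
    by (rule Leq_antisym[OF that le[OF that] le[OF that(2,1)]])
  then show ?thesis using L ex by blast
qed

text \<open>A pullback over the terminal object, where the compatibility condition always
  holds.\<close>

lemma ex_product:
  assumes "X \<in> Obj C" "Y \<in> Obj C"
  shows "\<exists>p q. is_product C X Y p q"
proof -
  obtain T where T: "\<forall>A\<in>Obj C. \<exists>u. u \<in> hom C A T"
    "\<forall>A u v. u \<in> hom C A T \<longrightarrow> v \<in> hom C A T \<longrightarrow> u = v"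
    using ex_terminal by blast
  obtain f g where fg: "f \<in> hom C X T" "g \<in> hom C Y T" using T(1) assms by blast
  obtain p q where pb: "is_pullback C f g p q" using ex_pullback[OF fg] .
  have eq: "f \<cdot> u = g \<cdot> v" if "u \<in> hom C A X" "v \<in> hom C A Y" for A u v
    using T(2) Cmp_hom[OF that(1) fg(1)] Cmp_hom[OF that(2) fg(2)] by blast
  have pq: "jointly_order_mono C p q" "Cod C p = X" "Cod C q = Y"
    and univ: "\<forall>A\<in>Obj C. \<forall>u\<in>hom C A X. \<forall>v\<in>hom C A Y. f \<cdot> u = g \<cdot> v \<longrightarrow>
      (\<exists>w\<in>hom C A (Dom C p). p \<cdot> w = u \<and> q \<cdot> w = v)"
    using pb homD[OF fg(1)] homD[OF fg(2)] unfolding is_pullback_def by simp_all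
  then have "is_product C X Y p q"
    unfolding is_product_def using eq by blast
  then show ?thesis by blast
qed

end

section \<open>Relations and generalized elements\<close>

context regular_category
begin

section \<open>Chosen products and pairing\<close>

lemma is_product_proj:
  assumes "X \<in> Obj C" "Y \<in> Obj C"
  shows "is_product C X Y (proj0 C X Y) (proj1 C X Y)"
proof -
  have "\<exists>z. case z of (p, q) \<Rightarrow> is_product C X Y p q" using ex_product[OF assms] by auto
  from someI_ex[OF this] show ?thesis
    by (simp add: proj0_def proj1_def chosen_product_def split: prod.splits)
qed

lemma proj_hom:
  assumes "X \<in> Obj C" "Y \<in> Obj C"
  shows "proj0 C X Y \<in> hom C (product C X Y) X" "proj1 C X Y \<in> hom C (product C X Y) Y"
  using is_product_proj[OF assms]
  by (auto simp: is_product_def jointly_order_mono_def hom_def product_def)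

lemma product_Obj: "\<lbrakk>X \<in> Obj C; Y \<in> Obj C\<rbrakk> \<Longrightarrow> product C X Y \<in> Obj C"
  using proj_hom hom_Obj by blast

lemma product_order_mono:
  assumes "X \<in> Obj C" "Y \<in> Obj C" "r \<in> hom C A (product C X Y)" "s \<in> hom C A (product C X Y)"
    "proj0 C X Y \<cdot> r \<preceq> proj0 C X Y \<cdot> s" "proj1 C X Y \<cdot> r \<preceq> proj1 C X Y \<cdot> s"
  shows "r \<preceq> s"
  using is_product_proj[OF assms(1,2)] assms(3-) jointly_order_monoD
  unfolding is_product_def product_def by blast

lemma product_cancel:
  assumes "X \<in> Obj C" "Y \<in> Obj C" "r \<in> hom C A (product C X Y)" "s \<in> hom C A (product C X Y)"
    "proj0 C X Y \<cdot> r = proj0 C X Y \<cdot> s" "proj1 C X Y \<cdot> r = proj1 C X Y \<cdot> s"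
  shows "r = s"
  using is_product_proj[OF assms(1,2)] assms(3-) jointly_order_mono_cancel
  unfolding is_product_def product_def by blast

lemma pair_hom:
  assumes x: "x \<in> hom C A X" and y: "y \<in> hom C A Y"
  shows "pair C x y \<in> hom C A (product C X Y)" (is ?A)
    and "proj0 C X Y \<cdot> pair C x y = x" (is ?B)
    and "proj1 C X Y \<cdot> pair C x y = y" (is ?C)
proof -
  have o: "X \<in> Obj C" "Y \<in> Obj C" "A \<in> Obj C" using x y hom_Obj by auto
  have "\<exists>!u. u \<in> hom C A (product C X Y) \<and> proj0 C X Y \<cdot> u = x \<and> proj1 C X Y \<cdot> u = y"
  proof (rule ex_ex1I)
    show "\<exists>u. u \<in> hom C A (product C X Y) \<and> proj0 C X Y \<cdot> u = x \<and> proj1 C X Y \<cdot> u = y"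
      using is_product_proj[OF o(1,2)] o(3) x y unfolding is_product_def product_def by blast
  qed (use product_cancel[OF o(1,2)] in metis)
  from theI'[OF this] show ?A ?B ?C
    using homD[OF x] homD[OF y] by (simp_all add: pair_def)
qed

lemma pair_eqI:
  assumes "r \<in> hom C A (product C X Y)" "X \<in> Obj C" "Y \<in> Obj C"
    "proj0 C X Y \<cdot> r = x" "proj1 C X Y \<cdot> r = y"
  shows "r = pair C x y"
proof -
  have xy: "x \<in> hom C A X" "y \<in> hom C A Y"
    using assms Cmp_hom proj_hom by blast+
  show ?thesis by (rule product_cancel[of X Y _ A]) (use assms pair_hom[OF xy] in auto)
qed

lemma pair_Cmp:
  assumes x: "x \<in> hom C A X" and y: "y \<in> hom C A Y" and u: "u \<in> hom C B A"
  shows "pair C x y \<cdot> u = pair C (x \<cdot> u) (y \<cdot> u)"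
proof -
  have o: "X \<in> Obj C" "Y \<in> Obj C" using x y hom_Obj by auto
  note p = pair_hom[OF x y] proj_hom[OF o]
  show ?thesis
  proof (rule pair_eqI[OF Cmp_hom[OF u p(1)] o])
    show "proj0 C X Y \<cdot> pair C x y \<cdot> u = x \<cdot> u" "proj1 C X Y \<cdot> pair C x y \<cdot> u = y \<cdot> u"
      using Cmp_assoc[OF u p(1) p(4)] Cmp_assoc[OF u p(1) p(5)] p(2,3) by auto
  qed
qed

lemma pair_inject:
  assumes "x \<in> hom C A X" "y \<in> hom C A Y" "x' \<in> hom C A X" "y' \<in> hom C A Y"
    "pair C x y = pair C x' y'"
  shows "x = x'" "y = y'"
  using pair_hom[OF assms(1,2)] pair_hom[OF assms(3,4)] assms(5) by auto

text \<open>The projections jointly reflect the order, so comparing composites with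
  \<open>pair C x y\<close> means comparing both coordinates. This identifies subobjects of a
  product with jointly order-monomorphic spans.\<close>

lemma ff_pair_iff:
  assumes x: "x \<in> hom C A X" and y: "y \<in> hom C A Y"
  shows "ff C (pair C x y) \<longleftrightarrow> jointly_order_mono C x y"
proof -
  have o: "X \<in> Obj C" "Y \<in> Obj C" using x y hom_Obj by auto
  note p = pair_hom[OF x y] proj_hom[OF o]
  have "pair C x y \<cdot> u \<preceq> pair C x y \<cdot> v \<longleftrightarrow> x \<cdot> u \<preceq> x \<cdot> v \<and> y \<cdot> u \<preceq> y \<cdot> v"
    if u: "u \<in> hom C B A" and v: "v \<in> hom C B A" for u v B
  proof -
    have pu: "pair C x y \<cdot> u \<in> hom C B (product C X Y)" "pair C x y \<cdot> v \<in> hom C B (product C X Y)"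
      using Cmp_hom u v p(1) by blast+
    have e: "proj0 C X Y \<cdot> pair C x y \<cdot> u = x \<cdot> u" "proj1 C X Y \<cdot> pair C x y \<cdot> u = y \<cdot> u"
      "proj0 C X Y \<cdot> pair C x y \<cdot> v = x \<cdot> v" "proj1 C X Y \<cdot> pair C x y \<cdot> v = y \<cdot> v"
      using Cmp_assoc[OF u p(1) p(4)] Cmp_assoc[OF u p(1) p(5)]
        Cmp_assoc[OF v p(1) p(4)] Cmp_assoc[OF v p(1) p(5)] p(2,3) by auto
    show ?thesis
      using product_order_mono[OF o pu] Cmp_mono_right[OF pu p(4)] Cmp_mono_right[OF pu p(5)]
      unfolding e by blast
  qed
  then show ?thesis
    unfolding ff_def jointly_order_mono_def using homD[OF x] homD[OF y] homD[OF p(1)] by auto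
qed

section \<open>Relations as predicates on generalized elements\<close>

lemma factors_trans: "\<lbrakk>factors C f m; factors C m n; n \<in> Arr C\<rbrakk> \<Longrightarrow> factors C f n"
proof -
  assume "factors C f m" "factors C m n" and n: "n \<in> Arr C"
  then obtain k l where "k \<in> hom C (Dom C f) (Dom C m)" "m \<cdot> k = f"
    "l \<in> hom C (Dom C m) (Dom C n)" "n \<cdot> l = m"
    unfolding factors_def by blast
  moreover from this have "l \<cdot> k \<in> hom C (Dom C f) (Dom C n)" using Cmp_hom by blast
  moreover from calculation have "n \<cdot> (l \<cdot> k) = f"
    using Cmp_assoc[of k "Dom C f" "Dom C m" l "Dom C n" n "Cod C n"] Arr_hom[OF n] by simp
  ultimately show ?thesis unfolding factors_def by blast
qed

lemma factors_refl: "f \<in> Arr C \<Longrightarrow> factors C f f"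
  unfolding factors_def by (rule bexI[of _ "Idn C (Dom C f)"]) (auto simp: hom_def)

text \<open>The stage \<open>A\<close> and both types are built in, since \<open>pair\<close> is a
  definite description that says nothing about ill-typed arrows. A relation thus becomes one
  predicate that can be compared with others extensionally.\<close>

definition mem :: "'o \<Rightarrow> 'o \<Rightarrow> 'a set \<Rightarrow> 'o \<Rightarrow> 'a \<Rightarrow> 'a \<Rightarrow> bool" where
  "mem X Y R A x y \<longleftrightarrow> x \<in> hom C A X \<and> y \<in> hom C A Y \<and> rel_mem C x y R"

abbreviation cover :: "'a \<Rightarrow> 'o \<Rightarrow> 'o \<Rightarrow> bool" where
  "cover e B A \<equiv> so C e \<and> e \<in> hom C B A"

lemma mem_hom: "mem X Y R A x y \<Longrightarrow> x \<in> hom C A X \<and> y \<in> hom C A Y"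
  by (simp add: mem_def)

lemma cover_Cmp: "\<lbrakk>cover e B A; cover e' B' B\<rbrakk> \<Longrightarrow> cover (e \<cdot> e') B' A"
  using so_Cmp[of e e'] Cmp_hom[of e' B' B e A] homD[of e B A] homD[of e' B' B] by simp

lemma cover_Idn: "A \<in> Obj C \<Longrightarrow> cover (Idn C A) A A"
  using so_Idn Idn_hom by auto

lemma relation_Obj: "relation C X Y R \<Longrightarrow> X \<in> Obj C \<and> Y \<in> Obj C"
  by (simp add: relation_def)

lemma subobject_of_eqI:
  assumes "ff C m" "ff C n" "Cod C m = Cod C n" "factors C m n" "factors C n m"
  shows "subobject_of C m = subobject_of C n"
proof -
  have "m \<in> Arr C" "n \<in> Arr C" using assms ff_Arr by auto
  then have "factors C m k \<longleftrightarrow> factors C n k" "factors C k m \<longleftrightarrow> factors C k n" if "ff C k" for k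
    using factors_trans assms(4,5) ff_Arr[OF that] by blast+
  then show ?thesis unfolding subobject_of_def using assms(3) by auto
qed

lemma relation_repD:
  assumes "relation C X Y R" "r \<in> R"
  shows "ff C r" "r \<in> hom C (Dom C r) (product C X Y)" "R = subobject_of C r"
    "pair C (proj0 C X Y \<cdot> r) (proj1 C X Y \<cdot> r) = r"
    "proj0 C X Y \<cdot> r \<in> hom C (Dom C r) X" "proj1 C X Y \<cdot> r \<in> hom C (Dom C r) Y"
proof -
  obtain m where m: "ff C m" "Cod C m = product C X Y" "R = subobject_of C m"
    and o: "X \<in> Obj C" "Y \<in> Obj C"
    using assms(1) unfolding relation_def by blast
  have r: "ff C r" "Cod C r = Cod C m" "factors C m r" "factors C r m"
    using assms(2) m(3) unfolding subobject_of_def by auto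
  show "ff C r" by fact
  show h: "r \<in> hom C (Dom C r) (product C X Y)" using r m ff_Arr by (auto simp: hom_def)
  show "R = subobject_of C r"
    unfolding m(3) by (rule subobject_of_eqI) (use r m in auto)
  show "pair C (proj0 C X Y \<cdot> r) (proj1 C X Y \<cdot> r) = r" using pair_eqI[OF h o] by metis
  show "proj0 C X Y \<cdot> r \<in> hom C (Dom C r) X" "proj1 C X Y \<cdot> r \<in> hom C (Dom C r) Y"
    using Cmp_hom[OF h] proj_hom[OF o] by auto
qed

lemma subobject_of_self: "ff C m \<Longrightarrow> m \<in> subobject_of C m"
  using factors_refl ff_Arr by (auto simp: subobject_of_def)

lemma relation_nonempty: "relation C X Y R \<Longrightarrow> \<exists>r. r \<in> R"
  unfolding relation_def using subobject_of_self by blast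

text \<open>Representatives factor through each other, so the existential quantifier of
  \<open>rel_mem\<close> may be tested at any single one.\<close>

lemma mem_rep_factors:
  assumes "relation C X Y R" "r \<in> R" "x \<in> hom C A X" "y \<in> hom C A Y"
  shows "mem X Y R A x y \<longleftrightarrow> factors C (pair C x y) r"
proof -
  have "factors C (pair C x y) r" if "r' \<in> R" "factors C (pair C x y) r'" for r'
  proof -
    have "factors C r' r" using that(1) relation_repD(3)[OF assms(1,2)] unfolding subobject_of_def
      by auto
    then show ?thesis using factors_trans that(2) ff_Arr relation_repD(1)[OF assms(1,2)] by blast
  qed
  then show ?thesis unfolding mem_def rel_mem_def using assms by blast
qed

lemma factors_pair_iff:
  assumes r: "r0 \<in> hom C T X" "r1 \<in> hom C T Y" and x: "x \<in> hom C A X" "y \<in> hom C A Y"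
  shows "factors C (pair C x y) (pair C r0 r1) \<longleftrightarrow> (\<exists>u\<in>hom C A T. r0 \<cdot> u = x \<and> r1 \<cdot> u = y)"
proof -
  have d: "Dom C (pair C x y) = A" "Dom C (pair C r0 r1) = T"
    using pair_hom(1)[OF r] pair_hom(1)[OF x] by (auto simp: hom_def)
  have "pair C r0 r1 \<cdot> u = pair C x y \<longleftrightarrow> r0 \<cdot> u = x \<and> r1 \<cdot> u = y" if u: "u \<in> hom C A T" for u
    using pair_Cmp[OF r u] pair_inject[OF Cmp_hom[OF u r(1)] Cmp_hom[OF u r(2)] x] by auto
  then show ?thesis unfolding factors_def d by auto
qed

lemma mem_rep:
  assumes R: "relation C X Y R" "r \<in> R"
  shows "mem X Y R A x y \<longleftrightarrow> x \<in> hom C A X \<and> y \<in> hom C A Y \<and>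
    (\<exists>u\<in>hom C A (Dom C r). (proj0 C X Y \<cdot> r) \<cdot> u = x \<and> (proj1 C X Y \<cdot> r) \<cdot> u = y)"
proof (cases "x \<in> hom C A X \<and> y \<in> hom C A Y")
  case True
  then show ?thesis
    using mem_rep_factors[OF R] factors_pair_iff[OF relation_repD(5,6)[OF R], of x A y]
      relation_repD(4)[OF R] by auto
qed (auto simp: mem_def)

lemma relation_tabulation:
  assumes "relation C X Y R"
  obtains T r0 r1 where "r0 \<in> hom C T X" "r1 \<in> hom C T Y" "jointly_order_mono C r0 r1"
    "R = subobject_of C (pair C r0 r1)"
    "\<And>A x y. mem X Y R A x y \<longleftrightarrow> x \<in> hom C A X \<and> y \<in> hom C A Y \<and>
      (\<exists>u\<in>hom C A T. r0 \<cdot> u = x \<and> r1 \<cdot> u = y)"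
proof -
  obtain r where r: "r \<in> R" using relation_nonempty[OF assms] by blast
  note f = relation_repD[OF assms r]
  show ?thesis
    using that[OF f(5,6)] mem_rep[OF assms r] f ff_pair_iff[OF f(5,6)] by simp
qed

text \<open>Take the identity of \<open>T\<close> as \<open>u\<close>: the legs of a tabulation are
  the universal element of the relation.\<close>

lemma mem_generic:
  assumes "r0 \<in> hom C T X" "r1 \<in> hom C T Y"
    "\<And>A x y. mem X Y R A x y \<longleftrightarrow> x \<in> hom C A X \<and> y \<in> hom C A Y \<and>
      (\<exists>u\<in>hom C A T. r0 \<cdot> u = x \<and> r1 \<cdot> u = y)"
  shows "mem X Y R T r0 r1"
  using assms hom_Obj(1)[OF assms(1)] Idn_hom Cmp_Idn_right by metis

lemma mem_restrict:
  assumes "relation C X Y R" "mem X Y R A x y" "u \<in> hom C B A"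
  shows "mem X Y R B (x \<cdot> u) (y \<cdot> u)"
proof -
  obtain T r0 r1 where r: "r0 \<in> hom C T X" "r1 \<in> hom C T Y"
    "\<And>A x y. mem X Y R A x y \<longleftrightarrow> x \<in> hom C A X \<and> y \<in> hom C A Y \<and>
      (\<exists>u\<in>hom C A T. r0 \<cdot> u = x \<and> r1 \<cdot> u = y)"
    using relation_tabulation[OF assms(1)] by metis
  obtain k where k: "k \<in> hom C A T" "r0 \<cdot> k = x" "r1 \<cdot> k = y" using assms(2) r(3) by blast
  have "r0 \<cdot> (k \<cdot> u) = x \<cdot> u" "r1 \<cdot> (k \<cdot> u) = y \<cdot> u"
    using Cmp_assoc[OF assms(3) k(1)] r(1,2) k(2,3) by metis+
  moreover have "x \<cdot> u \<in> hom C B X" "y \<cdot> u \<in> hom C B Y" "k \<cdot> u \<in> hom C B T"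
    using Cmp_hom[OF assms(3)] k(1) mem_hom[OF assms(2)] by auto
  ultimately show ?thesis unfolding r(3) by blast
qed

text \<open>The square formed by the cover \<open>e\<close> and a representative \<open>r\<close>
  has a diagonal, and this diagonal is the required factorization of
  \<open>pair C x y\<close>.\<close>

lemma mem_local:
  assumes "relation C X Y R" "cover e B A" "x \<in> hom C A X" "y \<in> hom C A Y"
    "mem X Y R B (x \<cdot> e) (y \<cdot> e)"
  shows "mem X Y R A x y"
proof -
  obtain r where r: "r \<in> R" using relation_nonempty[OF assms(1)] by blast
  note f = relation_repD[OF assms(1) r]
  have e: "e \<in> hom C B A" "so C e" using assms(2) by auto
  have xe: "x \<cdot> e \<in> hom C B X" "y \<cdot> e \<in> hom C B Y" using mem_hom[OF assms(5)] by auto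
  have d: "Dom C (pair C (x \<cdot> e) (y \<cdot> e)) = B" "Dom C (pair C x y) = A"
    "Cod C (pair C x y) = product C X Y"
    using pair_hom(1)[OF xe] pair_hom(1)[OF assms(3,4)] by (auto simp: hom_def)
  have "factors C (pair C (x \<cdot> e) (y \<cdot> e)) r"
    using assms(5) mem_rep_factors[OF assms(1) r xe] by blast
  then obtain k where "k \<in> hom C B (Dom C r)" "r \<cdot> k = pair C x y \<cdot> e"
    unfolding factors_def d pair_Cmp[OF assms(3,4) e(1)] by auto
  then obtain l where "l \<in> hom C A (Dom C r)" "r \<cdot> l = pair C x y"
    using so_lift[OF e(2) f(1), of k "pair C x y"] homD[OF e(1)] homD[OF f(2)]
      pair_hom(1)[OF assms(3,4)] by auto
  then have "factors C (pair C x y) r" unfolding factors_def d by blast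
  then show ?thesis using mem_rep_factors[OF assms(1) r assms(3,4)] by blast
qed

lemma relation_subobject:
  assumes "r0 \<in> hom C T X" "r1 \<in> hom C T Y" "jointly_order_mono C r0 r1"
  shows "relation C X Y (subobject_of C (pair C r0 r1))"
    "mem X Y (subobject_of C (pair C r0 r1)) A x y \<longleftrightarrow> x \<in> hom C A X \<and> y \<in> hom C A Y \<and>
      (\<exists>u\<in>hom C A T. r0 \<cdot> u = x \<and> r1 \<cdot> u = y)"
proof -
  have f: "ff C (pair C r0 r1)" using ff_pair_iff[OF assms(1,2)] assms(3) by auto
  show r: "relation C X Y (subobject_of C (pair C r0 r1))"
    unfolding relation_def using hom_Obj assms(1,2) f homD[OF pair_hom(1)[OF assms(1,2)]] by blast
  show "mem X Y (subobject_of C (pair C r0 r1)) A x y \<longleftrightarrow> x \<in> hom C A X \<and> y \<in> hom C A Y \<and>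
      (\<exists>u\<in>hom C A T. r0 \<cdot> u = x \<and> r1 \<cdot> u = y)"
    using mem_rep_factors[OF r subobject_of_self[OF f]] factors_pair_iff[OF assms(1,2)]
    by (auto simp: mem_def)
qed

text \<open>A Yoneda argument: for the converse the predicates are compared at the legs of a
  representative of \<open>R\<close>, its universal element.\<close>

lemma rel_le_iff:
  assumes R: "relation C X Y R" and S: "relation C X Y S"
  shows "rel_le C R S \<longleftrightarrow> (\<forall>A x y. mem X Y R A x y \<longrightarrow> mem X Y S A x y)"
proof
  assume "rel_le C R S"
  then obtain r s where rs: "r \<in> R" "s \<in> S" "factors C r s" unfolding rel_le_def by blast
  have s: "s \<in> Arr C" using relation_repD(1)[OF S rs(2)] ff_Arr by auto
  show "\<forall>A x y. mem X Y R A x y \<longrightarrow> mem X Y S A x y"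
    using mem_rep_factors[OF R rs(1)] mem_rep_factors[OF S rs(2)] factors_trans[OF _ rs(3) s]
      mem_hom by meson
next
  assume le: "\<forall>A x y. mem X Y R A x y \<longrightarrow> mem X Y S A x y"
  obtain r s where r: "r \<in> R" and s: "s \<in> S" using relation_nonempty R S by blast
  note f = relation_repD[OF R r]
  have "mem X Y R (Dom C r) (proj0 C X Y \<cdot> r) (proj1 C X Y \<cdot> r)"
    using mem_rep_factors[OF R r f(5,6)] f factors_refl ff_Arr by simp
  then have "factors C r s" using le mem_rep_factors[OF S s f(5,6)] f(4) by simp
  then show "rel_le C R S" unfolding rel_le_def using r s by blast
qed

text \<open>A relation contains every ff-morphism that represents its subobject. Agreement of the
  predicates therefore gives equality of sets of arrows, not only mutual inclusion of
  subobjects.\<close>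

lemma relation_eqI:
  assumes R: "relation C X Y R" and S: "relation C X Y S"
    and eq: "\<And>A x y. mem X Y R A x y \<longleftrightarrow> mem X Y S A x y"
  shows "R = S"
proof -
  have "factors C m n" if "m \<in> P" "n \<in> Q" "relation C X Y P" "relation C X Y Q"
    "\<And>A x y. mem X Y P A x y \<longleftrightarrow> mem X Y Q A x y" for P Q m n
  proof -
    note f = relation_repD[OF that(3,1)]
    have "mem X Y P (Dom C m) (proj0 C X Y \<cdot> m) (proj1 C X Y \<cdot> m)"
      using mem_rep_factors[OF that(3,1) f(5,6)] f factors_refl ff_Arr by simp
    then show ?thesis using that(5) mem_rep_factors[OF that(4,2) f(5,6)] f(4) by simp
  qed
  note fac = this
  have "P \<subseteq> Q" if P: "relation C X Y P" and Q: "relation C X Y Q"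
    and eq: "\<And>A x y. mem X Y P A x y \<longleftrightarrow> mem X Y Q A x y" for P Q
  proof
    fix m assume m: "m \<in> P"
    obtain n where n: "n \<in> Q" using relation_nonempty Q by blast
    have "m \<in> subobject_of C n"
      unfolding subobject_of_def
      using fac[OF m n P Q eq] fac[OF n m Q P] eq relation_repD(1,2)[OF P m]
        relation_repD(1,2)[OF Q n] by (auto simp: hom_def)
    then show "m \<in> Q" using relation_repD(3)[OF Q n] by simp
  qed
  then show ?thesis using R S eq by blast
qed

text \<open>This is where stability of so-morphisms under pullback is used.\<close>

lemma factors_image_iff:
  assumes t: "t0 \<in> hom C T X" "t1 \<in> hom C T Y" and e0: "so C e0" and m: "ff C m"
    and co: "Cod C e0 = Dom C m" and eq: "m \<cdot> e0 = pair C t0 t1"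
    and x: "x \<in> hom C A X" "y \<in> hom C A Y"
  shows "factors C (pair C x y) m \<longleftrightarrow>
    (\<exists>B e u. cover e B A \<and> u \<in> hom C B T \<and> t0 \<cdot> u = x \<cdot> e \<and> t1 \<cdot> u = y \<cdot> e)"
proof -
  note pt = pair_hom(1)[OF t] and px = pair_hom(1)[OF x]
  have e0m: "e0 \<in> Arr C" "m \<in> Arr C" using e0 m so_Arr ff_Arr by auto
  then have e0h: "e0 \<in> hom C T (Dom C m)" and mh: "m \<in> hom C (Dom C m) (product C X Y)"
    using pt co homD[OF pt] Cmp_Arr[of e0 m] unfolding eq[symmetric] by (auto simp: hom_def)
  have d: "Dom C (pair C x y) = A" using px by (simp add: hom_def)
  show ?thesis
  proof
    assume "factors C (pair C x y) m"
    then obtain k where k: "k \<in> hom C A (Dom C m)" "m \<cdot> k = pair C x y"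
      unfolding factors_def d by blast
    \<comment> \<open>Pulling the so-part \<open>e0\<close> back along \<open>k\<close> gives the
      cover \<open>p\<close>; the other projection \<open>q\<close> is the lift to \<open>T\<close>
      over it.\<close>
    obtain p q where pb: "is_pullback C k e0 p q" using ex_pullback[OF k(1) e0h] .
    then have so: "so C p" using so_pullback_stable e0 by blast
    have p: "p \<in> hom C (Dom C p) A" "q \<in> hom C (Dom C p) T" and kp: "k \<cdot> p = e0 \<cdot> q"
      using pb k(1) e0h unfolding is_pullback_def jointly_order_mono_def by (auto simp: hom_def)
    have "pair C t0 t1 \<cdot> q = m \<cdot> (e0 \<cdot> q)" using Cmp_assoc[OF p(2) e0h mh] eq by simp
    also have "\<dots> = pair C x y \<cdot> p" using Cmp_assoc[OF p(1) k(1) mh] kp k(2) by simp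
    finally have "pair C (t0 \<cdot> q) (t1 \<cdot> q) = pair C (x \<cdot> p) (y \<cdot> p)"
      using pair_Cmp[OF t p(2)] pair_Cmp[OF x p(1)] by simp
    then have "t0 \<cdot> q = x \<cdot> p" "t1 \<cdot> q = y \<cdot> p"
      using pair_inject[OF Cmp_hom[OF p(2) t(1)] Cmp_hom[OF p(2) t(2)]
          Cmp_hom[OF p(1) x(1)] Cmp_hom[OF p(1) x(2)]] by auto
    then show "\<exists>B e u. cover e B A \<and> u \<in> hom C B T \<and> t0 \<cdot> u = x \<cdot> e \<and> t1 \<cdot> u = y \<cdot> e"
      using so p by blast
  next
    assume "\<exists>B e u. cover e B A \<and> u \<in> hom C B T \<and> t0 \<cdot> u = x \<cdot> e \<and> t1 \<cdot> u = y \<cdot> e"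
    then obtain B e u where e: "so C e" "e \<in> hom C B A" and u: "u \<in> hom C B T"
      "t0 \<cdot> u = x \<cdot> e" "t1 \<cdot> u = y \<cdot> e" by blast
    have "m \<cdot> (e0 \<cdot> u) = pair C t0 t1 \<cdot> u" using Cmp_assoc[OF u(1) e0h mh] eq by simp
    also have "\<dots> = pair C x y \<cdot> e"
      using pair_Cmp[OF t u(1)] pair_Cmp[OF x e(2)] u by simp
    finally have "m \<cdot> (e0 \<cdot> u) = pair C x y \<cdot> e" .
    \<comment> \<open>Conversely, the cover \<open>e\<close> lifts against the ff-morphism
      \<open>m\<close>.\<close>
    then obtain l where "l \<in> hom C A (Dom C m)" "m \<cdot> l = pair C x y"
      using so_lift[OF e(1) m, of "e0 \<cdot> u" "pair C x y"] homD[OF e(2)] homD[OF mh]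
        Cmp_hom[OF u(1) e0h] px by auto
    then show "factors C (pair C x y) m" unfolding factors_def d by blast
  qed
qed

text \<open>The relation is the ff-part of \<open>pair C t0 t1\<close>. An element of it lifts to
  \<open>T\<close> only over a cover, since the so-part need not split.\<close>

lemma image_relation:
  assumes t: "t0 \<in> hom C T X" "t1 \<in> hom C T Y"
  obtains R where "relation C X Y R"
    "\<And>A x y. mem X Y R A x y \<longleftrightarrow> x \<in> hom C A X \<and> y \<in> hom C A Y \<and>
      (\<exists>B e u. cover e B A \<and> u \<in> hom C B T \<and> t0 \<cdot> u = x \<cdot> e \<and> t1 \<cdot> u = y \<cdot> e)"
proof -
  note pt = homD[OF pair_hom(1)[OF t]]
  obtain e m where em: "so C e" "ff C m" "Dom C e = T" "Cod C e = Dom C m" "m \<cdot> e = pair C t0 t1"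
    using so_ff_factorization[of "pair C t0 t1"] pt by metis
  then have "Cod C m = product C X Y" using pt Cmp_Arr(3)[of e m] so_Arr ff_Arr by auto
  then have R: "relation C X Y (subobject_of C m)"
    unfolding relation_def using em(2) t hom_Obj by blast
  show ?thesis
    using that[OF R] mem_rep_factors[OF R subobject_of_self[OF em(2)]]
      factors_image_iff[OF t em(1,2,4,5)] by (metis mem_hom)
qed

section \<open>Definable predicates and comprehension\<close>

definition definable :: "'o \<Rightarrow> 'o \<Rightarrow> ('o \<Rightarrow> 'a \<Rightarrow> 'a \<Rightarrow> bool) \<Rightarrow> bool" where
  "definable X Y P \<longleftrightarrow> (\<exists>R. relation C X Y R \<and> mem X Y R = P)"

text \<open>The relation is the image of the span \<open>t0\<close>, \<open>t1\<close>. An element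
  of the image satisfies \<open>P\<close> by restricting the instance at \<open>T\<close> and
  descending along the cover; the other direction is \<open>generic\<close>. So it is enough that
  the span is universal up to covers, without uniqueness of \<open>u\<close>.\<close>

lemma definableI:
  assumes t: "t0 \<in> hom C T X" "t1 \<in> hom C T Y"
    and typed: "\<And>A x y. P A x y \<Longrightarrow> x \<in> hom C A X \<and> y \<in> hom C A Y"
    and P: "P T t0 t1"
    and restrict: "\<And>A B x y u. \<lbrakk>P A x y; u \<in> hom C B A\<rbrakk> \<Longrightarrow> P B (x \<cdot> u) (y \<cdot> u)"
    and local: "\<And>A B e x y. \<lbrakk>cover e B A; x \<in> hom C A X; y \<in> hom C A Y; P B (x \<cdot> e) (y \<cdot> e)\<rbrakk>
      \<Longrightarrow> P A x y"
    and generic: "\<And>A x y. P A x y \<Longrightarrow>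
      \<exists>B e u. cover e B A \<and> u \<in> hom C B T \<and> t0 \<cdot> u = x \<cdot> e \<and> t1 \<cdot> u = y \<cdot> e"
  shows "definable X Y P"
proof -
  obtain R where R: "relation C X Y R"
    and mem: "\<And>A x y. mem X Y R A x y \<longleftrightarrow> x \<in> hom C A X \<and> y \<in> hom C A Y \<and>
      (\<exists>B e u. cover e B A \<and> u \<in> hom C B T \<and> t0 \<cdot> u = x \<cdot> e \<and> t1 \<cdot> u = y \<cdot> e)"
    using image_relation[OF t] by blast
  have "mem X Y R A x y \<longleftrightarrow> P A x y" for A x y
    unfolding mem using typed generic local restrict[OF P] by metis
  then show ?thesis unfolding definable_def using R by blast
qed

lemma definableI_exact:
  assumes t: "t0 \<in> hom C T X" "t1 \<in> hom C T Y"
    and typed: "\<And>A x y. P A x y \<Longrightarrow> x \<in> hom C A X \<and> y \<in> hom C A Y"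
    and P: "P T t0 t1"
    and restrict: "\<And>A B x y u. \<lbrakk>P A x y; u \<in> hom C B A\<rbrakk> \<Longrightarrow> P B (x \<cdot> u) (y \<cdot> u)"
    and local: "\<And>A B e x y. \<lbrakk>cover e B A; x \<in> hom C A X; y \<in> hom C A Y; P B (x \<cdot> e) (y \<cdot> e)\<rbrakk>
      \<Longrightarrow> P A x y"
    and generic: "\<And>A x y. P A x y \<Longrightarrow> \<exists>u\<in>hom C A T. t0 \<cdot> u = x \<and> t1 \<cdot> u = y"
  shows "definable X Y P"
proof -
  have gen: "\<exists>B e u. cover e B A \<and> u \<in> hom C B T \<and> t0 \<cdot> u = x \<cdot> e \<and> t1 \<cdot> u = y \<cdot> e"
    if p: "P A x y" for A x y
  proof -
    have x: "x \<in> hom C A X" "y \<in> hom C A Y" using typed[OF p] by auto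
    obtain u where "u \<in> hom C A T" "t0 \<cdot> u = x" "t1 \<cdot> u = y" using generic[OF p] by blast
    then show ?thesis
      using cover_Idn[of A] hom_Obj[OF x(1)] Cmp_Idn_right[OF x(1)] Cmp_Idn_right[OF x(2)] by metis
  qed
  show ?thesis
    by (rule definableI[where P = P, OF t]) (fact typed P restrict local gen)+
qed

lemma definableD:
  assumes "definable X Y P"
  shows "P A x y \<Longrightarrow> x \<in> hom C A X \<and> y \<in> hom C A Y"
    "\<lbrakk>P A x y; u \<in> hom C B A\<rbrakk> \<Longrightarrow> P B (x \<cdot> u) (y \<cdot> u)"
    "\<lbrakk>cover e B A; x \<in> hom C A X; y \<in> hom C A Y; P B (x \<cdot> e) (y \<cdot> e)\<rbrakk> \<Longrightarrow> P A x y"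
    "X \<in> Obj C" "Y \<in> Obj C"
proof -
  obtain R where R: "relation C X Y R" and P: "P = mem X Y R"
    using assms unfolding definable_def by blast
  show "P A x y \<Longrightarrow> x \<in> hom C A X \<and> y \<in> hom C A Y" unfolding P by (rule mem_hom)
  show "\<lbrakk>P A x y; u \<in> hom C B A\<rbrakk> \<Longrightarrow> P B (x \<cdot> u) (y \<cdot> u)"
    unfolding P by (rule mem_restrict[OF R])
  show "\<lbrakk>cover e B A; x \<in> hom C A X; y \<in> hom C A Y; P B (x \<cdot> e) (y \<cdot> e)\<rbrakk> \<Longrightarrow> P A x y"
    unfolding P by (rule mem_local[OF R])
  show "X \<in> Obj C" "Y \<in> Obj C" using relation_Obj[OF R] by auto
qed

lemma definable_generic:
  assumes "definable X Y P"
  obtains T r0 r1 where "r0 \<in> hom C T X" "r1 \<in> hom C T Y" "P T r0 r1"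
    "\<And>A x y. P A x y \<Longrightarrow> \<exists>u\<in>hom C A T. r0 \<cdot> u = x \<and> r1 \<cdot> u = y"
proof -
  obtain R where R: "relation C X Y R" "mem X Y R = P" using assms unfolding definable_def by blast
  obtain T r0 r1 where r: "r0 \<in> hom C T X" "r1 \<in> hom C T Y"
    "\<And>A x y. mem X Y R A x y \<longleftrightarrow> x \<in> hom C A X \<and> y \<in> hom C A Y \<and>
      (\<exists>u\<in>hom C A T. r0 \<cdot> u = x \<and> r1 \<cdot> u = y)"
    using relation_tabulation[OF R(1)] by metis
  show ?thesis using that r mem_generic[OF r] unfolding R(2) by metis
qed

lemma definable_True:
  assumes "X \<in> Obj C" "Y \<in> Obj C"
  shows "definable X Y (\<lambda>A x y. x \<in> hom C A X \<and> y \<in> hom C A Y)"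
proof (rule definableI_exact[OF proj_hom[OF assms]])
  show "\<exists>u\<in>hom C A (product C X Y). proj0 C X Y \<cdot> u = x \<and> proj1 C X Y \<cdot> u = y"
    if "x \<in> hom C A X \<and> y \<in> hom C A Y" for A x y
    using that pair_hom by blast
qed (auto simp: proj_hom[OF assms] intro: Cmp_hom)

lemma definable_converse:
  assumes "definable X Y P"
  shows "definable Y X (\<lambda>A y x. P A x y)"
proof -
  obtain T r0 r1 where r: "r0 \<in> hom C T X" "r1 \<in> hom C T Y" "P T r0 r1"
    "\<And>A x y. P A x y \<Longrightarrow> \<exists>u\<in>hom C A T. r0 \<cdot> u = x \<and> r1 \<cdot> u = y"
    by (rule definable_generic[OF assms]) (rule that)
  show ?thesis
  proof (rule definableI_exact[OF r(2,1)])
    show "P T r0 r1" by fact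
    show "\<exists>u\<in>hom C A T. r1 \<cdot> u = y \<and> r0 \<cdot> u = x" if "P A x y" for A x y
      using r(4)[OF that] by blast
    show "y \<in> hom C A Y \<and> x \<in> hom C A X" if "P A x y" for A x y
      using definableD(1)[OF assms that] by simp
    show "P B (x \<cdot> u) (y \<cdot> u)" if "P A x y" "u \<in> hom C B A" for A B x y u
      using definableD(2)[OF assms that] .
    show "P A x y" if "cover e B A" "y \<in> hom C A Y" "x \<in> hom C A X" "P B (x \<cdot> e) (y \<cdot> e)"
      for A B e x y
      using definableD(3)[OF assms that(1,3,2,4)] .
  qed
qed

text \<open>Comprehension: the part of \<open>T\<close> on which \<open>P\<close> holds between
  \<open>f\<close> and \<open>g\<close> is the pullback of a tabulation of \<open>P\<close> along
  \<open>pair C f g\<close>. Only the existence of \<open>v\<close> is recorded, which is what a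
  weak limit asks for.\<close>

lemma definable_restriction:
  assumes P: "definable X Y P" and f: "f \<in> hom C T X" and g: "g \<in> hom C T Y"
  obtains S k where "k \<in> hom C S T" "P S (f \<cdot> k) (g \<cdot> k)"
    "\<And>A u. \<lbrakk>u \<in> hom C A T; P A (f \<cdot> u) (g \<cdot> u)\<rbrakk> \<Longrightarrow> \<exists>v\<in>hom C A S. k \<cdot> v = u"
proof -
  obtain R r0 r1 where r: "r0 \<in> hom C R X" "r1 \<in> hom C R Y" "P R r0 r1"
    "\<And>A x y. P A x y \<Longrightarrow> \<exists>u\<in>hom C A R. r0 \<cdot> u = x \<and> r1 \<cdot> u = y"
    by (rule definable_generic[OF P]) (rule that)
  note pf = pair_hom(1)[OF f g] and pr = pair_hom(1)[OF r(1,2)]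
  obtain k b where pb: "is_pullback C (pair C f g) (pair C r0 r1) k b"
    using ex_pullback[OF pf pr] .
  have k: "k \<in> hom C (Dom C k) T" and b: "b \<in> hom C (Dom C k) R"
    and eq: "pair C f g \<cdot> k = pair C r0 r1 \<cdot> b"
    using pb homD[OF pf] homD[OF pr]
    unfolding is_pullback_def jointly_order_mono_def by (auto simp: hom_def)
  have univ: "\<exists>w\<in>hom C A (Dom C k). k \<cdot> w = u \<and> b \<cdot> w = v"
    if "u \<in> hom C A T" "v \<in> hom C A R" "pair C f g \<cdot> u = pair C r0 r1 \<cdot> v" for A u v
    using pb homD[OF pf] homD[OF pr] that hom_Obj(1)[OF that(1)] unfolding is_pullback_def by metis
  have "pair C (f \<cdot> k) (g \<cdot> k) = pair C (r0 \<cdot> b) (r1 \<cdot> b)"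
    using eq pair_Cmp[OF f g k] pair_Cmp[OF r(1,2) b] by simp
  then have e: "f \<cdot> k = r0 \<cdot> b" "g \<cdot> k = r1 \<cdot> b"
    using pair_inject[OF Cmp_hom[OF k f] Cmp_hom[OF k g] Cmp_hom[OF b r(1)]
        Cmp_hom[OF b r(2)]] by auto
  show ?thesis
  proof
    show "k \<in> hom C (Dom C k) T" by fact
    show "P (Dom C k) (f \<cdot> k) (g \<cdot> k)" unfolding e by (rule definableD(2)[OF P r(3) b])
  next
    fix A u assume u: "u \<in> hom C A T" and Pu: "P A (f \<cdot> u) (g \<cdot> u)"
    obtain v where v: "v \<in> hom C A R" "r0 \<cdot> v = f \<cdot> u" "r1 \<cdot> v = g \<cdot> u" using r(4)[OF Pu] by blast
    then have "pair C f g \<cdot> u = pair C r0 r1 \<cdot> v"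
      using pair_Cmp[OF f g u] pair_Cmp[OF r(1,2) v(1)] by simp
    then show "\<exists>v\<in>hom C A (Dom C k). k \<cdot> v = u" using univ[OF u v(1)] by blast
  qed
qed

text \<open>Comprehension on the product of \<open>X'\<close> and \<open>Y'\<close>, along
  \<open>f\<close> and \<open>g\<close> after the projections. The typing conjuncts are part of the
  predicate because the type of \<open>f \<cdot> x\<close> does not determine that of an arbitrary
  \<open>x\<close>.\<close>

lemma definable_vimage:
  assumes P: "definable X Y P" and f: "f \<in> hom C X' X" and g: "g \<in> hom C Y' Y"
  shows "definable X' Y' (\<lambda>A x y. x \<in> hom C A X' \<and> y \<in> hom C A Y' \<and> P A (f \<cdot> x) (g \<cdot> y))"
proof -
  note D = definableD[OF P]
  have o: "X' \<in> Obj C" "Y' \<in> Obj C" using f g hom_Obj by auto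
  define p where "p = proj0 C X' Y'"
  define q where "q = proj1 C X' Y'"
  have p: "p \<in> hom C (product C X' Y') X'" "q \<in> hom C (product C X' Y') Y'"
    using proj_hom[OF o] unfolding p_def q_def .
  obtain S k where k: "k \<in> hom C S (product C X' Y')" "P S ((f \<cdot> p) \<cdot> k) ((g \<cdot> q) \<cdot> k)"
    and univ: "\<And>A u. \<lbrakk>u \<in> hom C A (product C X' Y'); P A ((f \<cdot> p) \<cdot> u) ((g \<cdot> q) \<cdot> u)\<rbrakk>
      \<Longrightarrow> \<exists>v\<in>hom C A S. k \<cdot> v = u"
    by (rule definable_restriction[OF P Cmp_hom[OF p(1) f] Cmp_hom[OF p(2) g]]) (rule that)
  have ass: "(f \<cdot> p) \<cdot> u = f \<cdot> (p \<cdot> u)" "(g \<cdot> q) \<cdot> u = g \<cdot> (q \<cdot> u)"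
    if "u \<in> hom C A (product C X' Y')" for A u
    using Cmp_assoc[OF that p(1) f] Cmp_assoc[OF that p(2) g] by auto
  show ?thesis
  proof (rule definableI_exact[OF Cmp_hom[OF k(1) p(1)] Cmp_hom[OF k(1) p(2)]])
    show "p \<cdot> k \<in> hom C S X' \<and> q \<cdot> k \<in> hom C S Y' \<and> P S (f \<cdot> (p \<cdot> k)) (g \<cdot> (q \<cdot> k))"
      using k(2) ass[OF k(1)] Cmp_hom[OF k(1)] p by auto
  next
    fix A B x y u
    assume "x \<in> hom C A X' \<and> y \<in> hom C A Y' \<and> P A (f \<cdot> x) (g \<cdot> y)" and u: "u \<in> hom C B A"
    then show "x \<cdot> u \<in> hom C B X' \<and> y \<cdot> u \<in> hom C B Y' \<and> P B (f \<cdot> (x \<cdot> u)) (g \<cdot> (y \<cdot> u))"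
      using D(2)[OF _ u, of "f \<cdot> x" "g \<cdot> y"] Cmp_assoc[OF u _ f] Cmp_assoc[OF u _ g] Cmp_hom[OF u]
      by auto
  next
    fix A B e x y
    assume e: "cover e B A" and x: "x \<in> hom C A X'" "y \<in> hom C A Y'"
      and "x \<cdot> e \<in> hom C B X' \<and> y \<cdot> e \<in> hom C B Y' \<and> P B (f \<cdot> (x \<cdot> e)) (g \<cdot> (y \<cdot> e))"
    then show "x \<in> hom C A X' \<and> y \<in> hom C A Y' \<and> P A (f \<cdot> x) (g \<cdot> y)"
      using D(3)[OF e Cmp_hom[OF x(1) f] Cmp_hom[OF x(2) g]]
        Cmp_assoc[OF _ x(1) f, of e] Cmp_assoc[OF _ x(2) g, of e] by auto
  next
    fix A x y assume "x \<in> hom C A X' \<and> y \<in> hom C A Y' \<and> P A (f \<cdot> x) (g \<cdot> y)"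
    then have x: "x \<in> hom C A X'" "y \<in> hom C A Y'" and P: "P A (f \<cdot> x) (g \<cdot> y)" by auto
    note xy = pair_hom[OF x, folded p_def q_def]
    obtain w where w: "w \<in> hom C A S" "k \<cdot> w = pair C x y"
      using univ[OF xy(1)] ass[OF xy(1)] xy P by auto
    then have "(p \<cdot> k) \<cdot> w = x" "(q \<cdot> k) \<cdot> w = y"
      using Cmp_assoc[OF w(1) k(1)] p xy by auto
    then show "\<exists>u\<in>hom C A S. (p \<cdot> k) \<cdot> u = x \<and> (q \<cdot> k) \<cdot> u = y" using w(1) by blast
  qed auto
qed

text \<open>Comprehension of \<open>Q\<close> along the legs of a tabulation of \<open>P\<close>;
  the restricted legs are generic for both predicates at once.\<close>

lemma definable_conj:
  assumes "definable X Y P" "definable X Y Q"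
  shows "definable X Y (\<lambda>A x y. P A x y \<and> Q A x y)"
proof -
  note DP = definableD[OF assms(1)] and DQ = definableD[OF assms(2)]
  obtain T r0 r1 where r: "r0 \<in> hom C T X" "r1 \<in> hom C T Y" "P T r0 r1"
    and gen: "\<And>A x y. P A x y \<Longrightarrow> \<exists>u\<in>hom C A T. r0 \<cdot> u = x \<and> r1 \<cdot> u = y"
    by (rule definable_generic[OF assms(1)]) (rule that)
  obtain S k where k: "k \<in> hom C S T" "Q S (r0 \<cdot> k) (r1 \<cdot> k)"
    and univ: "\<And>A u. \<lbrakk>u \<in> hom C A T; Q A (r0 \<cdot> u) (r1 \<cdot> u)\<rbrakk> \<Longrightarrow> \<exists>v\<in>hom C A S. k \<cdot> v = u"
    by (rule definable_restriction[OF assms(2) r(1,2)]) (rule that)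
  show ?thesis
  proof (rule definableI_exact[OF Cmp_hom[OF k(1) r(1)] Cmp_hom[OF k(1) r(2)]])
    fix A x y assume PQ: "P A x y \<and> Q A x y"
    then obtain u where u: "u \<in> hom C A T" "r0 \<cdot> u = x" "r1 \<cdot> u = y" using gen by blast
    then obtain v where v: "v \<in> hom C A S" "k \<cdot> v = u" using univ PQ by blast
    then have "(r0 \<cdot> k) \<cdot> v = x" "(r1 \<cdot> k) \<cdot> v = y"
      using Cmp_assoc[OF v(1) k(1)] r u by auto
    then show "\<exists>u\<in>hom C A S. (r0 \<cdot> k) \<cdot> u = x \<and> (r1 \<cdot> k) \<cdot> u = y" using v(1) by blast
  next
    show "P S (r0 \<cdot> k) (r1 \<cdot> k) \<and> Q S (r0 \<cdot> k) (r1 \<cdot> k)" using DP(2)[OF r(3) k(1)] k(2) ..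
  next
    show "x \<in> hom C A X \<and> y \<in> hom C A Y" if "P A x y \<and> Q A x y" for A x y
      using DP(1)[OF conjunct1[OF that]] .
    show "P B (x \<cdot> u) (y \<cdot> u) \<and> Q B (x \<cdot> u) (y \<cdot> u)" if "P A x y \<and> Q A x y" "u \<in> hom C B A"
      for A B x y u
      using DP(2)[OF _ that(2)] DQ(2)[OF _ that(2)] that(1) by simp
    show "P A x y \<and> Q A x y" if "cover e B A" "x \<in> hom C A X" "y \<in> hom C A Y"
      "P B (x \<cdot> e) (y \<cdot> e) \<and> Q B (x \<cdot> e) (y \<cdot> e)" for A B e x y
      using DP(3)[OF that(1-3)] DQ(3)[OF that(1-3)] that(4) by simp
  qed
qed

text \<open>The two typing conjuncts carry the case of empty \<open>J\<close>, where nothing else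
  constrains \<open>x\<close> and \<open>y\<close>.\<close>

lemma definable_finite_conj:
  assumes "finite J" "X \<in> Obj C" "Y \<in> Obj C" "\<And>i. i \<in> J \<Longrightarrow> definable X Y (P i)"
  shows "definable X Y (\<lambda>A x y. x \<in> hom C A X \<and> y \<in> hom C A Y \<and> (\<forall>i\<in>J. P i A x y))"
  using assms(1,4)
proof (induction J)
  case empty
  show ?case using definable_True[OF assms(2,3)] by simp
next
  case (insert i J)
  have "definable X Y (P i)" using insert.prems by simp
  moreover have "definable X Y (\<lambda>A x y. x \<in> hom C A X \<and> y \<in> hom C A Y \<and> (\<forall>i\<in>J. P i A x y))"
    by (rule insert.IH) (simp add: insert.prems)
  ultimately have "definable X Y (\<lambda>A x y. P i A x y \<and>
      (x \<in> hom C A X \<and> y \<in> hom C A Y \<and> (\<forall>i\<in>J. P i A x y)))"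
    by (rule definable_conj)
  moreover have "(\<lambda>A x y. P i A x y \<and> (x \<in> hom C A X \<and> y \<in> hom C A Y \<and> (\<forall>i\<in>J. P i A x y)))
    = (\<lambda>A x y. x \<in> hom C A X \<and> y \<in> hom C A Y \<and> (\<forall>i\<in>insert i J. P i A x y))"
    by (intro ext) auto
  ultimately show ?case by simp
qed

text \<open>Weak limits suffice below, since the objects of the exact completion carry their own
  congruence.\<close>

lemma ex_weak_product:
  assumes "finite J" "\<And>i. i \<in> J \<Longrightarrow> X i \<in> Obj C"
  shows "\<exists>T t. T \<in> Obj C \<and> (\<forall>i\<in>J. t i \<in> hom C T (X i)) \<and>
    (\<forall>A x. A \<in> Obj C \<longrightarrow> (\<forall>i\<in>J. x i \<in> hom C A (X i)) \<longrightarrow> (\<exists>u\<in>hom C A T. \<forall>i\<in>J. t i \<cdot> u = x i))"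
  using assms
proof (induction J)
  case empty
  then show ?case using ex_terminal by (auto simp: Bex_def)
next
  case (insert j J)
  obtain T t where T: "T \<in> Obj C" "\<forall>i\<in>J. t i \<in> hom C T (X i)"
    and univ: "\<forall>A x. A \<in> Obj C \<longrightarrow> (\<forall>i\<in>J. x i \<in> hom C A (X i)) \<longrightarrow>
      (\<exists>u\<in>hom C A T. \<forall>i\<in>J. t i \<cdot> u = x i)"
    using insert.IH insert.prems by auto
  have j: "X j \<in> Obj C" using insert by auto
  note p = proj_hom[OF T(1) j]
  define t' where "t' i = (if i = j then proj1 C T (X j) else t i \<cdot> proj0 C T (X j))" for i
  have t': "t' i \<in> hom C (product C T (X j)) (X i)" if "i \<in> insert j J" for i
    using that p T(2) Cmp_hom[OF p(1)] by (auto simp: t'_def)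
  have "\<exists>u\<in>hom C A (product C T (X j)). \<forall>i\<in>insert j J. t' i \<cdot> u = x i"
    if A: "A \<in> Obj C" and x: "\<forall>i\<in>insert j J. x i \<in> hom C A (X i)" for A x
  proof -
    obtain u where u: "u \<in> hom C A T" "\<forall>i\<in>J. t i \<cdot> u = x i"
      using univ[rule_format, OF A, of x] x by auto
    have xj: "x j \<in> hom C A (X j)" using x by auto
    note q = pair_hom[OF u(1) xj]
    have "t' i \<cdot> pair C u (x j) = x i" if "i \<in> insert j J" for i
      using that q u(2) T(2) Cmp_assoc[OF q(1) p(1)] by (auto simp: t'_def)
    then show ?thesis using q(1) by blast
  qed
  then show ?case using t' product_Obj[OF T(1) j] by blast
qed

text \<open>\<open>J\<close> indexes the coordinates of a tuple and \<open>K\<close> binary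
  conditions between the coordinates \<open>s k\<close> and \<open>d k\<close>. Conditions are
  imposed one at a time: comprehension cuts the current vertex down to where one more of them holds,
  and the earlier ones survive because definable predicates are stable under restriction.\<close>

lemma ex_weak_limit:
  assumes "finite J" "\<And>i. i \<in> J \<Longrightarrow> X i \<in> Obj C" "finite K"
    "\<And>k. k \<in> K \<Longrightarrow> s k \<in> J \<and> d k \<in> J \<and> definable (X (s k)) (X (d k)) (P k)"
  shows "\<exists>T t. T \<in> Obj C \<and> (\<forall>i\<in>J. t i \<in> hom C T (X i)) \<and> (\<forall>k\<in>K. P k T (t (s k)) (t (d k))) \<and>
    (\<forall>A x. A \<in> Obj C \<longrightarrow> (\<forall>i\<in>J. x i \<in> hom C A (X i)) \<longrightarrow> (\<forall>k\<in>K. P k A (x (s k)) (x (d k)))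
       \<longrightarrow> (\<exists>u\<in>hom C A T. \<forall>i\<in>J. t i \<cdot> u = x i))"
  using assms(3,4)
proof (induction K)
  case empty
  then show ?case using ex_weak_product[of J X] assms(1,2) by simp
next
  case (insert k K)
  obtain T t where T: "T \<in> Obj C" "\<forall>i\<in>J. t i \<in> hom C T (X i)"
    "\<forall>k\<in>K. P k T (t (s k)) (t (d k))"
    and univ: "\<forall>A x. A \<in> Obj C \<longrightarrow> (\<forall>i\<in>J. x i \<in> hom C A (X i)) \<longrightarrow>
      (\<forall>k\<in>K. P k A (x (s k)) (x (d k))) \<longrightarrow> (\<exists>u\<in>hom C A T. \<forall>i\<in>J. t i \<cdot> u = x i)"
    using insert.IH insert.prems by auto
  have k: "s k \<in> J" "d k \<in> J" "definable (X (s k)) (X (d k)) (P k)" using insert by auto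
  obtain S h where h: "h \<in> hom C S T" "P k S (t (s k) \<cdot> h) (t (d k) \<cdot> h)"
    and restr: "\<And>A u. \<lbrakk>u \<in> hom C A T; P k A (t (s k) \<cdot> u) (t (d k) \<cdot> u)\<rbrakk>
      \<Longrightarrow> \<exists>v\<in>hom C A S. h \<cdot> v = u"
    using definable_restriction[OF k(3), of "t (s k)" T "t (d k)"] T(2) k by metis
  have S: "S \<in> Obj C" using h hom_Obj by auto
  moreover have "\<forall>i\<in>J. t i \<cdot> h \<in> hom C S (X i)" using T(2) Cmp_hom[OF h(1)] by auto
  moreover have "P l S (t (s l) \<cdot> h) (t (d l) \<cdot> h)" if "l \<in> insert k K" for l
    using that h T(3) insert.prems definableD(2)[OF _ _ h(1)] by blast
  moreover have "\<exists>v\<in>hom C A S. \<forall>i\<in>J. (t i \<cdot> h) \<cdot> v = x i"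
    if A: "A \<in> Obj C" and x: "\<forall>i\<in>J. x i \<in> hom C A (X i)"
      and P: "\<forall>l\<in>insert k K. P l A (x (s l)) (x (d l))" for A x
  proof -
    obtain u where u: "u \<in> hom C A T" "\<forall>i\<in>J. t i \<cdot> u = x i" 
      using univ[rule_format, OF A, of x] x P by auto
    then obtain v where v: "v \<in> hom C A S" "h \<cdot> v = u" using restr[OF u(1)] P k by auto
    have "(t i \<cdot> h) \<cdot> v = x i" if "i \<in> J" for i
      using Cmp_assoc[OF v(1) h(1)] T(2) that v u by auto
    then show ?thesis using v(1) by blast
  qed
  ultimately show ?case by (intro exI[of _ S] exI[of _ "\<lambda>i. t i \<cdot> h"]) auto
qed

text \<open>Composition of relations is existential quantification in the internal logic, where
  existence means existence after passing to a cover.\<close>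

lemma rel_comp:
  assumes R: "relation C X Y R" and S: "relation C Y Z S"
  shows "relation C X Z (rel_comp C X Y Z S R)"
    and "mem X Z (rel_comp C X Y Z S R) A x z \<longleftrightarrow> x \<in> hom C A X \<and> z \<in> hom C A Z \<and>
      (\<exists>B e y. cover e B A \<and> mem X Y R B (x \<cdot> e) y \<and> mem Y Z S B y (z \<cdot> e))"
proof -
  define Q where "Q A x z \<longleftrightarrow> (\<exists>B e y. cover e B A \<and> mem X Y R B (x \<cdot> e) y \<and> mem Y Z S B y (z \<cdot> e))"
    for A x z
  have XZ: "X \<in> Obj C" "Z \<in> Obj C" using R S relation_Obj by auto
  \<comment> \<open>Stated for every choice of representatives, pullback and factorization, because
    \<open>rel_comp\<close> collects the ff-parts from all of them; it shows that they all have the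
    same elements.\<close>
  have main: "m \<in> hom C (Dom C m) (product C X Z) \<and> (\<forall>A x z. x \<in> hom C A X \<longrightarrow> z \<in> hom C A Z \<longrightarrow>
      (factors C (pair C x z) m \<longleftrightarrow> Q A x z))"
    if m: "ff C m" and r: "r \<in> R" and s: "s \<in> S"
      and pb: "is_pullback C (proj1 C X Y \<cdot> r) (proj0 C Y Z \<cdot> s) t0 t1"
      and e: "so C e" "Cod C e = Dom C m"
      and eq: "m \<cdot> e = pair C ((proj0 C X Y \<cdot> r) \<cdot> t0) ((proj1 C Y Z \<cdot> s) \<cdot> t1)"
    for m r s t0 t1 e
  proof -
    note r' = relation_repD(5,6)[OF R r] and s' = relation_repD(5,6)[OF S s]
    let ?ra = "proj0 C X Y \<cdot> r" and ?rb = "proj1 C X Y \<cdot> r"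
    let ?sa = "proj0 C Y Z \<cdot> s" and ?sb = "proj1 C Y Z \<cdot> s"
    have t: "t0 \<in> hom C (Dom C t0) (Dom C r)" "t1 \<in> hom C (Dom C t0) (Dom C s)"
      and pbeq: "?rb \<cdot> t0 = ?sa \<cdot> t1"
      using pb homD[OF r'(2)] homD[OF s'(1)]
      unfolding is_pullback_def jointly_order_mono_def by (auto simp: hom_def)
    have univ: "\<exists>w\<in>hom C B (Dom C t0). t0 \<cdot> w = u \<and> t1 \<cdot> w = v"
      if "u \<in> hom C B (Dom C r)" "v \<in> hom C B (Dom C s)" "?rb \<cdot> u = ?sa \<cdot> v" for B u v
      using pb homD[OF r'(2)] homD[OF s'(1)] that hom_Obj(1)[OF that(1)]
      unfolding is_pullback_def by metis
    note rt = Cmp_hom[OF t(1) r'(1)] and st = Cmp_hom[OF t(2) s'(2)]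
    have mh: "m \<in> hom C (Dom C m) (product C X Z)"
      using homD[OF pair_hom(1)[OF rt st]] so_Arr[OF e(1)] ff_Arr[OF m] e(2) Cmp_Arr(3)[of e m]
      unfolding eq[symmetric] by (auto simp: hom_def)
    have "factors C (pair C x z) m \<longleftrightarrow> Q A x z" if x: "x \<in> hom C A X" "z \<in> hom C A Z" for A x z
    proof -
      \<comment> \<open>An arrow into the pullback amounts to a middle element \<open>y\<close>
        together with witnesses for both memberships: \<open>y\<close> is the common value of the
        two inner legs.\<close>
      have "(\<exists>u. u \<in> hom C B (Dom C t0) \<and> (?ra \<cdot> t0) \<cdot> u = x \<cdot> c \<and> (?sb \<cdot> t1) \<cdot> u = z \<cdot> c) \<longleftrightarrow>
        (\<exists>y. mem X Y R B (x \<cdot> c) y \<and> mem Y Z S B y (z \<cdot> c))" (is "?l \<longleftrightarrow> ?r")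
        if c: "c \<in> hom C B A" for B c
      proof
        assume ?l
        then obtain u where u: "u \<in> hom C B (Dom C t0)" "(?ra \<cdot> t0) \<cdot> u = x \<cdot> c"
          "(?sb \<cdot> t1) \<cdot> u = z \<cdot> c" by blast
        note ut = Cmp_hom[OF u(1) t(1)] Cmp_hom[OF u(1) t(2)]
        have y: "?rb \<cdot> (t0 \<cdot> u) = ?sa \<cdot> (t1 \<cdot> u)"
          using Cmp_assoc[OF u(1) t(1) r'(2)] Cmp_assoc[OF u(1) t(2) s'(1)] pbeq by simp
        have "mem X Y R B (x \<cdot> c) (?rb \<cdot> (t0 \<cdot> u))"
          unfolding mem_rep[OF R r]
          using Cmp_hom[OF c x(1)] Cmp_hom[OF ut(1) r'(2)] ut(1) Cmp_assoc[OF u(1) t(1) r'(1)] u(2)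
          by auto
        moreover have "mem Y Z S B (?rb \<cdot> (t0 \<cdot> u)) (z \<cdot> c)"
          unfolding mem_rep[OF S s] y
          using Cmp_hom[OF c x(2)] Cmp_hom[OF ut(2) s'(1)] ut(2) Cmp_assoc[OF u(1) t(2) s'(2)] u(3)
          by auto
        ultimately show ?r by blast
      next
        assume ?r
        then obtain y a b where a: "a \<in> hom C B (Dom C r)" "?ra \<cdot> a = x \<cdot> c" "?rb \<cdot> a = y"
          and b: "b \<in> hom C B (Dom C s)" "?sa \<cdot> b = y" "?sb \<cdot> b = z \<cdot> c"
          unfolding mem_rep[OF R r] mem_rep[OF S s] by blast
        then obtain w where w: "w \<in> hom C B (Dom C t0)" "t0 \<cdot> w = a" "t1 \<cdot> w = b"
          using univ[of a B b] by auto
        then show ?l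
          using Cmp_assoc[OF w(1) t(1) r'(1)] Cmp_assoc[OF w(1) t(2) s'(2)] a b by auto
      qed
      then show ?thesis
        unfolding factors_image_iff[OF rt st e(1) m e(2) eq x] Q_def by meson
    qed
    then show ?thesis using mh by blast
  qed
  obtain r s where r: "r \<in> R" and s: "s \<in> S" using relation_nonempty R S by blast
  note r' = relation_repD(5,6)[OF R r] and s' = relation_repD(5,6)[OF S s]
  obtain t0 t1 where pb: "is_pullback C (proj1 C X Y \<cdot> r) (proj0 C Y Z \<cdot> s) t0 t1"
    using ex_pullback[OF r'(2) s'(1)] .
  let ?p = "pair C ((proj0 C X Y \<cdot> r) \<cdot> t0) ((proj1 C Y Z \<cdot> s) \<cdot> t1)"
  have t: "t0 \<in> hom C (Dom C t0) (Dom C r)" "t1 \<in> hom C (Dom C t0) (Dom C s)"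
    using pb homD[OF r'(2)] homD[OF s'(1)]
    unfolding is_pullback_def jointly_order_mono_def by (auto simp: hom_def)
  have "?p \<in> Arr C" using homD[OF pair_hom(1)[OF Cmp_hom[OF t(1) r'(1)] Cmp_hom[OF t(2) s'(2)]]] by simp
  then obtain e m where em: "so C e" "ff C m" "Cod C e = Dom C m" "m \<cdot> e = ?p"
    using so_ff_factorization by metis
  note m = main[OF em(2) r s pb em(1,3,4)]
  have mh: "m \<in> hom C (Dom C m) (product C X Z)" using m by blast
  have "rel_comp C X Y Z S R = subobject_of C m"
  proof (intro set_eqI iffI)
    fix n assume "n \<in> rel_comp C X Y Z S R"
    then obtain r s t0 t1 e where n: "ff C n" "r \<in> R" "s \<in> S"
      "is_pullback C (proj1 C X Y \<cdot> r) (proj0 C Y Z \<cdot> s) t0 t1" "so C e" "Cod C e = Dom C n"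
      "n \<cdot> e = pair C ((proj0 C X Y \<cdot> r) \<cdot> t0) ((proj1 C Y Z \<cdot> s) \<cdot> t1)"
      unfolding rel_comp_def by blast
    note n' = main[OF n]
    have nh: "n \<in> hom C (Dom C n) (product C X Z)" using n' by blast
    have rep: "pair C (proj0 C X Z \<cdot> k) (proj1 C X Z \<cdot> k) = k"
      if "k \<in> hom C (Dom C k) (product C X Z)" for k
      using pair_eqI[OF that XZ] by metis
    \<comment> \<open>Yoneda for subobjects: \<open>k\<close> is the pairing of its own legs and
      factors through itself, so whatever contains all elements of \<open>k\<close> contains
      \<open>k\<close>.\<close>
    have fac: "factors C k l"
      if k: "k \<in> hom C (Dom C k) (product C X Z)" and l: "l \<in> Arr C" and
        kl: "\<And>A x z. x \<in> hom C A X \<Longrightarrow> z \<in> hom C A Z \<Longrightarrow>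
          factors C (pair C x z) k \<Longrightarrow> factors C (pair C x z) l" for k l
      using kl[OF Cmp_hom[OF k proj_hom(1)[OF XZ]] Cmp_hom[OF k proj_hom(2)[OF XZ]]]
        rep[OF k] factors_refl[of k] homD[OF k] by simp
    have "factors C n m" "factors C m n"
      by (rule fac; use n' m nh mh in \<open>auto simp: hom_def\<close>)+
    then show "n \<in> subobject_of C m"
      using n(1) nh mh unfolding subobject_of_def by (simp add: hom_def)
  next
    \<comment> \<open>Another representative \<open>n\<close> is isomorphic to \<open>m\<close> via
      \<open>k\<close>. Moving \<open>k\<close> into the so-part turns the factorization through
      \<open>m\<close> into one through \<open>n\<close>.\<close>
    fix n assume "n \<in> subobject_of C m"
    then have n: "ff C n" "Cod C n = Cod C m" "factors C m n" "factors C n m"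
      unfolding subobject_of_def by auto
    obtain k l where k: "k \<in> hom C (Dom C m) (Dom C n)" "n \<cdot> k = m"
      and l: "l \<in> hom C (Dom C n) (Dom C m)" "m \<cdot> l = n"
      using n(3,4) unfolding factors_def by blast
    have nh: "n \<in> hom C (Dom C n) (Cod C m)" using n ff_Arr by (simp add: hom_def)
    have mh': "m \<in> hom C (Dom C m) (Cod C m)" using em(2) ff_Arr by (simp add: hom_def)
    have "m \<cdot> (l \<cdot> k) = m \<cdot> Idn C (Dom C m)"
      using Cmp_assoc[OF k(1) l(1) mh'] k l mh' Cmp_Idn_right by simp
    then have lk: "l \<cdot> k = Idn C (Dom C m)"
      using ff_cancel[OF em(2) Cmp_hom[OF k(1) l(1)] Idn_hom] hom_Obj[OF k(1)] by auto
    have "n \<cdot> (k \<cdot> l) = n \<cdot> Idn C (Dom C n)"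
      using Cmp_assoc[OF l(1) k(1) nh] k l nh Cmp_Idn_right by simp
    then have kl: "k \<cdot> l = Idn C (Dom C n)"
      using ff_cancel[OF n(1) Cmp_hom[OF l(1) k(1)] Idn_hom] hom_Obj[OF l(1)] by auto
    have "so C k" using iso_so[OF k(1) l(1) lk kl] .
    then have so: "so C (k \<cdot> e)" using so_Cmp em(1,3) k(1) by (simp add: hom_def)
    have eh: "e \<in> hom C (Dom C e) (Dom C m)" using em so_Arr by (simp add: hom_def)
    have "n \<cdot> (k \<cdot> e) = ?p" using Cmp_assoc[OF eh k(1) nh] k em by simp
    moreover have "Cod C (k \<cdot> e) = Dom C n" using Cmp_hom[OF eh k(1)] by (simp add: hom_def)
    ultimately show "n \<in> rel_comp C X Y Z S R"
      unfolding rel_comp_def using n(1) r s pb so by blast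
  qed
  note eq = this
  show rel: "relation C X Z (rel_comp C X Y Z S R)"
    unfolding relation_def eq using XZ em(2) mh by (auto simp: hom_def)
  have "m \<in> rel_comp C X Y Z S R" unfolding eq using subobject_of_self em(2) .
  then show "mem X Z (rel_comp C X Y Z S R) A x z \<longleftrightarrow> x \<in> hom C A X \<and> z \<in> hom C A Z \<and>
      (\<exists>B e y. cover e B A \<and> mem X Y R B (x \<cdot> e) y \<and> mem Y Z S B y (z \<cdot> e))"
    using mem_rep_factors[OF rel] m mem_hom unfolding Q_def by meson
qed

text \<open>Any two comma objects factor through each other, and the legs of every representative of
  the resulting subobject form a comma object again; so the pairings of all comma objects are
  exactly one subobject. Membership is then the universal property.\<close>

lemma comma_rel:
  assumes f: "f \<in> hom C X Z" and g: "g \<in> hom C Y Z"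
  shows "relation C X Y (comma_rel C f g)"
    and "mem X Y (comma_rel C f g) A x y \<longleftrightarrow> x \<in> hom C A X \<and> y \<in> hom C A Y \<and> f \<cdot> x \<preceq> g \<cdot> y"
proof -
  have d: "Dom C f = X" "Dom C g = Y" "f \<in> Arr C" "g \<in> Arr C" "Cod C f = Cod C g"
    using f g by (auto simp: hom_def)
  have main: "c0 \<in> hom C (Dom C c0) X \<and> c1 \<in> hom C (Dom C c0) Y \<and> jointly_order_mono C c0 c1 \<and>
      (\<forall>A x y. x \<in> hom C A X \<longrightarrow> y \<in> hom C A Y \<longrightarrow>
        (f \<cdot> x \<preceq> g \<cdot> y \<longleftrightarrow> factors C (pair C x y) (pair C c0 c1)))"
    if c: "is_comma C f g c0 c1" for c0 c1
  proof -
    have j: "jointly_order_mono C c0 c1" and le: "f \<cdot> c0 \<preceq> g \<cdot> c1"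
      using c unfolding is_comma_def by auto
    have h: "c0 \<in> hom C (Dom C c0) X" "c1 \<in> hom C (Dom C c0) Y"
      using c d unfolding is_comma_def jointly_order_mono_def by (auto simp: hom_def)
    have "f \<cdot> x \<preceq> g \<cdot> y \<longleftrightarrow> (\<exists>u\<in>hom C A (Dom C c0). c0 \<cdot> u = x \<and> c1 \<cdot> u = y)"
      if x: "x \<in> hom C A X" "y \<in> hom C A Y" for A x y
    proof
      assume "f \<cdot> x \<preceq> g \<cdot> y"
      then show "\<exists>u\<in>hom C A (Dom C c0). c0 \<cdot> u = x \<and> c1 \<cdot> u = y"
        using c x hom_Obj(1)[OF x(1)] d unfolding is_comma_def by auto
    next
      assume "\<exists>u\<in>hom C A (Dom C c0). c0 \<cdot> u = x \<and> c1 \<cdot> u = y"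
      then obtain u where u: "u \<in> hom C A (Dom C c0)" "c0 \<cdot> u = x" "c1 \<cdot> u = y" by blast
      have "(f \<cdot> c0) \<cdot> u \<preceq> (g \<cdot> c1) \<cdot> u"
        using Cmp_mono_left[OF u(1) Cmp_hom[OF h(1) f] Cmp_hom[OF h(2) g] le] .
      then show "f \<cdot> x \<preceq> g \<cdot> y" using Cmp_assoc[OF u(1) h(1) f] Cmp_assoc[OF u(1) h(2) g] u by simp
    qed
    then show ?thesis using h j factors_pair_iff[OF h] by blast
  qed
  obtain c0 c1 where c: "is_comma C f g c0 c1" using ex_comma[OF f g] .
  note cm = main[OF c]
  have h: "c0 \<in> hom C (Dom C c0) X" "c1 \<in> hom C (Dom C c0) Y" "jointly_order_mono C c0 c1"
    using cm by auto
  note S = relation_subobject[OF h]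
  have eq: "comma_rel C f g = subobject_of C (pair C c0 c1)"
  proof (intro set_eqI iffI)
    fix n assume "n \<in> comma_rel C f g"
    then obtain b0 b1 where b: "is_comma C f g b0 b1" "n = pair C b0 b1"
      unfolding comma_rel_def by blast
    note bm = main[OF b(1)]
    have hb: "b0 \<in> hom C (Dom C b0) X" "b1 \<in> hom C (Dom C b0) Y" "jointly_order_mono C b0 b1"
      using bm by auto
    have ffb: "ff C n" unfolding b(2) ff_pair_iff[OF hb(1,2)] by fact
    have "factors C n (pair C c0 c1)" "factors C (pair C c0 c1) n"
      unfolding b(2) using cm bm h hb factors_refl homD[OF pair_hom(1)[OF hb(1,2)]]
        homD[OF pair_hom(1)[OF h(1,2)]] by meson+
    then show "n \<in> subobject_of C (pair C c0 c1)"
      unfolding subobject_of_def using ffb homD[OF pair_hom(1)[OF hb(1,2)]]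
        homD[OF pair_hom(1)[OF h(1,2)]] b(2) by simp
  next
    fix n assume n: "n \<in> subobject_of C (pair C c0 c1)"
    note r = relation_repD[OF S(1) n]
    let ?na = "proj0 C X Y \<cdot> n" and ?nb = "proj1 C X Y \<cdot> n"
    have mem: "mem X Y (subobject_of C (pair C c0 c1)) A x y \<longleftrightarrow>
      x \<in> hom C A X \<and> y \<in> hom C A Y \<and> f \<cdot> x \<preceq> g \<cdot> y" for A x y
      unfolding S(2) using cm factors_pair_iff[OF h(1,2)] by blast
    have j: "jointly_order_mono C ?na ?nb" using ff_pair_iff[OF r(5,6)] r(1,4) by simp
    have le: "f \<cdot> x \<preceq> g \<cdot> y \<longleftrightarrow> (\<exists>u\<in>hom C A (Dom C n). ?na \<cdot> u = x \<and> ?nb \<cdot> u = y)"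
      if "x \<in> hom C A X" "y \<in> hom C A Y" for A x y
      using mem[of A x y] mem_rep[OF S(1) n, of A x y] that by blast
    have "f \<cdot> ?na \<preceq> g \<cdot> ?nb"
      using le[OF r(5,6)] Cmp_Idn_right[OF r(5)] Cmp_Idn_right[OF r(6)] Idn_hom
        hom_Obj(1)[OF r(5)] by auto
    then have "is_comma C f g ?na ?nb"
      unfolding is_comma_def using j d homD[OF r(5)] homD[OF r(6)] le by auto
    then show "n \<in> comma_rel C f g" unfolding comma_rel_def using r(4) by force
  qed
  show "relation C X Y (comma_rel C f g)" unfolding eq by (rule S)
  show "mem X Y (comma_rel C f g) A x y \<longleftrightarrow> x \<in> hom C A X \<and> y \<in> hom C A Y \<and> f \<cdot> x \<preceq> g \<cdot> y"
    unfolding eq S(2) using cm factors_pair_iff[OF h(1,2)] by blast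
qed

text \<open>Weakening closure is recovered by transitivity along \<open>x' \<preceq> x\<close>, the
  pair \<open>x\<close>, \<open>y\<close> in \<open>E\<close>, and \<open>y \<preceq> y'\<close>.
  The cover in the composite \<open>E E\<close> disappears by locality of \<open>E\<close>.\<close>

lemma congruence_iff:
  "congruence C X E \<longleftrightarrow> relation C X X E \<and>
    (\<forall>A x y. x \<in> hom C A X \<longrightarrow> y \<in> hom C A X \<longrightarrow> x \<preceq> y \<longrightarrow> mem X X E A x y) \<and>
    (\<forall>A x y z. mem X X E A x y \<longrightarrow> mem X X E A y z \<longrightarrow> mem X X E A x z)"
proof (cases "relation C X X E")
  case E: True
  have X: "X \<in> Obj C" using E relation_Obj by auto
  note I = comma_rel[OF Idn_hom[OF X] Idn_hom[OF X]]
  have 1: "rel_le C (comma_rel C (Idn C X) (Idn C X)) E \<longleftrightarrow>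
    (\<forall>A x y. x \<in> hom C A X \<longrightarrow> y \<in> hom C A X \<longrightarrow> x \<preceq> y \<longrightarrow> mem X X E A x y)"
    unfolding rel_le_iff[OF I(1) E] I(2) using Cmp_Idn_left by metis
  have 2: "rel_le C (rel_comp C X X X E E) E \<longleftrightarrow>
    (\<forall>A x y z. mem X X E A x y \<longrightarrow> mem X X E A y z \<longrightarrow> mem X X E A x z)" (is "?l \<longleftrightarrow> ?r")
  proof
    assume l: ?l
    show ?r
    proof (intro allI impI)
      fix A x y z assume m: "mem X X E A x y" "mem X X E A y z"
      have h: "x \<in> hom C A X" "z \<in> hom C A X" using m mem_hom by auto
      have "mem X X (rel_comp C X X X E E) A x z"
        unfolding rel_comp(2)[OF E E] using m h cover_Idn[of A] hom_Obj(1)[OF h(1)]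
          Cmp_Idn_right[OF h(1)] Cmp_Idn_right[OF h(2)] by metis
      then show "mem X X E A x z" using l rel_le_iff[OF rel_comp(1)[OF E E] E] by blast
    qed
  next
    assume r: ?r
    show ?l unfolding rel_le_iff[OF rel_comp(1)[OF E E] E] rel_comp(2)[OF E E]
      using r mem_local[OF E] by meson
  qed
  have "weakening_closed C X X E"
    if r: "\<And>A x y. x \<in> hom C A X \<Longrightarrow> y \<in> hom C A X \<Longrightarrow> x \<preceq> y \<Longrightarrow> mem X X E A x y"
      and t: "\<And>A x y z. mem X X E A x y \<Longrightarrow> mem X X E A y z \<Longrightarrow> mem X X E A x z"
    unfolding weakening_closed_def
  proof (intro ballI impI)
    fix A x x' y y' assume h: "x \<in> hom C A X" "x' \<in> hom C A X" "y \<in> hom C A X" "y' \<in> hom C A X"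
      and "x' \<preceq> x \<and> rel_mem C x y E \<and> y \<preceq> y'"
    then have "mem X X E A x' x" "mem X X E A x y" "mem X X E A y y'"
      using r unfolding mem_def by auto
    then show "rel_mem C x' y' E" using t unfolding mem_def by blast
  qed
  then show ?thesis unfolding congruence_def 1 2 using E by blast
qed (auto simp: congruence_def)

end

section \<open>The exact completion in terms of generalized elements\<close>

text \<open>Tuples are taken apart by \<open>fst\<close> and \<open>snd\<close>, which rewrite
  without case splits. The relations change sides in the order, since \<open>exreg\<close> reverses
  inclusion.\<close>

lemma exreg_simps [simp]:
  "a \<in> Obj (exreg C) \<longleftrightarrow> congruence C (fst a) (snd a)"
  "Dom (exreg C) f = fst f"
  "Cod (exreg C) f = snd (snd f)"
  "Idn (exreg C) a = (a, snd a, a)"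
  "Cmp (exreg C) g f = (fst f, rel_comp C (fst (fst f)) (fst (fst g)) (fst (snd (snd g)))
     (fst (snd g)) (fst (snd f)), snd (snd g))"
  "Leq (exreg C) f g \<longleftrightarrow> rel_le C (fst (snd g)) (fst (snd f))"
  by (auto simp: exreg_def Qw_def split: prod.splits)

context regular_category
begin

abbreviation exC :: "(('o, 'a) cobj, ('o, 'a) carr) poscat" where
  "exC \<equiv> exreg C"

abbreviation exC_Cmp (infixr \<open>\<bullet>\<close> 70) where
  "g \<bullet> f \<equiv> g \<cdot>\<^bsub>exC\<^esub> f"

abbreviation exC_Leq (infix \<open>\<sqsubseteq>\<close> 50) where
  "f \<sqsubseteq> g \<equiv> f \<preceq>\<^bsub>exC\<^esub> g"

section \<open>Objects as preorders, arrows as adjoint bimodules\<close>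

definition le :: "('o, 'a) cobj \<Rightarrow> 'o \<Rightarrow> 'a \<Rightarrow> 'a \<Rightarrow> bool" where
  "le a = mem (fst a) (fst a) (snd a)"

abbreviation relates :: "('o, 'a) cobj \<Rightarrow> ('o, 'a) cobj \<Rightarrow> 'a set \<Rightarrow> 'o \<Rightarrow> 'a \<Rightarrow> 'a \<Rightarrow> bool" where
  "relates a b \<Phi> \<equiv> mem (fst a) (fst b) \<Phi>"

lemma le_hom: "le a A x y \<Longrightarrow> x \<in> hom C A (fst a)" "le a A x y \<Longrightarrow> y \<in> hom C A (fst a)"
  by (auto simp: le_def mem_def)

context
  fixes a :: "('o, 'a) cobj"
  assumes a: "a \<in> Obj exC"
begin

lemma cobj_relation: "relation C (fst a) (fst a) (snd a)"
  using a by (simp add: congruence_iff)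

lemma cobj_Obj: "fst a \<in> Obj C"
  using cobj_relation relation_Obj by auto

lemma le_restrict: "le a A x y \<Longrightarrow> u \<in> hom C B A \<Longrightarrow> le a B (x \<cdot> u) (y \<cdot> u)"
  unfolding le_def by (rule mem_restrict[OF cobj_relation])

lemma le_local: "cover e B A \<Longrightarrow> x \<in> hom C A (fst a) \<Longrightarrow> y \<in> hom C A (fst a) \<Longrightarrow>
    le a B (x \<cdot> e) (y \<cdot> e) \<Longrightarrow> le a A x y"
  unfolding le_def by (rule mem_local[OF cobj_relation])

lemma le_Leq: "x \<in> hom C A (fst a) \<Longrightarrow> y \<in> hom C A (fst a) \<Longrightarrow> x \<preceq> y \<Longrightarrow> le a A x y"
  using a by (simp add: congruence_iff le_def)

lemma le_refl: "x \<in> hom C A (fst a) \<Longrightarrow> le a A x x"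
  by (rule le_Leq) (auto intro: Leq_refl)

lemma le_trans: "le a A x y \<Longrightarrow> le a A y z \<Longrightarrow> le a A x z"
  using a unfolding exreg_simps congruence_iff le_def by blast

lemma le_definable: "definable (fst a) (fst a) (le a)"
  unfolding definable_def le_def using cobj_relation by blast

end

text \<open>The elementwise form of \<open>F \<Phi> E = \<Phi>\<close>: downward closed in the first
  argument and upward closed in the second.\<close>

definition bimodule :: "('o, 'a) cobj \<Rightarrow> ('o, 'a) cobj \<Rightarrow> 'a set \<Rightarrow> bool" where
  "bimodule a b \<Phi> \<longleftrightarrow> relation C (fst a) (fst b) \<Phi> \<and>
    (\<forall>A x x' y y'. le a A x' x \<longrightarrow> relates a b \<Phi> A x y \<longrightarrow> le b A y y' \<longrightarrow> relates a b \<Phi> A x' y')"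

text \<open>The last two clauses are unit and counit. The unit is asked at single elements
  \<open>x\<close> rather than at pairs in the congruence, and the counit without a cover; the
  bimodule laws and locality restore the inclusions of relations.\<close>

definition adjoint :: "('o, 'a) cobj \<Rightarrow> ('o, 'a) cobj \<Rightarrow> 'a set \<Rightarrow> 'a set \<Rightarrow> bool" where
  "adjoint a b \<Phi> \<Psi> \<longleftrightarrow> bimodule a b \<Phi> \<and> bimodule b a \<Psi> \<and>
    (\<forall>A x. x \<in> hom C A (fst a) \<longrightarrow>
      (\<exists>B e y. cover e B A \<and> relates a b \<Phi> B (x \<cdot> e) y \<and> relates b a \<Psi> B y (x \<cdot> e))) \<and>
    (\<forall>A x y y'. relates b a \<Psi> A y x \<longrightarrow> relates a b \<Phi> A x y' \<longrightarrow> le b A y y')"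

lemma bimodule_relation: "bimodule a b \<Phi> \<Longrightarrow> relation C (fst a) (fst b) \<Phi>"
  by (simp add: bimodule_def)

lemma bimodule_definable: "bimodule a b \<Phi> \<Longrightarrow> definable (fst a) (fst b) (relates a b \<Phi>)"
  unfolding definable_def by (intro exI[of _ \<Phi>] conjI bimodule_relation refl)

lemma bimoduleD:
  "bimodule a b \<Phi> \<Longrightarrow> le a A x' x \<Longrightarrow> relates a b \<Phi> A x y \<Longrightarrow> le b A y y' \<Longrightarrow> relates a b \<Phi> A x' y'"
  unfolding bimodule_def by blast

text \<open>Reflexivity of both congruences puts \<open>\<Phi>\<close> into the double composite.
  The opposite inclusion is closure of \<open>\<Phi>\<close>, after the two covers of the composite
  have been removed by locality.\<close>

lemma Qw_Arr_iff: "(a, \<Phi>, b) \<in> Arr (Qw C) \<longleftrightarrow> a \<in> Obj exC \<and> b \<in> Obj exC \<and> bimodule a b \<Phi>"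
proof -
  have 1: "(a, \<Phi>, b) \<in> Arr (Qw C) \<longleftrightarrow> a \<in> Obj exC \<and> b \<in> Obj exC \<and> relation C (fst a) (fst b) \<Phi> \<and>
    rel_comp C (fst a) (fst b) (fst b) (snd b) (rel_comp C (fst a) (fst a) (fst b) \<Phi> (snd a)) = \<Phi>"
    by (cases a; cases b) (auto simp: Qw_def)
  have "rel_comp C (fst a) (fst b) (fst b) (snd b) (rel_comp C (fst a) (fst a) (fst b) \<Phi> (snd a)) = \<Phi>
    \<longleftrightarrow> bimodule a b \<Phi>" (is "?K = \<Phi> \<longleftrightarrow> _")
    if a: "a \<in> Obj exC" and b: "b \<in> Obj exC" and R: "relation C (fst a) (fst b) \<Phi>"
  proof -
    note Ra = cobj_relation[OF a] and Rb = cobj_relation[OF b]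
    let ?L = "rel_comp C (fst a) (fst a) (fst b) \<Phi> (snd a)"
    note L = rel_comp[OF Ra R, folded le_def] and K = rel_comp[OF rel_comp(1)[OF Ra R] Rb, folded le_def]
    have intro: "relates a b ?K A x' y'"
      if h: "le a A x' x" "relates a b \<Phi> A x y" "le b A y y'" for A x' x y y'
    proof -
      have t: "x' \<in> hom C A (fst a)" "y' \<in> hom C A (fst b)" "y \<in> hom C A (fst b)"
        using h le_hom by auto
      have c: "cover (Idn C A) A A" using cover_Idn hom_Obj(1)[OF t(1)] by blast
      have "relates a b ?L A x' y"
        unfolding L(2) using c h t Cmp_Idn_right[OF t(1)] Cmp_Idn_right[OF t(3)] by metis
      then show ?thesis
        unfolding K(2) using c h t Cmp_Idn_right[OF t(1)] Cmp_Idn_right[OF t(2)] by metis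
    qed
    show ?thesis
    proof
      assume "?K = \<Phi>"
      then show "bimodule a b \<Phi>" unfolding bimodule_def using R intro by metis
    next
      assume bm: "bimodule a b \<Phi>"
      show "?K = \<Phi>"
      proof (rule relation_eqI[OF K(1) R])
        fix A x y
        show "relates a b ?K A x y \<longleftrightarrow> relates a b \<Phi> A x y"
        proof
          assume "relates a b ?K A x y"
          then obtain B e z where x: "x \<in> hom C A (fst a)" "y \<in> hom C A (fst b)" and e: "cover e B A"
            and z: "relates a b ?L B (x \<cdot> e) z" and zy: "le b B z (y \<cdot> e)"
            unfolding K(2) by blast
          obtain B' e' w where e': "cover e' B' B" and w: "le a B' ((x \<cdot> e) \<cdot> e') w"
            and wz: "relates a b \<Phi> B' w (z \<cdot> e')"
            using z unfolding L(2) by blast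
          note e'h = conjunct2[OF e']
          have "relates a b \<Phi> B' ((x \<cdot> e) \<cdot> e') ((y \<cdot> e) \<cdot> e')"
            by (rule bimoduleD[OF bm w wz le_restrict[OF b zy e'h]])
          then have "relates a b \<Phi> B (x \<cdot> e) (y \<cdot> e)"
            using mem_local[OF R e'] mem_hom z zy le_hom by metis
          then show "relates a b \<Phi> A x y" by (rule mem_local[OF R e x])
        next
          assume r: "relates a b \<Phi> A x y"
          then show "relates a b ?K A x y"
            using intro[OF le_refl[OF a] r le_refl[OF b]] mem_hom by blast
        qed
      qed
    qed
  qed
  then show ?thesis using 1 bimodule_relation by blast
qed

text \<open>\<open>\<Psi>\<close> is the right adjoint, which an arrow is required to have but does
  not store. Unit and counit are translated separately into statements on elements.\<close>

lemma hom_exreg_iff: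
  "f \<in> hom exC a b \<longleftrightarrow> a \<in> Obj exC \<and> b \<in> Obj exC \<and> (\<exists>\<Phi> \<Psi>. f = (a, \<Phi>, b) \<and> adjoint a b \<Phi> \<Psi>)"
proof -
  have Q: "hom (Qw C) c d = {(c, \<Psi>, d) | \<Psi>. c \<in> Obj exC \<and> d \<in> Obj exC \<and> bimodule c d \<Psi>}" for c d
  proof -
    have "f \<in> hom (Qw C) c d \<longleftrightarrow> (\<exists>\<Psi>. f = (c, \<Psi>, d) \<and> (c, \<Psi>, d) \<in> Arr (Qw C))" for f
      by (cases f) (auto simp: hom_def Qw_def)
    then show ?thesis unfolding Qw_Arr_iff by auto
  qed
  have 1: "f \<in> hom exC a b \<longleftrightarrow> f \<in> hom (Qw C) a b \<and> has_right_adjoint (Qw C) f"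
    by (auto simp: hom_def exreg_def)
  have 2: "has_right_adjoint (Qw C) (a, \<Phi>, b) \<longleftrightarrow> (\<exists>\<Psi>. bimodule b a \<Psi> \<and>
      rel_le C (snd a) (rel_comp C (fst a) (fst b) (fst a) \<Psi> \<Phi>) \<and>
      rel_le C (rel_comp C (fst b) (fst a) (fst b) \<Phi> \<Psi>) (snd b))"
    if "a \<in> Obj exC" "b \<in> Obj exC" for \<Phi>
  proof -
    have "Dom (Qw C) (a, \<Phi>, b) = a" "Cod (Qw C) (a, \<Phi>, b) = b" by (simp_all add: Qw_def)
    then show ?thesis
      unfolding has_right_adjoint_def using that
      by (cases a; cases b) (auto simp: Q, auto simp: Qw_def)
  qed
  have 3: "rel_le C (snd a) (rel_comp C (fst a) (fst b) (fst a) \<Psi> \<Phi>) \<and>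
      rel_le C (rel_comp C (fst b) (fst a) (fst b) \<Phi> \<Psi>) (snd b) \<longleftrightarrow> adjoint a b \<Phi> \<Psi>"
    if a: "a \<in> Obj exC" and b: "b \<in> Obj exC" and p: "bimodule a b \<Phi>" and q: "bimodule b a \<Psi>" for \<Phi> \<Psi>
  proof -
    note Ra = cobj_relation[OF a] and Rb = cobj_relation[OF b]
    note P = bimodule_relation[OF p] and Q = bimodule_relation[OF q]
    let ?l1 = "rel_le C (snd a) (rel_comp C (fst a) (fst b) (fst a) \<Psi> \<Phi>)"
    let ?l2 = "rel_le C (rel_comp C (fst b) (fst a) (fst b) \<Phi> \<Psi>) (snd b)"
    let ?r1 = "\<forall>A x. x \<in> hom C A (fst a) \<longrightarrow>
      (\<exists>B e y. cover e B A \<and> relates a b \<Phi> B (x \<cdot> e) y \<and> relates b a \<Psi> B y (x \<cdot> e))"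
    let ?r2 = "\<forall>A x y y'. relates b a \<Psi> A y x \<longrightarrow> relates a b \<Phi> A x y' \<longrightarrow> le b A y y'"
    have l1: "?l1 \<longleftrightarrow> (\<forall>A x x'. le a A x x' \<longrightarrow>
      (\<exists>B e y. cover e B A \<and> relates a b \<Phi> B (x \<cdot> e) y \<and> relates b a \<Psi> B y (x' \<cdot> e)))"
      unfolding rel_le_iff[OF Ra rel_comp(1)[OF P Q]] rel_comp(2)[OF P Q] le_def
      using mem_hom by meson
    have "?l1 \<longleftrightarrow> ?r1"
    proof
      show ?r1 if ?l1 using that le_refl[OF a] unfolding l1 by blast
    next
      \<comment> \<open>The unit at a pair \<open>x\<close>, \<open>x'\<close> follows from the unit
        at \<open>x\<close>, because \<open>\<Psi>\<close> absorbs the step from \<open>x\<close> up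
        to \<open>x'\<close>.\<close>
      assume r1: ?r1
      show ?l1 unfolding l1
      proof (intro allI impI)
        fix A x x' assume xx: "le a A x x'"
        obtain B e y where e: "cover e B A" and y: "relates a b \<Phi> B (x \<cdot> e) y" "relates b a \<Psi> B y (x \<cdot> e)"
          using r1 le_hom(1)[OF xx] by blast
        note eh = conjunct2[OF e]
        have yh: "y \<in> hom C B (fst b)" using y mem_hom by blast
        have "relates b a \<Psi> B y (x' \<cdot> e)"
          by (rule bimoduleD[OF q le_refl[OF b yh] y(2) le_restrict[OF a xx eh]])
        then show "\<exists>B e y. cover e B A \<and> relates a b \<Phi> B (x \<cdot> e) y \<and> relates b a \<Psi> B y (x' \<cdot> e)"
          using e y by blast
      qed
    qed
    moreover have l2: "?l2 \<longleftrightarrow> (\<forall>A y y'. y \<in> hom C A (fst b) \<and> y' \<in> hom C A (fst b) \<and> (\<exists>B e x. cover e B A \<and>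
      relates b a \<Psi> B (y \<cdot> e) x \<and> relates a b \<Phi> B x (y' \<cdot> e)) \<longrightarrow> le b A y y')"
      unfolding rel_le_iff[OF rel_comp(1)[OF Q P] Rb] rel_comp(2)[OF Q P] le_def ..
    moreover have "?l2 \<longleftrightarrow> ?r2"
    proof
      assume l: ?l2
      show ?r2
      proof (intro allI impI)
        fix A x y y' assume h: "relates b a \<Psi> A y x" "relates a b \<Phi> A x y'"
        have t: "y \<in> hom C A (fst b)" "y' \<in> hom C A (fst b)" using h mem_hom by blast+
        have "cover (Idn C A) A A" using cover_Idn hom_Obj(1)[OF t(1)] by blast
        then show "le b A y y'"
          using l[unfolded l2, rule_format, of y A y'] h t
            Cmp_Idn_right[OF t(1)] Cmp_Idn_right[OF t(2)] by metis
      qed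
    next
      assume r: ?r2
      show ?l2 unfolding l2
      proof (intro allI impI, elim conjE exE)
        fix A y y' B e x
        assume t: "y \<in> hom C A (fst b)" "y' \<in> hom C A (fst b)" and e: "so C e" "e \<in> hom C B A"
          and h: "relates b a \<Psi> B (y \<cdot> e) x" "relates a b \<Phi> B x (y' \<cdot> e)"
        show "le b A y y'" by (rule le_local[OF b _ t]) (use e r h in auto)
      qed
    qed
    ultimately show ?thesis unfolding adjoint_def using p q by blast
  qed
  show ?thesis
  proof
    assume f: "f \<in> hom exC a b"
    then obtain \<Phi> where \<Phi>: "f = (a, \<Phi>, b)" and ab: "a \<in> Obj exC" "b \<in> Obj exC" and p: "bimodule a b \<Phi>"
      and r: "has_right_adjoint (Qw C) f"
      unfolding 1 Q by blast
    obtain \<Psi> where "adjoint a b \<Phi> \<Psi>"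
      using r 3[OF ab p] unfolding \<Phi> 2[OF ab] by blast
    then show "a \<in> Obj exC \<and> b \<in> Obj exC \<and> (\<exists>\<Phi> \<Psi>. f = (a, \<Phi>, b) \<and> adjoint a b \<Phi> \<Psi>)"
      using \<Phi> ab by blast
  next
    assume "a \<in> Obj exC \<and> b \<in> Obj exC \<and> (\<exists>\<Phi> \<Psi>. f = (a, \<Phi>, b) \<and> adjoint a b \<Phi> \<Psi>)"
    then obtain \<Phi> \<Psi> where \<Phi>: "f = (a, \<Phi>, b)" and ab: "a \<in> Obj exC" "b \<in> Obj exC"
      and adj: "adjoint a b \<Phi> \<Psi>" by blast
    have pq: "bimodule a b \<Phi>" "bimodule b a \<Psi>" using adj unfolding adjoint_def by auto
    have "has_right_adjoint (Qw C) f"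
      unfolding \<Phi> 2[OF ab] using pq adj 3[OF ab pq] by blast
    then show "f \<in> hom exC a b" unfolding 1 Q using \<Phi> ab pq by blast
  qed
qed

text \<open>An arrow \<open>\<Phi>\<close> of the exact completion relates \<open>x\<close> to \<open>y\<close> iff its value at \<open>x\<close> is below
  \<open>y\<close>; so its value at \<open>x\<close> is the least \<open>y\<close> related to \<open>x\<close>, stably under restriction.\<close>

definition val :: "('o, 'a) carr \<Rightarrow> 'o \<Rightarrow> 'a \<Rightarrow> 'a \<Rightarrow> bool" where
  "val f A x y \<longleftrightarrow> relates (fst f) (snd (snd f)) (fst (snd f)) A x y \<and>
    (\<forall>B u y'. u \<in> hom C B A \<longrightarrow> relates (fst f) (snd (snd f)) (fst (snd f)) B (x \<cdot> u) y' \<longrightarrow>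
      le (snd (snd f)) B (y \<cdot> u) y')"

text \<open>Locally the unit provides \<open>z\<close> with \<open>\<Phi>(x, z)\<close> and
  \<open>\<Psi>(z, x)\<close>. If \<open>y\<close> is least then it lies below \<open>z\<close>, and
  \<open>\<Psi>\<close> absorbs this step; conversely the counit is leastness. While
  \<open>val\<close> mentions only \<open>\<Phi>\<close>, the right-hand side exhibits it as
  definable.\<close>

lemma val_adjoint_iff:
  assumes a: "a \<in> Obj exC" and b: "b \<in> Obj exC" and adj: "adjoint a b \<Phi> \<Psi>"
  shows "val (a, \<Phi>, b) A x y \<longleftrightarrow> relates a b \<Phi> A x y \<and> relates b a \<Psi> A y x"
proof -
  have pq: "bimodule a b \<Phi>" "bimodule b a \<Psi>" using adj unfolding adjoint_def by auto
  note Q = bimodule_relation[OF pq(2)]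
  have counit: "le b A y y'" if "relates b a \<Psi> A y x" "relates a b \<Phi> A x y'" for A x y y'
    using adj that unfolding adjoint_def by blast
  show ?thesis
  proof
    assume v: "val (a, \<Phi>, b) A x y"
    then have m: "relates a b \<Phi> A x y" by (simp add: val_def)
    have x: "x \<in> hom C A (fst a)" "y \<in> hom C A (fst b)" using mem_hom[OF m] by auto
    obtain B e z where e: "cover e B A" and z: "relates a b \<Phi> B (x \<cdot> e) z" "relates b a \<Psi> B z (x \<cdot> e)"
      using adj x unfolding adjoint_def by blast
    have "le b B (y \<cdot> e) z" using v e z(1) by (simp add: val_def)
    then have "relates b a \<Psi> B (y \<cdot> e) (x \<cdot> e)"
      using bimoduleD[OF pq(2) _ z(2) le_refl[OF a]] mem_hom[OF z(1)] by blast
    then show "relates a b \<Phi> A x y \<and> relates b a \<Psi> A y x"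
      using mem_local[OF Q e x(2,1)] m by blast
  next
    assume h: "relates a b \<Phi> A x y \<and> relates b a \<Psi> A y x"
    then have xy: "relates a b \<Phi> A x y" and yx: "relates b a \<Psi> A y x" by auto
    have "le b B (y \<cdot> u) y'" if "u \<in> hom C B A" "relates a b \<Phi> B (x \<cdot> u) y'" for B u y'
      using counit[OF mem_restrict[OF Q yx that(1)] that(2)] .
    then show "val (a, \<Phi>, b) A x y"
      unfolding val_def using xy by simp
  qed
qed

section \<open>Calculating with values of arrows\<close>

lemma exreg_arrowE:
  assumes "f \<in> hom exC a b"
  obtains \<Phi> \<Psi> where "a \<in> Obj exC" "b \<in> Obj exC" "f = (a, \<Phi>, b)" "bimodule a b \<Phi>" "bimodule b a \<Psi>"
    "adjoint a b \<Phi> \<Psi>" "val f = (\<lambda>A x y. relates a b \<Phi> A x y \<and> relates b a \<Psi> A y x)"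
proof -
  obtain \<Phi> \<Psi> where h: "a \<in> Obj exC" "b \<in> Obj exC" "f = (a, \<Phi>, b)" "adjoint a b \<Phi> \<Psi>"
    using assms unfolding hom_exreg_iff by blast
  have "val f = (\<lambda>A x y. relates a b \<Phi> A x y \<and> relates b a \<Psi> A y x)"
    unfolding h(3) by (intro ext val_adjoint_iff[OF h(1,2,4)])
  moreover have "bimodule a b \<Phi>" "bimodule b a \<Psi>" using h(4) unfolding adjoint_def by auto
  ultimately show ?thesis using that[OF h(1-3) _ _ h(4)] by blast
qed

context
  fixes f :: "('o, 'a) carr" and a b :: "('o, 'a) cobj"
  assumes f: "f \<in> hom exC a b"
begin

lemma exreg_hom_Obj: "a \<in> Obj exC" "b \<in> Obj exC"
  using exreg_arrowE[OF f] by blast+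

lemma val_definable: "definable (fst a) (fst b) (val f)"
proof (rule exreg_arrowE[OF f])
  fix \<Phi> \<Psi> assume "bimodule a b \<Phi>" "bimodule b a \<Psi>"
    and v: "val f = (\<lambda>A x y. relates a b \<Phi> A x y \<and> relates b a \<Psi> A y x)"
  then show ?thesis
    unfolding v by (intro definable_conj[OF bimodule_definable definable_converse[OF bimodule_definable]])
qed

lemma val_hom: "val f A x y \<Longrightarrow> x \<in> hom C A (fst a)" "val f A x y \<Longrightarrow> y \<in> hom C A (fst b)"
  using definableD(1)[OF val_definable] by blast+

lemma val_restrict: "val f A x y \<Longrightarrow> u \<in> hom C B A \<Longrightarrow> val f B (x \<cdot> u) (y \<cdot> u)"
  by (rule definableD(2)[OF val_definable])

lemma val_local: "cover e B A \<Longrightarrow> x \<in> hom C A (fst a) \<Longrightarrow> y \<in> hom C A (fst b) \<Longrightarrow>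
    val f B (x \<cdot> e) (y \<cdot> e) \<Longrightarrow> val f A x y"
  by (rule definableD(3)[OF val_definable])

text \<open>This is the unit of the adjunction; the cover comes from the existential quantifier in
  the composite of \<open>\<Psi>\<close> and \<open>\<Phi>\<close>.\<close>

lemma val_total:
  assumes "x \<in> hom C A (fst a)"
  obtains B e y where "cover e B A" "val f B (x \<cdot> e) y"
proof (rule exreg_arrowE[OF f])
  fix \<Phi> \<Psi> assume "adjoint a b \<Phi> \<Psi>"
    and v: "val f = (\<lambda>A x y. relates a b \<Phi> A x y \<and> relates b a \<Psi> A y x)"
  then show ?thesis using that assms unfolding v adjoint_def by meson
qed

text \<open>\<open>\<Phi>\<close> absorbs the step from \<open>x\<close> to \<open>x'\<close>, so it
  relates \<open>x\<close> to \<open>y'\<close>; the counit then puts the value \<open>y\<close> at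
  \<open>x\<close> below \<open>y'\<close>.\<close>

lemma val_mono:
  assumes "val f A x y" "val f A x' y'" "le a A x x'"
  shows "le b A y y'"
proof (rule exreg_arrowE[OF f])
  fix \<Phi> \<Psi> assume adj: "adjoint a b \<Phi> \<Psi>" and p: "bimodule a b \<Phi>" and b: "b \<in> Obj exC"
    and v: "val f = (\<lambda>A x y. relates a b \<Phi> A x y \<and> relates b a \<Psi> A y x)"
  have "relates a b \<Phi> A x y'"
    using bimoduleD[OF p assms(3) _ le_refl[OF b]] assms(2) val_hom(2)[OF assms(2)] unfolding v by blast
  then show ?thesis using adj assms(1) unfolding v adjoint_def by blast
qed

text \<open>The graph is closed under the equivalences of both preorders, as \<open>\<Phi>\<close>
  and \<open>\<Psi>\<close> absorb inequalities in opposite directions. Values are thus meaningful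
  only up to equivalence.\<close>

lemma val_cong:
  assumes v: "val f A x y" and x: "le a A x x'" "le a A x' x" and y: "le b A y y'" "le b A y' y"
  shows "val f A x' y'"
proof (rule exreg_arrowE[OF f])
  fix \<Phi> \<Psi> assume pq: "bimodule a b \<Phi>" "bimodule b a \<Psi>"
    and v': "val f = (\<lambda>A x y. relates a b \<Phi> A x y \<and> relates b a \<Psi> A y x)"
  show ?thesis
    using v bimoduleD[OF pq(1) x(2) _ y(1)] bimoduleD[OF pq(2) y(2) _ x(1)] unfolding v' by blast
qed

lemma val_unique: "val f A x y \<Longrightarrow> val f A x y' \<Longrightarrow> le b A y y'"
  using val_mono le_refl[OF exreg_hom_Obj(1)] val_hom(1) by blast

lemma val_cong_right:
  assumes "val f A x y" "le b A y y'" "le b A y' y"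
  shows "val f A x y'"
  using val_cong[OF assms(1) _ _ assms(2,3)] le_refl[OF exreg_hom_Obj(1)] val_hom(1)[OF assms(1)] by blast

end

text \<open>Unfolded, the larger arrow must have the smaller relation. If \<open>\<Phi>'\<close>
  relates \<open>x\<close> to \<open>z\<close>, then over a cover the value of \<open>f\<close> lies
  below that of \<open>g\<close>, which lies below \<open>z\<close>; so \<open>\<Phi>\<close>
  relates \<open>x\<close> to \<open>z\<close> there, and locality finishes.\<close>

lemma exreg_leI:
  assumes f: "f \<in> hom exC a b" and g: "g \<in> hom exC a b"
    and le: "\<And>A x y z. val f A x y \<Longrightarrow> val g A x z \<Longrightarrow> le b A y z"
  shows "f \<sqsubseteq> g"
proof (rule exreg_arrowE[OF f], rule exreg_arrowE[OF g])
  fix \<Phi> \<Psi> \<Phi>' \<Psi>'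
  assume a: "a \<in> Obj exC" and b: "b \<in> Obj exC" and fg: "f = (a, \<Phi>, b)" "g = (a, \<Phi>', b)"
    and p: "bimodule a b \<Phi>" "bimodule a b \<Phi>'" and adj: "adjoint a b \<Phi>' \<Psi>'"
    and vf: "val f = (\<lambda>A x y. relates a b \<Phi> A x y \<and> relates b a \<Psi> A y x)"
    and vg: "val g = (\<lambda>A x y. relates a b \<Phi>' A x y \<and> relates b a \<Psi>' A y x)"
  note P = bimodule_relation[OF p(1)] and P' = bimodule_relation[OF p(2)]
  have "relates a b \<Phi> A x z" if z: "relates a b \<Phi>' A x z" for A x z
  proof -
    have xz: "x \<in> hom C A (fst a)" "z \<in> hom C A (fst b)" using mem_hom[OF z] by auto
    obtain B e y where e: "cover e B A" and y: "val f B (x \<cdot> e) y" using val_total[OF f xz(1)] .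
    note eh = conjunct2[OF e]
    obtain B' e' w where e': "cover e' B' B" and w: "val g B' ((x \<cdot> e) \<cdot> e') w"
      using val_total[OF g val_hom(1)[OF f y]] .
    note e'h = conjunct2[OF e']
    have yw: "le b B' (y \<cdot> e') w" using le[OF val_restrict[OF f y e'h] w] .
    have "relates a b \<Phi>' B' ((x \<cdot> e) \<cdot> e') ((z \<cdot> e) \<cdot> e')"
      by (rule mem_restrict[OF P' mem_restrict[OF P' z eh] e'h])
    then have "le b B' w ((z \<cdot> e) \<cdot> e')"
      using adj w unfolding vg adjoint_def by blast
    then have yz: "le b B' (y \<cdot> e') ((z \<cdot> e) \<cdot> e')" by (rule le_trans[OF b yw])
    have "relates a b \<Phi> B' ((x \<cdot> e) \<cdot> e') (y \<cdot> e')"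
      using val_restrict[OF f y e'h] unfolding vf by blast
    then have "relates a b \<Phi> B' ((x \<cdot> e) \<cdot> e') ((z \<cdot> e) \<cdot> e')"
      using bimoduleD[OF p(1) le_refl[OF a] _ yz] mem_hom by blast
    then show ?thesis
      using mem_local[OF P e xz mem_local[OF P e' Cmp_hom[OF eh xz(1)] Cmp_hom[OF eh xz(2)]]] by blast
  qed
  then show ?thesis unfolding fg exreg_simps using rel_le_iff[OF P' P] by simp
qed

lemma exreg_leD:
  assumes f: "f \<in> hom exC a b" and g: "g \<in> hom exC a b" and fg: "f \<sqsubseteq> g"
    and y: "val f A x y" and z: "val g A x z"
  shows "le b A y z"
proof (rule exreg_arrowE[OF f], rule exreg_arrowE[OF g])
  fix \<Phi> \<Psi> \<Phi>' \<Psi>'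
  assume fg': "f = (a, \<Phi>, b)" "g = (a, \<Phi>', b)"
    and p: "bimodule a b \<Phi>" "bimodule a b \<Phi>'" and adj: "adjoint a b \<Phi> \<Psi>"
    and vf: "val f = (\<lambda>A x y. relates a b \<Phi> A x y \<and> relates b a \<Psi> A y x)"
    and vg: "val g = (\<lambda>A x y. relates a b \<Phi>' A x y \<and> relates b a \<Psi>' A y x)"
  have "relates a b \<Phi> A x z"
    using fg z rel_le_iff[OF bimodule_relation[OF p(2)] bimodule_relation[OF p(1)]]
    unfolding fg' vg[unfolded fg'] exreg_simps by simp
  then show ?thesis using adj y unfolding vf adjoint_def by blast
qed

lemma exreg_antisym:
  assumes f: "f \<in> hom exC a b" and g: "g \<in> hom exC a b" and "f \<sqsubseteq> g" "g \<sqsubseteq> f"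
  shows "f = g"
proof (rule exreg_arrowE[OF f], rule exreg_arrowE[OF g])
  fix \<Phi> \<Phi>' assume fg: "f = (a, \<Phi>, b)" "g = (a, \<Phi>', b)" and p: "bimodule a b \<Phi>" "bimodule a b \<Phi>'"
  note P = bimodule_relation[OF p(1)] and P' = bimodule_relation[OF p(2)]
  have "\<Phi> = \<Phi>'"
    using assms(3,4) unfolding fg exreg_simps
    by (intro relation_eqI[OF P P']) (auto simp: rel_le_iff[OF P P'] rel_le_iff[OF P' P])
  then show ?thesis using fg by simp
qed

lemma exreg_eqI:
  assumes f: "f \<in> hom exC a b" and g: "g \<in> hom exC a b"
    and eq: "\<And>A x y z. val f A x y \<Longrightarrow> val g A x z \<Longrightarrow> le b A y z \<and> le b A z y"
  shows "f = g"
  using exreg_antisym[OF f g] exreg_leI[OF f g] exreg_leI[OF g f] eq by blast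

text \<open>\<open>\<Phi>(x, y)\<close> says that the \<open>P\<close>-value of \<open>x\<close> is
  below \<open>y\<close>, and \<open>\<Psi>(y, x)\<close> that \<open>y\<close> is below it.
  Totality gives the unit, monotonicity the counit, and both together the bimodule laws.
  \<open>P\<close> itself may be smaller than the graph of \<open>f\<close>, for it is not assumed
  to be closed under equivalence.\<close>

lemma exreg_arrow_of_graph:
  assumes a: "a \<in> Obj exC" and b: "b \<in> Obj exC" and P: "definable (fst a) (fst b) P"
    and total: "\<And>A x. x \<in> hom C A (fst a) \<Longrightarrow> \<exists>B e y. cover e B A \<and> P B (x \<cdot> e) y"
    and mono: "\<And>A x x' y y'. P A x y \<Longrightarrow> P A x' y' \<Longrightarrow> le a A x x' \<Longrightarrow> le b A y y'"
  obtains f where "f \<in> hom exC a b" "\<And>A x y. P A x y \<Longrightarrow> val f A x y"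
proof -
  note D = definableD[OF P]
  obtain R where R: "relation C (fst a) (fst b) R" "mem (fst a) (fst b) R = P"
    using P unfolding definable_def by blast
  obtain R' where R': "relation C (fst b) (fst a) R'" "mem (fst b) (fst a) R' = (\<lambda>A y x. P A x y)"
    using definable_converse[OF P] unfolding definable_def by blast
  define \<Phi> where "\<Phi> = rel_comp C (fst a) (fst b) (fst b) (snd b) R"
  define \<Psi> where "\<Psi> = rel_comp C (fst b) (fst b) (fst a) R' (snd b)"
  note Rb = cobj_relation[OF b]
  have \<Phi>: "relation C (fst a) (fst b) \<Phi>"
    and \<Phi>': "\<And>A x y. relates a b \<Phi> A x y \<longleftrightarrow> x \<in> hom C A (fst a) \<and> y \<in> hom C A (fst b) \<and>
      (\<exists>B e z. cover e B A \<and> P B (x \<cdot> e) z \<and> le b B z (y \<cdot> e))"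
    unfolding \<Phi>_def using rel_comp[OF R(1) Rb, folded le_def] R(2) by auto
  have \<Psi>: "relation C (fst b) (fst a) \<Psi>"
    and \<Psi>': "\<And>A x y. relates b a \<Psi> A y x \<longleftrightarrow> y \<in> hom C A (fst b) \<and> x \<in> hom C A (fst a) \<and>
      (\<exists>B e z. cover e B A \<and> le b B (y \<cdot> e) z \<and> P B (x \<cdot> e) z)"
    unfolding \<Psi>_def using rel_comp[OF Rb R'(1), folded le_def] R'(2) by auto
  have PI: "relates a b \<Phi> A x y \<and> relates b a \<Psi> A y x" if "P A x y" for A x y
  proof -
    have x: "x \<in> hom C A (fst a)" "y \<in> hom C A (fst b)" using D(1)[OF that] by auto
    have "cover (Idn C A) A A" using cover_Idn hom_Obj(1)[OF x(1)] by blast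
    then show ?thesis
      unfolding \<Phi>' \<Psi>' using that x le_refl[OF b x(2)] Cmp_Idn_right[OF x(1)] Cmp_Idn_right[OF x(2)]
      by metis
  qed
  have "bimodule a b \<Phi>"
    unfolding bimodule_def
  proof (intro conjI \<Phi> allI impI)
    fix A x x' y y' assume xx: "le a A x' x" and xy: "relates a b \<Phi> A x y" and yy: "le b A y y'"
    have h: "x' \<in> hom C A (fst a)" "y' \<in> hom C A (fst b)" using le_hom xx yy by auto
    obtain B e z where e: "cover e B A" and z: "P B (x \<cdot> e) z" "le b B z (y \<cdot> e)"
      using xy unfolding \<Phi>' by blast
    note eh = conjunct2[OF e]
    have xxe: "le a B (x' \<cdot> e) (x \<cdot> e)" using le_restrict[OF a xx eh] .
    \<comment> \<open>The witness \<open>z\<close> is a value at \<open>x\<close>, but one at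
      \<open>x'\<close> is required. It exists over a second cover, where \<open>w\<close> lies
      below \<open>z\<close>, hence below \<open>y\<close> and \<open>y'\<close>.\<close>
    obtain B' e' w where e': "cover e' B' B" and w: "P B' ((x' \<cdot> e) \<cdot> e') w"
      using total[OF le_hom(1)[OF xxe]] by blast
    note e'h = conjunct2[OF e']
    have "le b B' w (z \<cdot> e')" using mono[OF w D(2)[OF z(1) e'h] le_restrict[OF a xxe e'h]] .
    moreover have "le b B' (z \<cdot> e') ((y \<cdot> e) \<cdot> e')" using le_restrict[OF b z(2) e'h] .
    moreover have "le b B' ((y \<cdot> e) \<cdot> e') ((y' \<cdot> e) \<cdot> e')"
      using le_restrict[OF b le_restrict[OF b yy eh] e'h] .
    ultimately have "le b B' w ((y' \<cdot> e) \<cdot> e')" using le_trans[OF b] by blast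
    then show "relates a b \<Phi> A x' y'"
      unfolding \<Phi>' using h cover_Cmp[OF e e'] w Cmp_assoc[OF e'h eh h(1)] Cmp_assoc[OF e'h eh h(2)]
      by metis
  qed
  moreover have "bimodule b a \<Psi>"
    unfolding bimodule_def
  proof (intro conjI \<Psi> allI impI)
    fix A x x' y y' assume yy: "le b A y' y" and yx: "relates b a \<Psi> A y x" and xx: "le a A x x'"
    have h: "x' \<in> hom C A (fst a)" "y' \<in> hom C A (fst b)" using le_hom xx yy by auto
    obtain B e z where e: "cover e B A" and z: "P B (x \<cdot> e) z" "le b B (y \<cdot> e) z"
      using yx unfolding \<Psi>' by blast
    note eh = conjunct2[OF e]
    have xxe: "le a B (x \<cdot> e) (x' \<cdot> e)" using le_restrict[OF a xx eh] .
    obtain B' e' w where e': "cover e' B' B" and w: "P B' ((x' \<cdot> e) \<cdot> e') w"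
      using total[OF le_hom(2)[OF xxe]] by blast
    note e'h = conjunct2[OF e']
    have "le b B' (z \<cdot> e') w" using mono[OF D(2)[OF z(1) e'h] w le_restrict[OF a xxe e'h]] .
    moreover have "le b B' ((y \<cdot> e) \<cdot> e') (z \<cdot> e')" using le_restrict[OF b z(2) e'h] .
    moreover have "le b B' ((y' \<cdot> e) \<cdot> e') ((y \<cdot> e) \<cdot> e')"
      using le_restrict[OF b le_restrict[OF b yy eh] e'h] .
    ultimately have "le b B' ((y' \<cdot> e) \<cdot> e') w" using le_trans[OF b] by blast
    then show "relates b a \<Psi> A y' x'"
      unfolding \<Psi>' using h cover_Cmp[OF e e'] w Cmp_assoc[OF e'h eh h(1)] Cmp_assoc[OF e'h eh h(2)]
      by metis
  qed
  moreover have "\<exists>B e y. cover e B A \<and> relates a b \<Phi> B (x \<cdot> e) y \<and> relates b a \<Psi> B y (x \<cdot> e)"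
    if "x \<in> hom C A (fst a)" for A x
    using total[OF that] PI by blast
  moreover have "le b A y y'" if yx: "relates b a \<Psi> A y x" and xy: "relates a b \<Phi> A x y'" for A x y y'
  proof -
    have h: "y \<in> hom C A (fst b)" "y' \<in> hom C A (fst b)" using mem_hom yx xy by blast+
    obtain B e z where e: "cover e B A" and z: "P B (x \<cdot> e) z" "le b B (y \<cdot> e) z"
      using yx unfolding \<Psi>' by blast
    note eh = conjunct2[OF e]
    obtain B' e' w where e': "cover e' B' B" and w: "P B' ((x \<cdot> e) \<cdot> e') w" "le b B' w ((y' \<cdot> e) \<cdot> e')"
      using mem_restrict[OF \<Phi> xy eh] unfolding \<Phi>' by blast
    note e'h = conjunct2[OF e']
    have "le b B' (z \<cdot> e') w"
      using mono[OF D(2)[OF z(1) e'h] w(1) le_refl[OF a]] D(1)[OF w(1)] by blast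
    then have "le b B' ((y \<cdot> e) \<cdot> e') ((y' \<cdot> e) \<cdot> e')"
      using le_restrict[OF b z(2) e'h] w(2) le_trans[OF b] by blast
    then show ?thesis
      using le_local[OF b e h le_local[OF b e' Cmp_hom[OF eh h(1)] Cmp_hom[OF eh h(2)]]] by blast
  qed
  ultimately have adj: "adjoint a b \<Phi> \<Psi>" unfolding adjoint_def by blast
  show ?thesis
  proof (rule that[of "(a, \<Phi>, b)"])
    show "(a, \<Phi>, b) \<in> hom exC a b" unfolding hom_exreg_iff using a b adj by blast
    show "val (a, \<Phi>, b) A x y" if "P A x y" for A x y
      unfolding val_adjoint_iff[OF a b adj] using PI[OF that] .
  qed
qed

text \<open>The congruence is its own right adjoint. The graph of an identity is therefore
  equivalence of elements rather than equality.\<close>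

lemma exreg_Idn:
  assumes a: "a \<in> Obj exC"
  shows "Idn exC a \<in> hom exC a a" "val (Idn exC a) A x y \<longleftrightarrow> le a A x y \<and> le a A y x"
proof -
  have bm: "bimodule a a (snd a)"
    unfolding bimodule_def le_def[symmetric] using cobj_relation[OF a] le_trans[OF a] by blast
  have "\<exists>B e y. cover e B A \<and> le a B (x \<cdot> e) y \<and> le a B y (x \<cdot> e)" if x: "x \<in> hom C A (fst a)" for A x
    using cover_Idn[OF hom_Obj(1)[OF x]] le_refl[OF a x] Cmp_Idn_right[OF x] by metis
  then have adj: "adjoint a a (snd a) (snd a)"
    unfolding adjoint_def le_def[symmetric] using bm le_trans[OF a] by blast
  show "Idn exC a \<in> hom exC a a" unfolding hom_exreg_iff using a adj by auto
  show "val (Idn exC a) A x y \<longleftrightarrow> le a A x y \<and> le a A y x"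
    using val_adjoint_iff[OF a a adj] by (simp add: le_def)
qed

lemma bimodule_comp:
  assumes a: "a \<in> Obj exC" and b: "b \<in> Obj exC" and c: "c \<in> Obj exC"
    and p: "bimodule a b \<Phi>" and q: "bimodule b c \<Phi>'"
  shows "bimodule a c (rel_comp C (fst a) (fst b) (fst c) \<Phi>' \<Phi>)"
proof -
  note P = bimodule_relation[OF p] and Q = bimodule_relation[OF q]
  show ?thesis
    unfolding bimodule_def
  proof (intro conjI allI impI rel_comp(1)[OF P Q])
    fix A x x' z z' assume xx: "le a A x' x" and zz: "le c A z z'"
      and "relates a c (rel_comp C (fst a) (fst b) (fst c) \<Phi>' \<Phi>) A x z"
    then obtain B e y where e: "cover e B A" and y: "relates a b \<Phi> B (x \<cdot> e) y" "relates b c \<Phi>' B y (z \<cdot> e)"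
      unfolding rel_comp(2)[OF P Q] by blast
    note eh = conjunct2[OF e]
    have yy: "le b B y y" using le_refl[OF b] y mem_hom by blast
    have "relates a b \<Phi> B (x' \<cdot> e) y" using bimoduleD[OF p le_restrict[OF a xx eh] y(1) yy] .
    moreover have "relates b c \<Phi>' B y (z' \<cdot> e)" using bimoduleD[OF q yy y(2) le_restrict[OF c zz eh]] .
    ultimately show "relates a c (rel_comp C (fst a) (fst b) (fst c) \<Phi>' \<Phi>) A x' z'"
      unfolding rel_comp(2)[OF P Q] using le_hom(1)[OF xx] le_hom(2)[OF zz] e by blast
  qed
qed

text \<open>Left adjoints compose, with the right adjoints in reverse order; each triangle is
  computed over the composite of two covers.\<close>

lemma adjoint_comp:
  assumes a: "a \<in> Obj exC" and b: "b \<in> Obj exC" and c: "c \<in> Obj exC"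
    and f: "adjoint a b \<Phi> \<Psi>" and g: "adjoint b c \<Phi>' \<Psi>'"
  shows "adjoint a c (rel_comp C (fst a) (fst b) (fst c) \<Phi>' \<Phi>) (rel_comp C (fst c) (fst b) (fst a) \<Psi> \<Psi>')"
    (is "adjoint a c ?F ?G")
proof -
  have bm: "bimodule a b \<Phi>" "bimodule b a \<Psi>" "bimodule b c \<Phi>'" "bimodule c b \<Psi>'"
    using f g unfolding adjoint_def by auto
  note R = bm[THEN bimodule_relation]
  note F = rel_comp[OF R(1,3)] and G = rel_comp[OF R(4,2)]
  have "\<exists>B e z. cover e B A \<and> relates a c ?F B (x \<cdot> e) z \<and> relates c a ?G B z (x \<cdot> e)"
    if x: "x \<in> hom C A (fst a)" for A x
  proof -
    obtain B e y where e: "cover e B A" and y: "relates a b \<Phi> B (x \<cdot> e) y" "relates b a \<Psi> B y (x \<cdot> e)"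
      using f x unfolding adjoint_def by blast
    note eh = conjunct2[OF e]
    have yh: "y \<in> hom C B (fst b)" using y mem_hom by blast
    obtain B' e' z where e': "cover e' B' B" and z: "relates b c \<Phi>' B' (y \<cdot> e') z"
      "relates c b \<Psi>' B' z (y \<cdot> e')"
      using g yh unfolding adjoint_def by blast
    note e'h = conjunct2[OF e']
    note ye = mem_restrict[OF R(1) y(1) e'h] mem_restrict[OF R(2) y(2) e'h]
    have h: "(x \<cdot> e) \<cdot> e' \<in> hom C B' (fst a)" "z \<in> hom C B' (fst c)"
      using mem_hom[OF ye(1)] mem_hom[OF z(1)] by auto
    have i: "cover (Idn C B') B' B'" using cover_Idn[OF hom_Obj(1)[OF e'h]] .
    have "relates a c ?F B' ((x \<cdot> e) \<cdot> e') z" "relates c a ?G B' z ((x \<cdot> e) \<cdot> e')"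
      unfolding F(2) G(2) using h i ye z Cmp_Idn_right[OF h(1)] Cmp_Idn_right[OF h(2)] by metis+
    then show ?thesis using cover_Cmp[OF e e'] Cmp_assoc[OF e'h eh x] by metis
  qed
  moreover have "le c A z z'" if zx: "relates c a ?G A z x" and xz: "relates a c ?F A x z'" for A x z z'
  proof -
    have h: "z \<in> hom C A (fst c)" "z' \<in> hom C A (fst c)" using mem_hom zx xz by blast+
    obtain B e y where e: "cover e B A" and y: "relates c b \<Psi>' B (z \<cdot> e) y" "relates b a \<Psi> B y (x \<cdot> e)"
      using zx unfolding G(2) by blast
    note eh = conjunct2[OF e]
    obtain B' e' w where e': "cover e' B' B" and w: "relates a b \<Phi> B' ((x \<cdot> e) \<cdot> e') w"
      "relates b c \<Phi>' B' w ((z' \<cdot> e) \<cdot> e')"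
      using mem_restrict[OF F(1) xz eh] unfolding F(2) by blast
    note e'h = conjunct2[OF e']
    note ye = mem_restrict[OF R(4) y(1) e'h] mem_restrict[OF R(2) y(2) e'h]
    have yw: "le b B' (y \<cdot> e') w" using f ye(2) w(1) unfolding adjoint_def by blast
    have "relates b c \<Phi>' B' (y \<cdot> e') ((z' \<cdot> e) \<cdot> e')"
      using bimoduleD[OF bm(3) yw w(2) le_refl[OF c]] mem_hom[OF w(2)] by blast
    then have "le c B' ((z \<cdot> e) \<cdot> e') ((z' \<cdot> e) \<cdot> e')" using g ye(1) unfolding adjoint_def by blast
    then show ?thesis
      using le_local[OF c e h le_local[OF c e' Cmp_hom[OF eh h(1)] Cmp_hom[OF eh h(2)]]] by blast
  qed
  moreover have "bimodule a c ?F" "bimodule c a ?G"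
    using bimodule_comp[OF a b c bm(1,3)] bimodule_comp[OF c b a bm(4,2)] .
  ultimately show ?thesis unfolding adjoint_def by blast
qed

lemma exreg_Cmp:
  assumes f: "f \<in> hom exC a b" and g: "g \<in> hom exC b c"
  shows "g \<bullet> f \<in> hom exC a c"
    and "val f A x y \<Longrightarrow> val g A y z \<Longrightarrow> val (g \<bullet> f) A x z"
proof -
  obtain \<Phi> \<Psi> where 1: "a \<in> Obj exC" "b \<in> Obj exC" "f = (a, \<Phi>, b)" "bimodule a b \<Phi>" "bimodule b a \<Psi>"
    "adjoint a b \<Phi> \<Psi>" "val f = (\<lambda>A x y. relates a b \<Phi> A x y \<and> relates b a \<Psi> A y x)"
    using exreg_arrowE[OF f] .
  obtain \<Phi>' \<Psi>' where 2: "b \<in> Obj exC" "c \<in> Obj exC" "g = (b, \<Phi>', c)" "bimodule b c \<Phi>'" "bimodule c b \<Psi>'"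
    "adjoint b c \<Phi>' \<Psi>'" "val g = (\<lambda>A x y. relates b c \<Phi>' A x y \<and> relates c b \<Psi>' A y x)"
    using exreg_arrowE[OF g] .
  note adj = adjoint_comp[OF 1(1,2) 2(2) 1(6) 2(6)]
  have gf: "g \<bullet> f = (a, rel_comp C (fst a) (fst b) (fst c) \<Phi>' \<Phi>, c)"
    unfolding 1(3) 2(3) by simp
  show "g \<bullet> f \<in> hom exC a c" unfolding gf hom_exreg_iff using 1(1) 2(2) adj by blast
  note R = 1(4)[THEN bimodule_relation] 1(5)[THEN bimodule_relation]
    2(4)[THEN bimodule_relation] 2(5)[THEN bimodule_relation]
  assume v: "val f A x y" "val g A y z"
  have h: "x \<in> hom C A (fst a)" "y \<in> hom C A (fst b)" "z \<in> hom C A (fst c)"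
    using val_hom[OF f v(1)] val_hom[OF g v(2)] by auto
  have i: "cover (Idn C A) A A" using cover_Idn[OF hom_Obj(1)[OF h(1)]] .
  show "val (g \<bullet> f) A x z"
    unfolding gf val_adjoint_iff[OF 1(1) 2(2) adj] rel_comp(2)[OF R(1,3)] rel_comp(2)[OF R(4,2)]
    using v[unfolded 1(7) 2(7)] i h Cmp_Idn_right[OF h(1)] Cmp_Idn_right[OF h(3)] by metis
qed

text \<open>Locally \<open>g\<close> has some value \<open>w\<close> at \<open>y\<close>; it is also
  a value of the composite at \<open>x\<close>, hence equivalent to \<open>z\<close>. By saturation
  and locality of the graph of \<open>g\<close>, no cover remains in the conclusion.\<close>

lemma val_CmpD:
  assumes f: "f \<in> hom exC a b" and g: "g \<in> hom exC b c"
    and y: "val f A x y" and z: "val (g \<bullet> f) A x z"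
  shows "val g A y z"
proof -
  note gf = exreg_Cmp(1)[OF f g]
  note h = val_hom(2)[OF f y] val_hom(2)[OF gf z]
  obtain B e w where e: "cover e B A" and w: "val g B (y \<cdot> e) w" using val_total[OF g h(1)] .
  note eh = conjunct2[OF e]
  note w' = exreg_Cmp(2)[OF f g val_restrict[OF f y eh] w] and z' = val_restrict[OF gf z eh]
  have "val g B (y \<cdot> e) (z \<cdot> e)"
    using val_cong_right[OF g w val_unique[OF gf w' z'] val_unique[OF gf z' w']] .
  then show ?thesis by (rule val_local[OF g e h])
qed

text \<open>Each law is checked on values: pass to a cover on which the intermediate values exist,
  compare the results there, and descend by locality of the preorder.\<close>

lemma exreg_pos_category: "pos_category exC"
proof
  fix f assume "f \<in> Arr exC"
  then have f: "f \<in> hom exC (Dom exC f) (Cod exC f)" by (simp add: hom_def)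
  show "Dom exC f \<in> Obj exC" "Cod exC f \<in> Obj exC" using exreg_hom_Obj[OF f] .
next
  fix a assume "a \<in> Obj exC"
  then show "Idn exC a \<in> hom exC a a" by (rule exreg_Idn)
next
  fix f g a b c assume "f \<in> hom exC a b" "g \<in> hom exC b c"
  then show "g \<bullet> f \<in> hom exC a c" by (rule exreg_Cmp)
next
  fix f a b assume f: "f \<in> hom exC a b"
  note o = exreg_hom_Obj[OF f]
  note i = exreg_Idn[OF o(1)] and j = exreg_Idn[OF o(2)]
  show "Idn exC b \<bullet> f = f"
  proof (rule exreg_eqI[OF exreg_Cmp(1)[OF f j(1)] f])
    fix A x y z assume "val (Idn exC b \<bullet> f) A x y" and z: "val f A x z"
    then have "val (Idn exC b) A z y" using val_CmpD[OF f j(1) z] by blast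
    then show "le b A y z \<and> le b A z y" unfolding j(2) by blast
  qed
  show "f \<bullet> Idn exC a = f"
  proof (rule exreg_eqI[OF exreg_Cmp(1)[OF i(1) f] f])
    fix A x y z assume y: "val (f \<bullet> Idn exC a) A x y" and z: "val f A x z"
    have "val (Idn exC a) A x x" unfolding i(2) using le_refl[OF o(1) val_hom(1)[OF f z]] by blast
    then have "val f A x y" using val_CmpD[OF i(1) f _ y] by blast
    then show "le b A y z \<and> le b A z y" using val_unique[OF f] z by blast
  qed
  show "f \<sqsubseteq> f" using exreg_leI[OF f f] val_unique[OF f] by blast
next
  fix f g h a b c d assume f: "f \<in> hom exC a b" and g: "g \<in> hom exC b c" and h: "h \<in> hom exC c d"
  note gf = exreg_Cmp(1)[OF f g] and hg = exreg_Cmp(1)[OF g h]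
  note l = exreg_Cmp(1)[OF f hg] and r = exreg_Cmp(1)[OF gf h]
  note d = exreg_hom_Obj(2)[OF h]
  show "(h \<bullet> g) \<bullet> f = h \<bullet> (g \<bullet> f)"
  proof (rule exreg_eqI[OF l r])
    fix A x p q
    assume p: "val ((h \<bullet> g) \<bullet> f) A x p" and q: "val (h \<bullet> (g \<bullet> f)) A x q"
    note ph = val_hom[OF l p] and qh = val_hom[OF r q]
    obtain B e y where e: "cover e B A" and y: "val f B (x \<cdot> e) y" using val_total[OF f ph(1)] .
    note eh = conjunct2[OF e]
    note pe = val_restrict[OF l p eh] and qe = val_restrict[OF r q eh]
    note peh = val_hom(2)[OF l pe] and qeh = val_hom(2)[OF r qe]
    obtain B' e' z where e': "cover e' B' B" and z: "val g B' (y \<cdot> e') z"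
      using val_total[OF g val_hom(2)[OF f y]] .
    note e'h = conjunct2[OF e']
    note y' = val_restrict[OF f y e'h]
    have "val h B' z ((p \<cdot> e) \<cdot> e')"
      by (rule val_CmpD[OF g h z val_CmpD[OF f hg y' val_restrict[OF l pe e'h]]])
    moreover have "val h B' z ((q \<cdot> e) \<cdot> e')"
      by (rule val_CmpD[OF gf h exreg_Cmp(2)[OF f g y' z] val_restrict[OF r qe e'h]])
    ultimately have pq: "le d B' ((p \<cdot> e) \<cdot> e') ((q \<cdot> e) \<cdot> e')" "le d B' ((q \<cdot> e) \<cdot> e') ((p \<cdot> e) \<cdot> e')"
      using val_unique[OF h] by blast+
    show "le d A p q \<and> le d A q p"
      using le_local[OF d e ph(2) qh(2) le_local[OF d e' peh qeh pq(1)]]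
        le_local[OF d e qh(2) ph(2) le_local[OF d e' qeh peh pq(2)]] by blast
  qed
next
  fix f g a b assume "f \<in> hom exC a b" "g \<in> hom exC a b" "f \<sqsubseteq> g" "g \<sqsubseteq> f"
  then show "f = g" by (rule exreg_antisym)
next
  fix f g h a b assume f: "f \<in> hom exC a b" and g: "g \<in> hom exC a b" and h: "h \<in> hom exC a b"
    and fg: "f \<sqsubseteq> g" and gh: "g \<sqsubseteq> h"
  note b = exreg_hom_Obj(2)[OF f]
  show "f \<sqsubseteq> h"
  proof (rule exreg_leI[OF f h])
    fix A x y z assume y: "val f A x y" and z: "val h A x z"
    note yh = val_hom[OF f y] and zh = val_hom[OF h z]
    obtain B e w where e: "cover e B A" and w: "val g B (x \<cdot> e) w" using val_total[OF g yh(1)] .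
    note eh = conjunct2[OF e]
    have "le b B (y \<cdot> e) (z \<cdot> e)"
      using le_trans[OF b exreg_leD[OF f g fg val_restrict[OF f y eh] w]
          exreg_leD[OF g h gh w val_restrict[OF h z eh]]] .
    then show "le b A y z" by (rule le_local[OF b e yh(2) zh(2)])
  qed
next
  fix f g g' a b c assume f: "f \<in> hom exC a b" and g: "g \<in> hom exC b c" and g': "g' \<in> hom exC b c"
    and gg: "g \<sqsubseteq> g'"
  note c = exreg_hom_Obj(2)[OF g]
  note gf = exreg_Cmp(1)[OF f g] and g'f = exreg_Cmp(1)[OF f g']
  show "g \<bullet> f \<sqsubseteq> g' \<bullet> f"
  proof (rule exreg_leI[OF gf g'f])
    fix A x p q assume p: "val (g \<bullet> f) A x p" and q: "val (g' \<bullet> f) A x q"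
    note ph = val_hom[OF gf p] and qh = val_hom[OF g'f q]
    obtain B e y where e: "cover e B A" and y: "val f B (x \<cdot> e) y" using val_total[OF f ph(1)] .
    note eh = conjunct2[OF e]
    have "le c B (p \<cdot> e) (q \<cdot> e)"
      using exreg_leD[OF g g' gg val_CmpD[OF f g y val_restrict[OF gf p eh]]
          val_CmpD[OF f g' y val_restrict[OF g'f q eh]]] .
    then show "le c A p q" by (rule le_local[OF c e ph(2) qh(2)])
  qed
next
  fix f f' g a b c assume f: "f \<in> hom exC a b" and f': "f' \<in> hom exC a b" and g: "g \<in> hom exC b c"
    and ff: "f \<sqsubseteq> f'"
  note c = exreg_hom_Obj(2)[OF g]
  note gf = exreg_Cmp(1)[OF f g] and gf' = exreg_Cmp(1)[OF f' g]
  show "g \<bullet> f \<sqsubseteq> g \<bullet> f'"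
  proof (rule exreg_leI[OF gf gf'])
    fix A x p q assume p: "val (g \<bullet> f) A x p" and q: "val (g \<bullet> f') A x q"
    note ph = val_hom[OF gf p] and qh = val_hom[OF gf' q]
    obtain B e y where e: "cover e B A" and y: "val f B (x \<cdot> e) y" using val_total[OF f ph(1)] .
    note eh = conjunct2[OF e]
    note pe = val_restrict[OF gf p eh] and qe = val_restrict[OF gf' q eh]
    note peh = val_hom[OF gf pe] and qeh = val_hom[OF gf' qe]
    obtain B' e' z where e': "cover e' B' B" and z: "val f' B' ((x \<cdot> e) \<cdot> e') z"
      using val_total[OF f' qeh(1)] .
    note e'h = conjunct2[OF e']
    note y' = val_restrict[OF f y e'h]
    have "val g B' (y \<cdot> e') ((p \<cdot> e) \<cdot> e')" "val g B' z ((q \<cdot> e) \<cdot> e')"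
      using val_CmpD[OF f g y' val_restrict[OF gf pe e'h]]
        val_CmpD[OF f' g z val_restrict[OF gf' qe e'h]] .
    then have pq: "le c B' ((p \<cdot> e) \<cdot> e') ((q \<cdot> e) \<cdot> e')"
      by (rule val_mono[OF g _ _ exreg_leD[OF f f' ff y' z]])
    show "le c A p q"
      by (rule le_local[OF c e ph(2) qh(2) le_local[OF c e' peh(2) qeh(2) pq]])
  qed
qed

end

section \<open>Regularity of the exact completion\<close>

text \<open>From here on composites and the order are reasoned about through values and should not
  unfold into relations.\<close>

declare exreg_simps [simp del]

context regular_category
begin

interpretation exC: pos_category exC by (rule exreg_pos_category)

text \<open>The graph consists of the \<open>y\<close> equivalent, not equal, to
  \<open>t \<cdot> x\<close>. This makes it a conjunction of two inverse images of the preorder of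
  \<open>b\<close>, hence definable.\<close>

lemma exreg_arrow_of_map:
  assumes a: "a \<in> Obj exC" and b: "b \<in> Obj exC" and t: "t \<in> hom C (fst a) (fst b)"
    and mono: "\<And>A x x'. le a A x x' \<Longrightarrow> le b A (t \<cdot> x) (t \<cdot> x')"
  obtains f where "f \<in> hom exC a b" "\<And>A x. x \<in> hom C A (fst a) \<Longrightarrow> val f A x (t \<cdot> x)"
proof -
  define P where "P A x y \<longleftrightarrow> x \<in> hom C A (fst a) \<and> le b A (t \<cdot> x) y \<and> le b A y (t \<cdot> x)" for A x y
  have i: "Idn C (fst b) \<in> hom C (fst b) (fst b)" using Idn_hom cobj_Obj[OF b] by blast
  \<comment> \<open>The identity is inserted to bring both conjuncts into the shape of
    \<open>definable_vimage\<close>.\<close>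
  have eq: "P A x y \<longleftrightarrow>
    (x \<in> hom C A (fst a) \<and> y \<in> hom C A (fst b) \<and> le b A (t \<cdot> x) (Idn C (fst b) \<cdot> y)) \<and>
    (x \<in> hom C A (fst a) \<and> y \<in> hom C A (fst b) \<and> le b A (Idn C (fst b) \<cdot> y) (t \<cdot> x))" for A x y
  proof (cases "y \<in> hom C A (fst b)")
    case True
    then show ?thesis using Cmp_Idn_left[OF True] by (auto simp: P_def)
  next
    case False
    then show ?thesis using le_hom(1)[of b A y "t \<cdot> x"] by (auto simp: P_def)
  qed
  have def: "definable (fst a) (fst b) P"
    unfolding eq[abs_def]
    by (rule definable_conj[OF definable_vimage[OF le_definable[OF b] t i]
          definable_vimage[OF definable_converse[OF le_definable[OF b]] t i]])
  have Pt: "P A x (t \<cdot> x)" if x: "x \<in> hom C A (fst a)" for A x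
    unfolding P_def using x le_refl[OF b Cmp_hom[OF x t]] by blast
  obtain f where f: "f \<in> hom exC a b" "\<And>A x y. P A x y \<Longrightarrow> val f A x y"
  proof (rule exreg_arrow_of_graph[OF a b def])
    show "\<exists>B e y. cover e B A \<and> P B (x \<cdot> e) y" if x: "x \<in> hom C A (fst a)" for A x
      using cover_Idn[OF hom_Obj(1)[OF x]] Pt[OF x] Cmp_Idn_right[OF x] by metis
    show "le b A y y'" if "P A x y" "P A x' y'" "le a A x x'" for A x x' y y'
      using that mono[OF that(3)] le_trans[OF b] unfolding P_def by meson
  qed (rule that)
  show ?thesis using that f Pt by blast
qed

text \<open>Arrows out of discrete objects turn generalized elements in \<open>C\<close> into test arrows of the exact
  completion.\<close>

definition discrete :: "'o \<Rightarrow> ('o, 'a) cobj" where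
  "discrete A = (A, comma_rel C (Idn C A) (Idn C A))"

lemma fst_discrete [simp]: "fst (discrete A) = A"
  by (simp add: discrete_def)

lemma le_discrete:
  assumes "A \<in> Obj C"
  shows "le (discrete A) B u v \<longleftrightarrow> u \<in> hom C B A \<and> v \<in> hom C B A \<and> u \<preceq> v"
  using comma_rel(2)[OF Idn_hom[OF assms] Idn_hom[OF assms], of B u v] Cmp_Idn_left
  by (auto simp: le_def discrete_def)

lemma discrete_Obj:
  assumes A: "A \<in> Obj C"
  shows "discrete A \<in> Obj exC"
proof -
  have "relation C (fst (discrete A)) (fst (discrete A)) (snd (discrete A))"
    using comma_rel(1)[OF Idn_hom[OF A] Idn_hom[OF A]] by (simp add: discrete_def)
  moreover have "mem (fst (discrete A)) (fst (discrete A)) (snd (discrete A)) = le (discrete A)"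
    by (simp only: le_def)
  ultimately show ?thesis
    unfolding exreg_simps congruence_iff by (simp add: le_discrete[OF A]) (blast intro: Leq_trans)
qed

text \<open>Composition with \<open>x\<close> is monotone and the congruence contains the order of
  \<open>C\<close>, so \<open>x\<close> respects the preorder of the discrete object.\<close>

lemma exreg_point:
  assumes a: "a \<in> Obj exC" and x: "x \<in> hom C A (fst a)"
  obtains f where "f \<in> hom exC (discrete A) a" "\<And>B u. u \<in> hom C B A \<Longrightarrow> val f B u (x \<cdot> u)"
proof -
  have A: "A \<in> Obj C" using hom_Obj(1)[OF x] .
  have x': "x \<in> hom C (fst (discrete A)) (fst a)" using x by simp
  have mono: "le a B (x \<cdot> u) (x \<cdot> v)" if "le (discrete A) B u v" for B u v
  proof -
    have uv: "u \<in> hom C B A" "v \<in> hom C B A" "u \<preceq> v" using that unfolding le_discrete[OF A] by auto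
    show ?thesis
      using le_Leq[OF a Cmp_hom[OF uv(1) x] Cmp_hom[OF uv(2) x] Cmp_mono_right[OF uv(1,2) x uv(3)]] .
  qed
  show ?thesis
    by (rule exreg_arrow_of_map[OF discrete_Obj[OF A] a x' mono]) (simp_all add: that)
qed

lemma val_total2:
  assumes f: "f \<in> hom exC a b" and g: "g \<in> hom exC a' b'"
    and x: "x \<in> hom C A (fst a)" "x' \<in> hom C A (fst a')"
  obtains B e y y' where "cover e B A" "e \<in> hom C B A" "val f B (x \<cdot> e) y" "val g B (x' \<cdot> e) y'"
proof -
  obtain B e y where e: "cover e B A" and y: "val f B (x \<cdot> e) y" using val_total[OF f x(1)] .
  note eh = conjunct2[OF e]
  obtain B' e' y' where e': "cover e' B' B" and y': "val g B' ((x' \<cdot> e) \<cdot> e') y'"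
    using val_total[OF g Cmp_hom[OF eh x(2)]] .
  note e'h = conjunct2[OF e']
  show ?thesis
    using that[OF cover_Cmp[OF e e'] Cmp_hom[OF e'h eh]] val_restrict[OF f y e'h] y'
      Cmp_assoc[OF e'h eh x(1)] Cmp_assoc[OF e'h eh x(2)] by simp
qed

text \<open>Covers compose, so finitely many arrows have values over one common cover; the values
  found earlier are restricted along each new cover.\<close>

lemma vals_total:
  assumes "finite I" "\<And>i. i \<in> I \<Longrightarrow> f i \<in> hom exC a (b i)" and x: "x \<in> hom C A (fst a)"
  shows "\<exists>B e y. cover e B A \<and> (\<forall>i\<in>I. val (f i) B (x \<cdot> e) (y i))"
  using assms(1,2)
proof (induction I)
  case empty
  show ?case using cover_Idn[OF hom_Obj(1)[OF x]] by auto
next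
  case (insert i I)
  obtain B e y where e: "cover e B A" and y: "\<forall>i\<in>I. val (f i) B (x \<cdot> e) (y i)"
    using insert.IH insert.prems by auto
  note eh = conjunct2[OF e]
  have fi: "f i \<in> hom exC a (b i)" using insert.prems by simp
  obtain B' e' z where e': "cover e' B' B" and z: "val (f i) B' ((x \<cdot> e) \<cdot> e') z"
    using val_total[OF fi Cmp_hom[OF eh x]] .
  note e'h = conjunct2[OF e']
  have "val (f j) B' (x \<cdot> (e \<cdot> e')) (if j = i then z else y j \<cdot> e')" if "j \<in> insert i I" for j
  proof (cases "j = i")
    case False
    then have "val (f j) B (x \<cdot> e) (y j)" using y that by simp
    from val_restrict[OF insert.prems[OF that] this e'h] show ?thesis
      unfolding Cmp_assoc[OF e'h eh x] using False by simp
  qed (use z Cmp_assoc[OF e'h eh x] in simp)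
  then show ?case
    using cover_Cmp[OF e e'] by (intro exI[of _ B'] exI[of _ "e \<cdot> e'"] exI conjI ballI) auto
qed

lemma definable_comp:
  assumes "definable X Y P" "definable Y Z Q"
  shows "definable X Z (\<lambda>A x z. x \<in> hom C A X \<and> z \<in> hom C A Z \<and>
    (\<exists>B e y. cover e B A \<and> P B (x \<cdot> e) y \<and> Q B y (z \<cdot> e)))"
proof -
  obtain R S where R: "relation C X Y R" "mem X Y R = P" and S: "relation C Y Z S" "mem Y Z S = Q"
    using assms unfolding definable_def by blast
  show ?thesis
    unfolding definable_def
    by (intro exI[of _ "rel_comp C X Y Z S R"] conjI ext rel_comp(1)[OF R(1) S(1)]
        rel_comp(2)[OF R(1) S(1), unfolded R(2) S(2)])
qed

section \<open>The ff- and so-morphisms of the completion\<close>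

lemma exreg_ffI:
  assumes m: "m \<in> hom exC a b"
    and refl: "\<And>A x x' y y'. val m A x y \<Longrightarrow> val m A x' y' \<Longrightarrow> le b A y y' \<Longrightarrow> le a A x x'"
  shows "ff exC m"
  unfolding ff_def
proof (intro conjI ballI impI)
  show "m \<in> Arr exC" using exC.homD[OF m] by simp
  fix z f g assume "f \<in> hom exC z (Dom exC m)" "g \<in> hom exC z (Dom exC m)"
    and le: "m \<bullet> f \<sqsubseteq> m \<bullet> g"
  then have f: "f \<in> hom exC z a" and g: "g \<in> hom exC z a" using exC.homD[OF m] by auto
  note a = exreg_hom_Obj(1)[OF m]
  show "f \<sqsubseteq> g"
  proof (rule exreg_leI[OF f g])
    fix A z x x' assume x: "val f A z x" and x': "val g A z x'"
    note xh = val_hom[OF f x] and x'h = val_hom[OF g x']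
    obtain B e y y' where e: "cover e B A" "e \<in> hom C B A" and y: "val m B (x \<cdot> e) y" "val m B (x' \<cdot> e) y'"
      using val_total2[OF m m xh(2) x'h(2)] .
    have "le b B y y'"
      using exreg_leD[OF exreg_Cmp(1)[OF f m] exreg_Cmp(1)[OF g m] le
          exreg_Cmp(2)[OF f m val_restrict[OF f x e(2)] y(1)]
          exreg_Cmp(2)[OF g m val_restrict[OF g x' e(2)] y(2)]] .
    then show "le a A x x'" using le_local[OF a e(1) xh(2) x'h(2) refl[OF y]] by blast
  qed
qed

text \<open>A point is determined by its value at the identity of \<open>A\<close>, which is
  \<open>x\<close>; its other values are restrictions of \<open>x\<close>, up to
  equivalence.\<close>

lemma exreg_point_le:
  assumes a: "a \<in> Obj exC" and p: "p \<in> hom exC (discrete A) a" "p' \<in> hom exC (discrete A) a"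
    and val: "\<And>B u. u \<in> hom C B A \<Longrightarrow> val p B u (x \<cdot> u)" "\<And>B u. u \<in> hom C B A \<Longrightarrow> val p' B u (x' \<cdot> u)"
    and x: "x \<in> hom C A (fst a)" "x' \<in> hom C A (fst a)"
  shows "p \<sqsubseteq> p' \<longleftrightarrow> le a A x x'"
proof
  have i: "Idn C A \<in> hom C A A" using Idn_hom[OF hom_Obj(1)[OF x(1)]] .
  assume "p \<sqsubseteq> p'"
  then show "le a A x x'"
    using exreg_leD[OF p _ val(1)[OF i] val(2)[OF i]] Cmp_Idn_right[OF x(1)] Cmp_Idn_right[OF x(2)]
    by simp
next
  assume le: "le a A x x'"
  show "p \<sqsubseteq> p'"
  proof (rule exreg_leI[OF p])
    fix B u w w' assume w: "val p B u w" and w': "val p' B u w'"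
    have u: "u \<in> hom C B A" using val_hom(1)[OF p(1) w] by simp
    show "le a B w w'"
      using le_trans[OF a val_unique[OF p(1) w val(1)[OF u]]
          le_trans[OF a le_restrict[OF a le u] val_unique[OF p(2) val(2)[OF u] w']]] .
  qed
qed

lemma exreg_Cmp_point:
  assumes m: "m \<in> hom exC a b" and p: "p \<in> hom exC (discrete A) a"
    and val: "\<And>B u. u \<in> hom C B A \<Longrightarrow> val p B u (x \<cdot> u)" and y: "val m A x y"
    and u: "u \<in> hom C B A"
  shows "val (m \<bullet> p) B u (y \<cdot> u)"
  using exreg_Cmp(2)[OF p m val[OF u] val_restrict[OF m y u]] .

text \<open>The definition of ff speaks of arrows only, so it is applied to the points that name
  \<open>x\<close> and \<open>x'\<close>.\<close>

lemma exreg_ffD: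
  assumes m: "m \<in> hom exC a b" and ff: "ff exC m"
    and y: "val m A x y" and y': "val m A x' y'" and le: "le b A y y'"
  shows "le a A x x'"
proof -
  note a = exreg_hom_Obj(1)[OF m] and b = exreg_hom_Obj(2)[OF m]
  note xh = val_hom[OF m y] and x'h = val_hom[OF m y']
  obtain p where p: "p \<in> hom exC (discrete A) a" "\<And>B u. u \<in> hom C B A \<Longrightarrow> val p B u (x \<cdot> u)"
    by (rule exreg_point[OF a xh(1)]) (rule that)
  obtain p' where p': "p' \<in> hom exC (discrete A) a" "\<And>B u. u \<in> hom C B A \<Longrightarrow> val p' B u (x' \<cdot> u)"
    by (rule exreg_point[OF a x'h(1)]) (rule that)
  have "m \<bullet> p \<sqsubseteq> m \<bullet> p'"
    using exreg_point_le[OF b exreg_Cmp(1)[OF p(1) m] exreg_Cmp(1)[OF p'(1) m]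
        exreg_Cmp_point[OF m p y] exreg_Cmp_point[OF m p' y'] xh(2) x'h(2)] le by blast
  then have "p \<sqsubseteq> p'"
    using exC.ffD[OF ff] p(1) p'(1) exC.homD[OF m] by auto
  then show ?thesis
    using exreg_point_le[OF a p(1) p'(1) p(2) p'(2) xh(1) x'h(1)] by blast
qed

definition surjective :: "('o, 'a) carr \<Rightarrow> ('o, 'a) cobj \<Rightarrow> bool" where
  "surjective f b \<longleftrightarrow> (\<forall>A y. y \<in> hom C A (fst b) \<longrightarrow> (\<exists>B e x. cover e B A \<and> val f B x (y \<cdot> e)))"

text \<open>The diagonal sends \<open>y\<close> to the value of \<open>p\<close> at any local
  preimage \<open>x\<close> of \<open>y\<close> under \<open>e\<close>. The choice of
  \<open>x\<close> is immaterial up to equivalence, because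
  \<open>m \<bullet> p = q \<bullet> e\<close> and \<open>m\<close> reflects the preorder.\<close>

lemma exreg_soI:
  assumes e: "e \<in> hom exC a b" and surj: "surjective e b"
  shows "so exC e"
proof (rule exC.soI)
  show "e \<in> Arr exC" using exC.homD[OF e] by simp
  fix m p q
  assume ff: "ff exC m" and "p \<in> hom exC (Dom exC e) (Dom exC m)"
    "q \<in> hom exC (Cod exC e) (Cod exC m)" and sq: "m \<bullet> p = q \<bullet> e"
  moreover define c d where "c = Dom exC m" "d = Cod exC m"
  ultimately have m: "m \<in> hom exC c d" and p: "p \<in> hom exC a c" and q: "q \<in> hom exC b d"
    using exC.ff_Arr[OF ff] exC.homD[OF e] exC.Arr_hom by auto
  note a = exreg_hom_Obj(1)[OF e] and b = exreg_hom_Obj(2)[OF e] and c = exreg_hom_Obj(1)[OF m]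
  define P where "P A y u \<longleftrightarrow> y \<in> hom C A (fst b) \<and> u \<in> hom C A (fst c) \<and>
    (\<exists>B k x. cover k B A \<and> val e B x (y \<cdot> k) \<and> val p B x (u \<cdot> k))" for A y u
  have def: "definable (fst b) (fst c) P"
    using definable_comp[OF definable_converse[OF val_definable[OF e]] val_definable[OF p]]
    unfolding P_def[abs_def] .
  have PI: "P A y u" if y: "val e A x y" and u: "val p A x u" for A x y u
  proof -
    note h = val_hom[OF e y] val_hom(2)[OF p u]
    show ?thesis
      unfolding P_def using cover_Idn[OF hom_Obj(1)[OF h(1)]] y u h Cmp_Idn_right[OF h(2)]
        Cmp_Idn_right[OF h(3)] by metis
  qed
  \<comment> \<open>Covers both monotonicity of the diagonal and its independence of the preimage:
    after \<open>m\<close> the values become those of \<open>q\<close> at \<open>y\<close> and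
    \<open>y'\<close>, which are ordered.\<close>
  have mono0: "le c A u u'" if y: "val e A x y" "val e A x' y'" and u: "val p A x u" "val p A x' u'"
    and yy: "le b A y y'" for A x y x' y' u u'
  proof -
    note uh = val_hom(2)[OF p u(1)] val_hom(2)[OF p u(2)]
    obtain B k w w' where k: "cover k B A" "k \<in> hom C B A" and w: "val m B (u \<cdot> k) w" "val m B (u' \<cdot> k) w'"
      using val_total2[OF m m uh] .
    have "val (q \<bullet> e) B (x \<cdot> k) w" "val (q \<bullet> e) B (x' \<cdot> k) w'"
      unfolding sq[symmetric] using exreg_Cmp(2)[OF p m val_restrict[OF p u(1) k(2)] w(1)]
        exreg_Cmp(2)[OF p m val_restrict[OF p u(2) k(2)] w(2)] .
    then have "val q B (y \<cdot> k) w" "val q B (y' \<cdot> k) w'"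
      using val_CmpD[OF e q val_restrict[OF e y(1) k(2)]] val_CmpD[OF e q val_restrict[OF e y(2) k(2)]]
      by blast+
    then have "le d B w w'" using val_mono[OF q _ _ le_restrict[OF b yy k(2)]] by blast
    then show ?thesis using le_local[OF c k(1) uh exreg_ffD[OF m ff w]] by blast
  qed
  obtain d' where d': "d' \<in> hom exC b c" and Pd: "\<And>A y u. P A y u \<Longrightarrow> val d' A y u"
  proof (rule exreg_arrow_of_graph[OF b c def])
    fix A y assume y: "y \<in> hom C A (fst b)"
    obtain B k x where k: "cover k B A" and x: "val e B x (y \<cdot> k)"
      using surj y unfolding surjective_def by blast
    note kh = conjunct2[OF k]
    obtain B' k' u where k': "cover k' B' B" and u: "val p B' (x \<cdot> k') u"
      using val_total[OF p val_hom(1)[OF e x]] .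
    note k'h = conjunct2[OF k']
    have "P B' (y \<cdot> (k \<cdot> k')) u"
      using PI[OF val_restrict[OF e x k'h] u] Cmp_assoc[OF k'h kh y] by simp
    then show "\<exists>B k u. cover k B A \<and> P B (y \<cdot> k) u" using cover_Cmp[OF k k'] by blast
  next
    fix A y y' u u' assume P: "P A y u" "P A y' u'" and yy: "le b A y y'"
    have uh: "u \<in> hom C A (fst c)" "u' \<in> hom C A (fst c)" using P unfolding P_def by auto
    obtain B k x where k: "cover k B A" and x: "val e B x (y \<cdot> k)" "val p B x (u \<cdot> k)"
      using P(1) unfolding P_def by blast
    note kh = conjunct2[OF k]
    obtain B' k' x' where k': "cover k' B' B" and x': "val e B' x' ((y' \<cdot> k) \<cdot> k')"
      "val p B' x' ((u' \<cdot> k) \<cdot> k')"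
      using definableD(2)[OF def P(2) kh] unfolding P_def by blast
    note k'h = conjunct2[OF k']
    have "le c B' ((u \<cdot> k) \<cdot> k') ((u' \<cdot> k) \<cdot> k')"
      using mono0[OF val_restrict[OF e x(1) k'h] x'(1) val_restrict[OF p x(2) k'h] x'(2)
          le_restrict[OF b le_restrict[OF b yy kh] k'h]] .
    then show "le c A u u'"
      using le_local[OF c k uh le_local[OF c k' Cmp_hom[OF kh uh(1)] Cmp_hom[OF kh uh(2)]]] by blast
  qed (rule that)
  have "d' \<bullet> e = p"
  proof (rule exreg_eqI[OF exreg_Cmp(1)[OF e d'] p])
    fix A x u u' assume u: "val (d' \<bullet> e) A x u" and u': "val p A x u'"
    note xh = val_hom(1)[OF p u'] and uh = val_hom(2)[OF exreg_Cmp(1)[OF e d'] u] val_hom(2)[OF p u']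
    obtain B k y where k: "cover k B A" and y: "val e B (x \<cdot> k) y" using val_total[OF e xh] .
    note kh = conjunct2[OF k]
    have 1: "val d' B y (u' \<cdot> k)" using Pd[OF PI[OF y val_restrict[OF p u' kh]]] .
    have 2: "val d' B y (u \<cdot> k)"
      using val_CmpD[OF e d' y val_restrict[OF exreg_Cmp(1)[OF e d'] u kh]] .
    show "le c A u u' \<and> le c A u' u"
      using le_local[OF c k uh val_unique[OF d' 2 1]] le_local[OF c k uh(2,1) val_unique[OF d' 1 2]] ..
  qed
  moreover have "m \<bullet> d' = q"
  proof (rule exreg_eqI[OF exreg_Cmp(1)[OF d' m] q])
    note md = exreg_Cmp(1)[OF d' m] and d = exreg_hom_Obj(2)[OF m]
    fix A y w w' assume w: "val (m \<bullet> d') A y w" and w': "val q A y w'"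
    note yh = val_hom(1)[OF q w'] and wh = val_hom(2)[OF md w] val_hom(2)[OF q w']
    obtain B k x where k: "cover k B A" and x: "val e B x (y \<cdot> k)"
      using surj yh unfolding surjective_def by blast
    note kh = conjunct2[OF k]
    obtain B' k' u where k': "cover k' B' B" and u: "val p B' (x \<cdot> k') u"
      using val_total[OF p val_hom(1)[OF e x]] .
    note k'h = conjunct2[OF k']
    note x' = val_restrict[OF e x k'h]
    have "val d' B' ((y \<cdot> k) \<cdot> k') u" using Pd[OF PI[OF x' u]] .
    then have "val m B' u ((w \<cdot> k) \<cdot> k')"
      using val_CmpD[OF d' m _ val_restrict[OF md val_restrict[OF md w kh] k'h]] by blast
    then have "val (q \<bullet> e) B' (x \<cdot> k') ((w \<cdot> k) \<cdot> k')"
      using exreg_Cmp(2)[OF p m u] unfolding sq by blast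
    then have 1: "val q B' ((y \<cdot> k) \<cdot> k') ((w \<cdot> k) \<cdot> k')" using val_CmpD[OF e q x'] by blast
    have 2: "val q B' ((y \<cdot> k) \<cdot> k') ((w' \<cdot> k) \<cdot> k')"
      using val_restrict[OF q val_restrict[OF q w' kh] k'h] .
    show "le d A w w' \<and> le d A w' w"
      using le_local[OF d k wh le_local[OF d k' Cmp_hom[OF kh wh(1)] Cmp_hom[OF kh wh(2)]
            val_unique[OF q 1 2]]]
        le_local[OF d k wh(2,1) le_local[OF d k' Cmp_hom[OF kh wh(2)] Cmp_hom[OF kh wh(1)]
            val_unique[OF q 2 1]]] ..
  qed
  ultimately show "\<exists>d\<in>hom exC (Cod exC e) (Dom exC m). d \<bullet> e = p \<and> m \<bullet> d = q"
    using d' exC.homD[OF e] c_d_def(1) by auto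
qed

text \<open>\<open>K\<close> is the composite of \<open>\<Phi>\<close> and then
  \<open>\<Psi>\<close>: it relates \<open>x\<close> to \<open>x'\<close> if locally some
  \<open>w\<close> lies above the value at \<open>x\<close> and below the value at
  \<open>x'\<close>. The description presupposes values, since these need not exist at every
  stage.\<close>

lemma exreg_kernel:
  assumes f: "f \<in> hom exC a b"
  obtains K where "relation C (fst a) (fst a) K"
    "\<And>A x x' y y'. val f A x y \<Longrightarrow> val f A x' y' \<Longrightarrow> mem (fst a) (fst a) K A x x' \<longleftrightarrow> le b A y y'"
proof (rule exreg_arrowE[OF f])
  fix \<Phi> \<Psi> assume a: "a \<in> Obj exC" and b: "b \<in> Obj exC" and pq: "bimodule a b \<Phi>" "bimodule b a \<Psi>"
    and adj: "adjoint a b \<Phi> \<Psi>"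
    and v: "val f = (\<lambda>A x y. relates a b \<Phi> A x y \<and> relates b a \<Psi> A y x)"
  note R = pq[THEN bimodule_relation]
  have counit: "le b A y y'" if "relates b a \<Psi> A y x" "relates a b \<Phi> A x y'" for A x y y'
    using adj that unfolding adjoint_def by blast
  show ?thesis
  proof (rule that[OF rel_comp(1)[OF R]])
    fix A x x' y y' assume y: "val f A x y" and y': "val f A x' y'"
    note h = val_hom[OF f y] val_hom[OF f y']
    show "relates a a (rel_comp C (fst a) (fst b) (fst a) \<Psi> \<Phi>) A x x' \<longleftrightarrow> le b A y y'"
    proof
      assume "relates a a (rel_comp C (fst a) (fst b) (fst a) \<Psi> \<Phi>) A x x'"
      then obtain B e w where e: "cover e B A" and w: "relates a b \<Phi> B (x \<cdot> e) w"
        "relates b a \<Psi> B w (x' \<cdot> e)"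
        unfolding rel_comp(2)[OF R] by blast
      note eh = conjunct2[OF e]
      have "le b B (y \<cdot> e) w" "le b B w (y' \<cdot> e)"
        using counit[OF _ w(1)] counit[OF w(2)] val_restrict[OF f y eh] val_restrict[OF f y' eh]
        unfolding v by blast+
      then show "le b A y y'" using le_local[OF b e h(2,4)] le_trans[OF b] by blast
    next
      assume "le b A y y'"
      then have "relates b a \<Psi> A y x'"
        using bimoduleD[OF pq(2) _ _ le_refl[OF a h(3)]] y' unfolding v by blast
      then show "relates a a (rel_comp C (fst a) (fst b) (fst a) \<Psi> \<Phi>) A x x'"
        unfolding rel_comp(2)[OF R] using cover_Idn[OF hom_Obj(1)[OF h(1)]] y h
          Cmp_Idn_right[OF h(1)] Cmp_Idn_right[OF h(3)] unfolding v by metis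
    qed
  qed
qed

text \<open>Only the congruence changes: \<open>e\<close> is carried by the identity of the
  underlying object, hence surjective, and \<open>m\<close> is built on the graph of
  \<open>f\<close>. With the preorder pulled back from \<open>b\<close>, \<open>m\<close> reflects
  it.\<close>

lemma exreg_factorization:
  assumes f: "f \<in> hom exC a b"
  obtains k e m where "e \<in> hom exC a k" "m \<in> hom exC k b" "surjective e k" "ff exC m" "m \<bullet> e = f"
proof -
  note a = exreg_hom_Obj(1)[OF f] and b = exreg_hom_Obj(2)[OF f]
  obtain K where K: "relation C (fst a) (fst a) K"
    and ker: "\<And>A x x' y y'. val f A x y \<Longrightarrow> val f A x' y' \<Longrightarrow> mem (fst a) (fst a) K A x x' \<longleftrightarrow> le b A y y'"
    by (rule exreg_kernel[OF f]) (rule that)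
  define k where "k = (fst a, K)"
  have fk: "fst k = fst a" by (simp add: k_def)
  have lek: "le k = mem (fst a) (fst a) K" by (simp add: le_def k_def)
  \<comment> \<open>This inclusion makes the identity monotone from \<open>a\<close> to
    \<open>k\<close>; it also puts the order of \<open>C\<close> into \<open>K\<close>, as a
    congruence requires.\<close>
  have aK: "le k A x x'" if xx: "le a A x x'" for A x x'
  proof -
    note h = le_hom[OF xx]
    obtain B e y y' where e: "cover e B A" "e \<in> hom C B A" and y: "val f B (x \<cdot> e) y" "val f B (x' \<cdot> e) y'"
      using val_total2[OF f f h] .
    have "le b B y y'" using val_mono[OF f y le_restrict[OF a xx e(2)]] .
    then show ?thesis unfolding lek using mem_local[OF K e(1) h] ker[OF y] by blast
  qed
  have k: "k \<in> Obj exC"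
    unfolding exreg_simps congruence_iff
  proof (intro conjI allI impI)
    show "relation C (fst k) (fst k) (snd k)" using K by (simp add: k_def)
    show "mem (fst k) (fst k) (snd k) A x y" if "x \<in> hom C A (fst k)" "y \<in> hom C A (fst k)" "x \<preceq> y"
      for A x y
      using aK[OF le_Leq[OF a]] that by (simp add: le_def k_def)
  next
    fix A x y z assume "mem (fst k) (fst k) (snd k) A x y" "mem (fst k) (fst k) (snd k) A y z"
    then have xy: "mem (fst a) (fst a) K A x y" and yz: "mem (fst a) (fst a) K A y z"
      by (simp_all add: k_def)
    have h: "x \<in> hom C A (fst a)" "y \<in> hom C A (fst a)" "z \<in> hom C A (fst a)"
      using mem_hom xy yz by blast+
    obtain B e x' y' where e: "cover e B A" "e \<in> hom C B A" and x': "val f B (x \<cdot> e) x'" "val f B (y \<cdot> e) y'"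
      using val_total2[OF f f h(1,2)] .
    obtain B' e' z' where e': "cover e' B' B" and z': "val f B' ((z \<cdot> e) \<cdot> e') z'"
      using val_total[OF f Cmp_hom[OF e(2) h(3)]] .
    note e'h = conjunct2[OF e']
    note x'' = val_restrict[OF f x'(1) e'h] and y'' = val_restrict[OF f x'(2) e'h]
    have "le b B' (x' \<cdot> e') (y' \<cdot> e')" "le b B' (y' \<cdot> e') z'"
      using mem_restrict[OF K mem_restrict[OF K xy e(2)] e'h]
        mem_restrict[OF K mem_restrict[OF K yz e(2)] e'h] ker[OF x'' y''] ker[OF y'' z'] by blast+
    then have "mem (fst a) (fst a) K B' ((x \<cdot> e) \<cdot> e') ((z \<cdot> e) \<cdot> e')"
      using ker[OF x'' z'] le_trans[OF b] by blast
    then have "mem (fst a) (fst a) K A x z"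
      using mem_local[OF K e(1) h(1,3) mem_local[OF K e' Cmp_hom[OF e(2) h(1)] Cmp_hom[OF e(2) h(3)]]]
      by blast
    then show "mem (fst k) (fst k) (snd k) A x z" by (simp add: k_def)
  qed
  have i: "Idn C (fst a) \<in> hom C (fst a) (fst k)" unfolding fk using Idn_hom[OF cobj_Obj[OF a]] .
  have mono: "le k A (Idn C (fst a) \<cdot> x) (Idn C (fst a) \<cdot> x')" if "le a A x x'" for A x x'
    using aK[OF that] Cmp_Idn_left[OF le_hom(1)[OF that]] Cmp_Idn_left[OF le_hom(2)[OF that]] by simp
  obtain e where e: "e \<in> hom exC a k"
    and ev0: "\<And>A x. x \<in> hom C A (fst a) \<Longrightarrow> val e A x (Idn C (fst a) \<cdot> x)"
    by (rule exreg_arrow_of_map[OF a k i]) (erule mono, rule that)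
  have ev: "val e A x x" if "x \<in> hom C A (fst a)" for A x
    using ev0[OF that] Cmp_Idn_left[OF that] by simp
  \<comment> \<open>The graph of \<open>f\<close> can be reused for \<open>m\<close> because
    \<open>k\<close> and \<open>a\<close> share their underlying object.\<close>
  have def: "definable (fst k) (fst b) (val f)" unfolding fk by (rule val_definable[OF f])
  obtain m where m: "m \<in> hom exC k b" and mv: "\<And>A x y. val f A x y \<Longrightarrow> val m A x y"
  proof (rule exreg_arrow_of_graph[OF k b def])
    show "\<exists>B e y. cover e B A \<and> val f B (x \<cdot> e) y" if "x \<in> hom C A (fst k)" for A x
      using val_total[OF f] that unfolding fk by blast
    show "le b A y y'" if "val f A x y" "val f A x' y'" "le k A x x'" for A x x' y y'
      using ker[OF that(1,2)] that(3) unfolding lek by blast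
  qed (rule that)
  have "surjective e k"
    unfolding surjective_def fk using ev cover_Idn hom_Obj(1) Cmp_Idn_right by metis
  moreover have "ff exC m"
  proof (rule exreg_ffI[OF m])
    fix A x x' y y' assume y: "val m A x y" "val m A x' y'" and yy: "le b A y y'"
    have h: "x \<in> hom C A (fst a)" "x' \<in> hom C A (fst a)"
      using val_hom(1)[OF m y(1)] val_hom(1)[OF m y(2)] unfolding fk .
    obtain B c w w' where c: "cover c B A" "c \<in> hom C B A" and w: "val f B (x \<cdot> c) w" "val f B (x' \<cdot> c) w'"
      using val_total2[OF f f h] .
    have "le b B w (y \<cdot> c)" "le b B (y' \<cdot> c) w'"
      using val_unique[OF m mv[OF w(1)] val_restrict[OF m y(1) c(2)]]
        val_unique[OF m val_restrict[OF m y(2) c(2)] mv[OF w(2)]] .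
    then have "le b B w w'" using le_restrict[OF b yy c(2)] le_trans[OF b] by blast
    then show "le k A x x'" unfolding lek using mem_local[OF K c(1) h] ker[OF w] by blast
  qed
  moreover have "m \<bullet> e = f"
  proof (rule exreg_eqI[OF exreg_Cmp(1)[OF e m] f])
    fix A x y z assume y: "val (m \<bullet> e) A x y" and z: "val f A x z"
    have "val m A x y" using val_CmpD[OF e m ev[OF val_hom(1)[OF f z]] y] .
    then show "le b A y z \<and> le b A z y" using val_unique[OF m] mv[OF z] by blast
  qed
  ultimately show ?thesis using that e m by blast
qed

text \<open>Factor \<open>e\<close> as a surjective \<open>e'\<close> followed by an ff-morphism
  \<open>m\<close>. Lifting the identity against \<open>m\<close> gives a section \<open>d\<close>
  of \<open>m\<close>; so \<open>y\<close> is the value of \<open>m\<close> at the value of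
  \<open>d\<close>, and a local preimage of the latter under \<open>e'\<close> is one of
  \<open>y\<close> under \<open>e\<close>.\<close>

lemma exreg_soD:
  assumes e: "e \<in> hom exC a b" and so: "so exC e"
  shows "surjective e b"
proof -
  obtain k e' m where e': "e' \<in> hom exC a k" and m: "m \<in> hom exC k b" and surj: "surjective e' k"
    and ff: "ff exC m" and me: "m \<bullet> e' = e"
    using exreg_factorization[OF e] by blast
  note b = exreg_hom_Obj(2)[OF e]
  have sq: "m \<bullet> e' = Idn exC b \<bullet> e" using exC.Cmp_Idn_left[OF e] me by simp
  have h: "e' \<in> hom exC (Dom exC e) (Dom exC m)" "Idn exC b \<in> hom exC (Cod exC e) (Cod exC m)"
    using e' exC.Idn_hom[OF b] exC.homD[OF e] exC.homD[OF m] by simp_all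
  obtain d where "d \<in> hom exC (Cod exC e) (Dom exC m)" "d \<bullet> e = e'" and md: "m \<bullet> d = Idn exC b"
    using exC.so_lift[OF so ff h sq] .
  then have d: "d \<in> hom exC b k" using exC.homD[OF e] exC.homD[OF m] by simp
  show ?thesis
    unfolding surjective_def
  proof (intro allI impI)
    fix A y assume y: "y \<in> hom C A (fst b)"
    obtain B c u where c: "cover c B A" and u: "val d B (y \<cdot> c) u" using val_total[OF d y] .
    note ch = conjunct2[OF c]
    obtain B' c' w where c': "cover c' B' B" and w: "val m B' (u \<cdot> c') w"
      using val_total[OF m val_hom(2)[OF d u]] .
    note c'h = conjunct2[OF c']
    note u' = val_restrict[OF d u c'h]
    have "val (Idn exC b) B' ((y \<cdot> c) \<cdot> c') w" using exreg_Cmp(2)[OF d m u' w] unfolding md .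
    then have eq: "le b B' w ((y \<cdot> c) \<cdot> c')" "le b B' ((y \<cdot> c) \<cdot> c') w"
      using exreg_Idn(2)[OF b] by auto
    obtain B'' c'' x where c'': "cover c'' B'' B'" and x: "val e' B'' x ((u \<cdot> c') \<cdot> c'')"
      using surj val_hom(2)[OF d u'] unfolding surjective_def by blast
    note c''h = conjunct2[OF c'']
    have "val e B'' x (w \<cdot> c'')"
      using exreg_Cmp(2)[OF e' m x val_restrict[OF m w c''h]] unfolding me .
    then have "val e B'' x (((y \<cdot> c) \<cdot> c') \<cdot> c'')"
      using val_cong_right[OF e _ le_restrict[OF b eq(1) c''h] le_restrict[OF b eq(2) c''h]] by blast
    moreover have "((y \<cdot> c) \<cdot> c') \<cdot> c'' = y \<cdot> ((c \<cdot> c') \<cdot> c'')"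
      using Cmp_assoc[OF c'h ch y] Cmp_assoc[OF c''h Cmp_hom[OF c'h ch] y] by simp
    ultimately show "\<exists>B e' x. cover e' B A \<and> val e B x (y \<cdot> e')"
      using cover_Cmp[OF cover_Cmp[OF c c'] c''] by metis
  qed
qed

text \<open>Given \<open>x\<close>, a local preimage under \<open>g\<close> of the value of
  \<open>f\<close> at \<open>x\<close> exists. Both elements are named by arrows out of one discrete
  object, which agree after \<open>f\<close> and \<open>g\<close>, so the universal property of the
  pullback applies to them.\<close>

lemma exreg_so_stable:
  assumes pb: "is_pullback exC f g p q" and so: "so exC g"
  shows "so exC p"
proof -
  define b c z r where bczr: "b = Dom exC f" "c = Dom exC g" "z = Cod exC f" "r = Dom exC p"
  have f: "f \<in> hom exC b z" and g: "g \<in> hom exC c z" and p: "p \<in> hom exC r b" and q: "q \<in> hom exC r c"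
    using pb unfolding is_pullback_def jointly_order_mono_def bczr by (auto simp: hom_def)
  have univ: "\<exists>w\<in>hom exC y r. p \<bullet> w = u \<and> q \<bullet> w = v"
    if "u \<in> hom exC y b" "v \<in> hom exC y c" "f \<bullet> u = g \<bullet> v" for y u v
    using pb that exC.hom_Obj(1)[OF that(1)] unfolding is_pullback_def bczr by blast
  note b = exreg_hom_Obj(1)[OF f] and c = exreg_hom_Obj(1)[OF g] and z = exreg_hom_Obj(2)[OF f]
  have surj: "surjective g z" using exreg_soD[OF g so] .
  have "surjective p b"
    unfolding surjective_def
  proof (intro allI impI)
    fix A x assume x: "x \<in> hom C A (fst b)"
    obtain B e w where e: "cover e B A" and w: "val f B (x \<cdot> e) w" using val_total[OF f x] .
    note eh = conjunct2[OF e]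
    obtain B' e' y where e': "cover e' B' B" and y: "val g B' y (w \<cdot> e')"
      using surj val_hom(2)[OF f w] unfolding surjective_def by blast
    note e'h = conjunct2[OF e']
    note w' = val_restrict[OF f w e'h]
    define x' where "x' = (x \<cdot> e) \<cdot> e'"
    have x'h: "x' \<in> hom C B' (fst b)" using val_hom(1)[OF f w'] unfolding x'_def .
    obtain s where s: "s \<in> hom exC (discrete B') b" "\<And>D u. u \<in> hom C D B' \<Longrightarrow> val s D u (x' \<cdot> u)"
      by (rule exreg_point[OF b x'h]) (rule that)
    obtain t where t: "t \<in> hom exC (discrete B') c" "\<And>D u. u \<in> hom C D B' \<Longrightarrow> val t D u (y \<cdot> u)"
      by (rule exreg_point[OF c val_hom(1)[OF g y]]) (rule that)
    note fs = exreg_Cmp(1)[OF s(1) f] and gt = exreg_Cmp(1)[OF t(1) g]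
    have "f \<bullet> s = g \<bullet> t"
    proof (rule exreg_eqI[OF fs gt])
      fix D u v v' assume v: "val (f \<bullet> s) D u v" and v': "val (g \<bullet> t) D u v'"
      have u: "u \<in> hom C D B'" using val_hom(1)[OF fs v] by simp
      have 1: "val f D (x' \<cdot> u) v" using val_CmpD[OF s(1) f s(2)[OF u] v] .
      have 2: "val f D (x' \<cdot> u) ((w \<cdot> e') \<cdot> u)" using val_restrict[OF f w' u] unfolding x'_def .
      have 3: "val g D (y \<cdot> u) v'" using val_CmpD[OF t(1) g t(2)[OF u] v'] .
      have 4: "val g D (y \<cdot> u) ((w \<cdot> e') \<cdot> u)" using val_restrict[OF g y u] .
      show "le z D v v' \<and> le z D v' v"
        using le_trans[OF z val_unique[OF f 1 2] val_unique[OF g 4 3]]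
          le_trans[OF z val_unique[OF g 3 4] val_unique[OF f 2 1]] ..
    qed
    then obtain h where h: "h \<in> hom exC (discrete B') r" and ph: "p \<bullet> h = s"
      using univ[OF s(1) t(1)] by blast
    \<comment> \<open>Since \<open>p \<bullet> h\<close> names \<open>x'\<close>, a local value of
      \<open>h\<close> at the identity is the desired preimage.\<close>
    have i: "Idn C B' \<in> hom C B' (fst (discrete B'))" using Idn_hom[OF hom_Obj(1)[OF x'h]] by simp
    obtain D k v where k: "cover k D B'" and v: "val h D (Idn C B' \<cdot> k) v" using val_total[OF h i] .
    note kh = conjunct2[OF k]
    have "val (p \<bullet> h) D (Idn C B' \<cdot> k) (x' \<cdot> k)"
      unfolding ph Cmp_Idn_left[OF kh] using s(2)[OF kh] .
    then have "val p D v (x' \<cdot> k)" using val_CmpD[OF h p v] by blast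
    moreover have "x' \<cdot> k = x \<cdot> ((e \<cdot> e') \<cdot> k)"
      unfolding x'_def using Cmp_assoc[OF e'h eh x] Cmp_assoc[OF kh Cmp_hom[OF e'h eh] x] by simp
    ultimately show "\<exists>B e v. cover e B A \<and> val p B v (x \<cdot> e)"
      using cover_Cmp[OF cover_Cmp[OF e e'] k] by metis
  qed
  then show ?thesis by (rule exreg_soI[OF p])
qed

text \<open>The limit is carried by a weak limit of underlying objects; its congruence is the
  componentwise one.\<close>

lemma exreg_weighted_limit:
  assumes W: "finite_weight D Wo Wa" and F: "pos_functor D exC Fo Fa"
  shows "\<exists>L \<kappa>. is_weighted_limit D Wo Wa exC Fo Fa L \<kappa>"
proof -
  interpret W: finite_weight D Wo Wa by (rule W)
  interpret F: pos_functor D exC Fo Fa by (rule F)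
  \<comment> \<open>\<open>J\<close> has one coordinate \<open>(d, w)\<close> for each component of
    a cone. \<open>K\<close> lists the conditions on a tuple: \<open>Inl (d, v, w)\<close> asks for
    the order between the coordinates at \<open>v\<close> and \<open>w\<close>, and
    \<open>Inr (f, w)\<close> that \<open>Fa f\<close> takes the coordinate at \<open>w\<close> to
    the one at \<open>Wa f w\<close>. The maps \<open>s\<close> and \<open>t\<close> name the two
    coordinates and \<open>P\<close> the condition.\<close>
  define J where "J = (SIGMA d:Obj D. Field (Wo d))"
  define X where "X i = fst (Fo (fst i))" for i :: "nat \<times> nat"
  define K where "K = Inl ` (SIGMA d:Obj D. Wo d) \<union> Inr ` (SIGMA f:Arr D. Field (Wo (Dom D f)))"
  define s :: "nat \<times> nat \<times> nat + nat \<times> nat \<Rightarrow> nat \<times> nat"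
    where "s = case_sum (\<lambda>(d, v, w). (d, v)) (\<lambda>(f, w). (Dom D f, w))"
  define t :: "nat \<times> nat \<times> nat + nat \<times> nat \<Rightarrow> nat \<times> nat"
    where "t = case_sum (\<lambda>(d, v, w). (d, w)) (\<lambda>(f, w). (Cod D f, Wa f w))"
  define P :: "nat \<times> nat \<times> nat + nat \<times> nat \<Rightarrow> 'o \<Rightarrow> 'a \<Rightarrow> 'a \<Rightarrow> bool"
    where "P = case_sum (\<lambda>(d, v, w). le (Fo d)) (\<lambda>(f, w). val (Fa f))"
  have fo: "Fo d \<in> Obj exC" if "d \<in> Obj D" for d using F.Fo_Obj that .
  have fa: "Fa f \<in> hom exC (Fo (Dom D f)) (Fo (Cod D f))" if "f \<in> Arr D" for f
    using F.Fa_hom[OF W.Arr_hom[OF that]] .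
  have wa: "Wa f w \<in> Field (Wo (Cod D f))" if "f \<in> Arr D" "w \<in> Field (Wo (Dom D f))" for f w
  proof -
    have "(w, w) \<in> Wo (Dom D f)"
      using W.Wo_poset[OF W.Dom_Obj[OF that(1)]] that(2)
      by (auto simp: partial_order_on_def preorder_on_def refl_on_def)
    then show ?thesis using W.Wa_mono[OF W.Arr_hom[OF that(1)]] by (blast intro: FieldI1)
  qed
  have finJ: "finite J"
    unfolding J_def using W.finite_Obj W.finite_Wo by (auto intro: finite_Field)
  have finK: "finite K"
    unfolding K_def
    by (intro finite_UnI finite_imageI finite_SigmaI finite_Field W.finite_Obj W.finite_Arr
        W.finite_Wo W.Dom_Obj)
  have XJ: "X i \<in> Obj C" if "i \<in> J" for i
  proof -
    have "fst i \<in> Obj D" using that by (auto simp: J_def)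
    then show ?thesis unfolding X_def by (rule cobj_Obj[OF fo])
  qed
  have KP: "s k \<in> J \<and> t k \<in> J \<and> definable (X (s k)) (X (t k)) (P k)" if "k \<in> K" for k
    using that unfolding K_def
  proof (elim UnE imageE SigmaE)
    fix p d vw assume kk: "k = Inl p" "p = (d, vw)" and d: "d \<in> Obj D" and vw: "vw \<in> Wo d"
    obtain v w where vw': "vw = (v, w)" by (cases vw)
    have "v \<in> Field (Wo d)" "w \<in> Field (Wo d)" using vw vw' by (auto intro: FieldI1 FieldI2)
    then show ?thesis
      using le_definable[OF fo[OF d]] d kk vw' by (simp add: s_def t_def P_def J_def X_def)
  next
    fix p f w assume kk: "k = Inr p" "p = (f, w)" and f: "f \<in> Arr D" and w: "w \<in> Field (Wo (Dom D f))"
    show ?thesis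
      using val_definable[OF fa[OF f]] wa[OF f w] w W.Dom_Obj[OF f] W.Cod_Obj[OF f] kk
      by (simp add: s_def t_def P_def J_def X_def)
  qed
  obtain T \<pi> where T: "T \<in> Obj C" and \<pi>: "\<forall>i\<in>J. \<pi> i \<in> hom C T (X i)"
    and \<pi>P: "\<forall>k\<in>K. P k T (\<pi> (s k)) (\<pi> (t k))"
    and univ: "\<forall>A x. A \<in> Obj C \<longrightarrow> (\<forall>i\<in>J. x i \<in> hom C A (X i)) \<longrightarrow>
      (\<forall>k\<in>K. P k A (x (s k)) (x (t k))) \<longrightarrow> (\<exists>u\<in>hom C A T. \<forall>i\<in>J. \<pi> i \<cdot> u = x i)"
  proof -
    have "\<exists>T \<pi>. T \<in> Obj C \<and> (\<forall>i\<in>J. \<pi> i \<in> hom C T (X i)) \<and> (\<forall>k\<in>K. P k T (\<pi> (s k)) (\<pi> (t k))) \<and>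
      (\<forall>A x. A \<in> Obj C \<longrightarrow> (\<forall>i\<in>J. x i \<in> hom C A (X i)) \<longrightarrow>
        (\<forall>k\<in>K. P k A (x (s k)) (x (t k))) \<longrightarrow> (\<exists>u\<in>hom C A T. \<forall>i\<in>J. \<pi> i \<cdot> u = x i))"
      by (rule ex_weak_limit[OF finJ _ finK]) (fact XJ KP)+
    then show ?thesis by (elim exE conjE) (rule that)
  qed
  have foJ: "Fo (fst i) \<in> Obj exC" if "i \<in> J" for i using that fo by (auto simp: J_def)
  have \<pi>h: "\<pi> i \<in> hom C T (fst (Fo (fst i)))" if "i \<in> J" for i using \<pi> that unfolding X_def by blast
  define Q where "Q A l l' \<longleftrightarrow> l \<in> hom C A T \<and> l' \<in> hom C A T \<and>
    (\<forall>i\<in>J. le (Fo (fst i)) A (\<pi> i \<cdot> l) (\<pi> i \<cdot> l'))" for A l l'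
  \<comment> \<open>The typing conjuncts are repeated under the quantifier to fit
    \<open>definable_vimage\<close>; the predicate is then identified with \<open>Q\<close>.\<close>
  have "definable T T (\<lambda>A l l'. l \<in> hom C A T \<and> l' \<in> hom C A T \<and>
      (\<forall>i\<in>J. l \<in> hom C A T \<and> l' \<in> hom C A T \<and> le (Fo (fst i)) A (\<pi> i \<cdot> l) (\<pi> i \<cdot> l')))"
  proof (rule definable_finite_conj[OF finJ T T])
    fix i assume i: "i \<in> J"
    show "definable T T (\<lambda>A l l'. l \<in> hom C A T \<and> l' \<in> hom C A T \<and>
        le (Fo (fst i)) A (\<pi> i \<cdot> l) (\<pi> i \<cdot> l'))"
      by (rule definable_vimage[OF le_definable[OF foJ[OF i]] \<pi>h[OF i] \<pi>h[OF i]])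
  qed
  also have "(\<lambda>A l l'. l \<in> hom C A T \<and> l' \<in> hom C A T \<and>
      (\<forall>i\<in>J. l \<in> hom C A T \<and> l' \<in> hom C A T \<and> le (Fo (fst i)) A (\<pi> i \<cdot> l) (\<pi> i \<cdot> l'))) = Q"
    by (intro ext) (auto simp: Q_def)
  finally obtain E where E: "relation C T T E" "mem T T E = Q"
    unfolding definable_def by (elim exE conjE) (rule that)
  define L where "L = (T, E)"
  have fL: "fst L = T" by (simp add: L_def)
  have leL: "le L = Q" unfolding le_def L_def using E by simp
  have L: "L \<in> Obj exC"
    unfolding exreg_simps congruence_iff fL
  proof (intro conjI allI impI)
    show "relation C T T (snd L)" using E(1) by (simp add: L_def)
    show "mem T T (snd L) A x y" if xy: "x \<in> hom C A T" "y \<in> hom C A T" "x \<preceq> y" for A x y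
    proof -
      have "le (Fo (fst i)) A (\<pi> i \<cdot> x) (\<pi> i \<cdot> y)" if i: "i \<in> J" for i
        using le_Leq[OF foJ[OF i] Cmp_hom[OF xy(1) \<pi>h[OF i]] Cmp_hom[OF xy(2) \<pi>h[OF i]]
            Cmp_mono_right[OF xy(1,2) \<pi>h[OF i] xy(3)]] .
      then show ?thesis using xy E(2) by (simp add: L_def Q_def)
    qed
    show "mem T T (snd L) A x z" if "mem T T (snd L) A x y" "mem T T (snd L) A y z" for A x y z
    proof -
      have xy: "Q A x y" and yz: "Q A y z" using that E(2) by (simp_all add: L_def)
      have "le (Fo (fst i)) A (\<pi> i \<cdot> x) (\<pi> i \<cdot> z)" if i: "i \<in> J" for i
        using le_trans[OF foJ[OF i]] xy yz i unfolding Q_def by blast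
      then show ?thesis using xy yz E(2) by (simp add: L_def Q_def)
    qed
  qed
  have "\<exists>f. f \<in> hom exC L (Fo (fst i)) \<and> (\<forall>A l. l \<in> hom C A T \<longrightarrow> val f A l (\<pi> i \<cdot> l))" if i: "i \<in> J" for i
  proof -
    have \<pi>L: "\<pi> i \<in> hom C (fst L) (fst (Fo (fst i)))" using \<pi>h[OF i] fL by simp
    have mono: "le (Fo (fst i)) A (\<pi> i \<cdot> l) (\<pi> i \<cdot> l')" if "le L A l l'" for A l l'
      using that i unfolding leL Q_def by blast
    obtain f where "f \<in> hom exC L (Fo (fst i))" "\<And>A l. l \<in> hom C A (fst L) \<Longrightarrow> val f A l (\<pi> i \<cdot> l)"
      by (rule exreg_arrow_of_map[OF L foJ[OF i] \<pi>L]) (erule mono, rule that)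
    then show ?thesis unfolding fL by (intro exI[of _ f]) simp
  qed
  then obtain \<kappa>' where \<kappa>': "\<And>i. i \<in> J \<Longrightarrow> \<kappa>' i \<in> hom exC L (Fo (fst i))"
    "\<And>i A l. i \<in> J \<Longrightarrow> l \<in> hom C A T \<Longrightarrow> val (\<kappa>' i) A l (\<pi> i \<cdot> l)"
    by metis
  define \<kappa> where "\<kappa> d w = \<kappa>' (d, w)" for d w
  have \<kappa>h: "\<kappa> d w \<in> hom exC L (Fo d)" if "d \<in> Obj D" "w \<in> Field (Wo d)" for d w
    using \<kappa>'(1)[of "(d, w)"] that by (simp add: \<kappa>_def J_def)
  have \<kappa>v: "val (\<kappa> d w) A l (\<pi> (d, w) \<cdot> l)" if "d \<in> Obj D" "w \<in> Field (Wo d)" "l \<in> hom C A T" for d w A l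
    using \<kappa>'(2)[of "(d, w)"] that by (simp add: \<kappa>_def J_def)
  have cone: "weighted_cone D Wo Wa exC Fo Fa L \<kappa>"
    unfolding weighted_cone_def
  proof (intro conjI ballI)
    show "L \<in> Obj exC" by fact
    show "\<kappa> d w \<in> hom exC L (Fo d)" if "d \<in> Obj D" "w \<in> Field (Wo d)" for d w using \<kappa>h that .
  next
    fix d p assume d: "d \<in> Obj D" and p: "p \<in> Wo d"
    obtain v w where vw: "p = (v, w)" by (cases p)
    have F: "v \<in> Field (Wo d)" "w \<in> Field (Wo d)" using p vw by (auto intro: FieldI1 FieldI2)
    have "Inl (d, v, w) \<in> K" using d p vw by (auto simp: K_def)
    then have pi: "le (Fo d) T (\<pi> (d, v)) (\<pi> (d, w))" using \<pi>P by (force simp: P_def s_def t_def)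
    have "\<kappa> d v \<sqsubseteq> \<kappa> d w"
    proof (rule exreg_leI[OF \<kappa>h[OF d F(1)] \<kappa>h[OF d F(2)]])
      fix A l x y assume x: "val (\<kappa> d v) A l x" and y: "val (\<kappa> d w) A l y"
      have l: "l \<in> hom C A T" using val_hom(1)[OF \<kappa>h[OF d F(1)] x] fL by simp
      show "le (Fo d) A x y"
        using le_trans[OF fo[OF d] val_unique[OF \<kappa>h[OF d F(1)] x \<kappa>v[OF d F(1) l]]
            le_trans[OF fo[OF d] le_restrict[OF fo[OF d] pi l]
              val_unique[OF \<kappa>h[OF d F(2)] \<kappa>v[OF d F(2) l] y]]] .
    qed
    then show "case p of (v, w) \<Rightarrow> \<kappa> d v \<sqsubseteq> \<kappa> d w" using vw by simp
  next
    fix d e f w assume d: "d \<in> Obj D" "e \<in> Obj D" and f: "f \<in> hom D d e" and w: "w \<in> Field (Wo d)"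
    have fA: "f \<in> Arr D" "Dom D f = d" "Cod D f = e" using f by (auto simp: hom_def)
    have w': "Wa f w \<in> Field (Wo e)" using wa[OF fA(1)] w fA by simp
    note fh = F.Fa_hom[OF f]
    have "Inr (f, w) \<in> K" using fA w by (auto simp: K_def)
    then have pi: "val (Fa f) T (\<pi> (d, w)) (\<pi> (e, Wa f w))"
      using \<pi>P fA by (force simp: P_def s_def t_def)
    note c = exreg_Cmp(1)[OF \<kappa>h[OF d(1) w] fh] and k = \<kappa>h[OF d(2) w']
    show "Fa f \<bullet> \<kappa> d w = \<kappa> e (Wa f w)"
    proof (rule exreg_eqI[OF c k])
      fix A l x y assume x: "val (Fa f \<bullet> \<kappa> d w) A l x" and y: "val (\<kappa> e (Wa f w)) A l y"
      have l: "l \<in> hom C A T" using val_hom(1)[OF k y] fL by simp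
      note x' = exreg_Cmp(2)[OF \<kappa>h[OF d(1) w] fh \<kappa>v[OF d(1) w l] val_restrict[OF fh pi l]]
      note y' = \<kappa>v[OF d(2) w' l]
      show "le (Fo e) A x y \<and> le (Fo e) A y x"
        using le_trans[OF fo[OF d(2)] val_unique[OF c x x'] val_unique[OF k y' y]]
          le_trans[OF fo[OF d(2)] val_unique[OF k y y'] val_unique[OF c x' x]] ..
    qed
  qed
  moreover have "\<exists>u\<in>hom exC Z L. \<forall>d\<in>Obj D. \<forall>w\<in>Field (Wo d). \<kappa> d w \<bullet> u = \<mu> d w"
    if "weighted_cone D Wo Wa exC Fo Fa Z \<mu>" for Z \<mu>
  proof -
    have Z: "Z \<in> Obj exC" and \<mu>h: "\<And>d w. d \<in> Obj D \<Longrightarrow> w \<in> Field (Wo d) \<Longrightarrow> \<mu> d w \<in> hom exC Z (Fo d)"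
      and \<mu>le: "\<And>d v w. d \<in> Obj D \<Longrightarrow> (v, w) \<in> Wo d \<Longrightarrow> \<mu> d v \<sqsubseteq> \<mu> d w"
      and \<mu>nat: "\<And>d e f w. d \<in> Obj D \<Longrightarrow> e \<in> Obj D \<Longrightarrow> f \<in> hom D d e \<Longrightarrow> w \<in> Field (Wo d) \<Longrightarrow>
        Fa f \<bullet> \<mu> d w = \<mu> e (Wa f w)"
      using that unfolding weighted_cone_def by blast+
    have \<mu>J: "case_prod \<mu> i \<in> hom exC Z (Fo (fst i))" if "i \<in> J" for i
      using that \<mu>h by (auto simp: J_def)
    \<comment> \<open>The mediating arrow sends \<open>z\<close> to a tuple \<open>l\<close> whose
      coordinates are values of the cone at \<open>z\<close>.\<close>
    define G where "G A z l \<longleftrightarrow> z \<in> hom C A (fst Z) \<and> l \<in> hom C A T \<and>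
      (\<forall>i\<in>J. val (case_prod \<mu> i) A z (\<pi> i \<cdot> l))" for A z l
    have i: "Idn C (fst Z) \<in> hom C (fst Z) (fst Z)" using Idn_hom[OF cobj_Obj[OF Z]] .
    have "definable (fst Z) T (\<lambda>A z l. z \<in> hom C A (fst Z) \<and> l \<in> hom C A T \<and>
      (\<forall>i\<in>J. z \<in> hom C A (fst Z) \<and> l \<in> hom C A T \<and>
        val (case_prod \<mu> i) A (Idn C (fst Z) \<cdot> z) (\<pi> i \<cdot> l)))"
      by (rule definable_finite_conj[OF finJ cobj_Obj[OF Z] T],
          rule definable_vimage[OF val_definable[OF \<mu>J] i \<pi>h])
    moreover have "(\<lambda>A z l. z \<in> hom C A (fst Z) \<and> l \<in> hom C A T \<and>
      (\<forall>i\<in>J. z \<in> hom C A (fst Z) \<and> l \<in> hom C A T \<and>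
        val (case_prod \<mu> i) A (Idn C (fst Z) \<cdot> z) (\<pi> i \<cdot> l))) = G"
      using Cmp_Idn_left by (intro ext) (auto simp: G_def)
    ultimately have def: "definable (fst Z) (fst L) G" unfolding fL by simp
    obtain u where u: "u \<in> hom exC Z L" and Gu: "\<And>A z l. G A z l \<Longrightarrow> val u A z l"
      and Gt: "\<And>A z. z \<in> hom C A (fst Z) \<Longrightarrow> \<exists>B e l. cover e B A \<and> G B (z \<cdot> e) l"
    proof -
      have total: "\<exists>B e l. cover e B A \<and> G B (z \<cdot> e) l" if z: "z \<in> hom C A (fst Z)" for A z
      proof -
        \<comment> \<open>Values of all components are chosen over one cover. They satisfy the
          conditions in \<open>K\<close> because \<open>\<mu>\<close> is a cone, and weak
          universality of \<open>T\<close> turns them into a tuple.\<close>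
        obtain B e y where e: "cover e B A" and y: "\<forall>i\<in>J. val (case_prod \<mu> i) B (z \<cdot> e) (y i)"
        proof -
          have "\<exists>B e y. cover e B A \<and> (\<forall>i\<in>J. val (case_prod \<mu> i) B (z \<cdot> e) (y i))"
            by (rule vals_total[OF finJ _ z]) (fact \<mu>J)
          then show ?thesis by (elim exE conjE) (rule that, rule conjI)
        qed
        note eh = conjunct2[OF e]
        have yX: "\<forall>i\<in>J. y i \<in> hom C B (X i)" using y val_hom(2)[OF \<mu>J] unfolding X_def by blast
        have "P k B (y (s k)) (y (t k))" if k: "k \<in> K" for k
          using k unfolding K_def
        proof (elim UnE imageE SigmaE)
          fix p d vw assume kk: "k = Inl p" "p = (d, vw)" and d: "d \<in> Obj D" and vw: "vw \<in> Wo d"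
          obtain v w where vw': "vw = (v, w)" by (cases vw)
          have F: "v \<in> Field (Wo d)" "w \<in> Field (Wo d)" using vw vw' by (auto intro: FieldI1 FieldI2)
          have "val (\<mu> d v) B (z \<cdot> e) (y (d, v))" "val (\<mu> d w) B (z \<cdot> e) (y (d, w))"
            using y d F by (force simp: J_def)+
          then have "le (Fo d) B (y (d, v)) (y (d, w))"
            using exreg_leD[OF \<mu>h[OF d F(1)] \<mu>h[OF d F(2)] \<mu>le[OF d vw[unfolded vw']]] by blast
          then show ?thesis using kk vw' by (simp add: P_def s_def t_def)
        next
          fix p f w assume kk: "k = Inr p" "p = (f, w)" and f: "f \<in> Arr D"
            and w: "w \<in> Field (Wo (Dom D f))"
          note d = W.Dom_Obj[OF f] W.Cod_Obj[OF f] and w' = wa[OF f w]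
          note nat = \<mu>nat[OF d W.Arr_hom[OF f] w]
          have v: "val (\<mu> (Dom D f) w) B (z \<cdot> e) (y (Dom D f, w))"
            "val (\<mu> (Cod D f) (Wa f w)) B (z \<cdot> e) (y (Cod D f, Wa f w))"
            using y d w w' by (force simp: J_def)+
          have "val (Fa f) B (y (Dom D f, w)) (y (Cod D f, Wa f w))"
            using val_CmpD[OF \<mu>h[OF d(1) w] fa[OF f] v(1)] v(2) unfolding nat by blast
          then show ?thesis using kk by (simp add: P_def s_def t_def)
        qed
        then obtain l where "l \<in> hom C B T" "\<forall>i\<in>J. \<pi> i \<cdot> l = y i"
          using univ[rule_format, of B y] yX hom_Obj(1)[OF eh] by auto
        then have "G B (z \<cdot> e) l" unfolding G_def using y Cmp_hom[OF eh z] by simp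
        then show ?thesis using e by blast
      qed
      show ?thesis
      proof (rule exreg_arrow_of_graph[OF Z L def total])
        \<comment> \<open>Nonuniqueness of tuples is harmless here: \<open>Q\<close> compares their
          coordinates only, and these are values of monotone arrows.\<close>
        show "le L A l l'" if "G A z l" "G A z' l'" "le Z A z z'" for A z z' l l'
          unfolding leL Q_def using that val_mono[OF \<mu>J _ _ that(3)] unfolding G_def by blast
      qed (use that total in blast)+
    qed
    have "\<kappa> d w \<bullet> u = \<mu> d w" if d: "d \<in> Obj D" and w: "w \<in> Field (Wo d)" for d w
    proof (rule exreg_eqI[OF exreg_Cmp(1)[OF u \<kappa>h[OF d w]] \<mu>h[OF d w]])
      note c = exreg_Cmp(1)[OF u \<kappa>h[OF d w]] and m = \<mu>h[OF d w] and o = fo[OF d]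
      fix A z x y assume x: "val (\<kappa> d w \<bullet> u) A z x" and y: "val (\<mu> d w) A z y"
      note h = val_hom[OF c x] val_hom(2)[OF m y]
      obtain B e l where e: "cover e B A" and G: "G B (z \<cdot> e) l" using Gt[OF h(1)] by blast
      note eh = conjunct2[OF e]
      have l: "l \<in> hom C B T" and 1: "val (\<mu> d w) B (z \<cdot> e) (\<pi> (d, w) \<cdot> l)"
        using G d w unfolding G_def J_def by auto
      note 2 = exreg_Cmp(2)[OF u \<kappa>h[OF d w] Gu[OF G] \<kappa>v[OF d w l]]
      note xe = val_restrict[OF c x eh] and ye = val_restrict[OF m y eh]
      show "le (Fo d) A x y \<and> le (Fo d) A y x"
        using le_local[OF o e h(2,3) le_trans[OF o val_unique[OF c xe 2] val_unique[OF m 1 ye]]]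
          le_local[OF o e h(3,2) le_trans[OF o val_unique[OF m ye 1] val_unique[OF c 2 xe]]] ..
    qed
    then show ?thesis using u by blast
  qed
  moreover have "u \<sqsubseteq> v" if u: "u \<in> hom exC Z L" and v: "v \<in> hom exC Z L"
    and le: "\<forall>d\<in>Obj D. \<forall>w\<in>Field (Wo d). \<kappa> d w \<bullet> u \<sqsubseteq> \<kappa> d w \<bullet> v" for Z u v
  proof (rule exreg_leI[OF u v])
    fix A z l l' assume l: "val u A z l" and l': "val v A z l'"
    have lh: "l \<in> hom C A T" "l' \<in> hom C A T" using val_hom(2)[OF u l] val_hom(2)[OF v l'] fL by auto
    have "le (Fo d) A (\<pi> (d, w) \<cdot> l) (\<pi> (d, w) \<cdot> l')" if d: "d \<in> Obj D" and w: "w \<in> Field (Wo d)" for d w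
    proof -
      note k = \<kappa>h[OF d w]
      have "\<kappa> d w \<bullet> u \<sqsubseteq> \<kappa> d w \<bullet> v" using le d w by blast
      then show ?thesis
        by (rule exreg_leD[OF exreg_Cmp(1)[OF u k] exreg_Cmp(1)[OF v k] _
              exreg_Cmp(2)[OF u k l \<kappa>v[OF d w lh(1)]] exreg_Cmp(2)[OF v k l' \<kappa>v[OF d w lh(2)]]])
    qed
    then show "le L A l l'" unfolding leL Q_def using lh by (auto simp: J_def)
  qed
  ultimately have "is_weighted_limit D Wo Wa exC Fo Fa L \<kappa>" unfolding is_weighted_limit_def by blast
  then show ?thesis by blast
qed

lemma exreg_regular: "regular_category exC"
proof
  show "has_finite_weighted_limits exC"
    unfolding has_finite_weighted_limits_def using exreg_weighted_limit by blast
  show "so exC p" if "is_pullback exC f g p q" "so exC g" for f g p q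
    using exreg_so_stable that .
  fix f assume "f \<in> Arr exC"
  then have f: "f \<in> hom exC (Dom exC f) (Cod exC f)" by (rule exC.Arr_hom)
  obtain k e m where "e \<in> hom exC (Dom exC f) k" "m \<in> hom exC k (Cod exC f)" "surjective e k" "ff exC m"
    "m \<bullet> e = f"
    using exreg_factorization[OF f] .
  then show "\<exists>e m. so exC e \<and> ff exC m \<and> Dom exC e = Dom exC f \<and> Cod exC e = Dom exC m \<and>
      m \<bullet> e = f"
    using exreg_soI by (intro exI[of _ e] exI[of _ m]) (simp add: hom_def)
qed

end

section \<open>Effectiveness of congruences\<close>

context regular_category
begin

interpretation exC: regular_category exC by (rule exreg_regular)

text \<open>The internal statement that \<open>f\<close> at \<open>x\<close> equals \<open>g\<close>
  at \<open>x'\<close>. Quantifying over a local common value makes it definable although values are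
  not unique.\<close>

definition val_eq :: "('o, 'a) carr \<Rightarrow> ('o, 'a) carr \<Rightarrow> 'o \<Rightarrow> 'a \<Rightarrow> 'a \<Rightarrow> bool" where
  "val_eq f g A x x' \<longleftrightarrow> x \<in> hom C A (fst (fst f)) \<and> x' \<in> hom C A (fst (fst g)) \<and>
    (\<exists>B e y. cover e B A \<and> val f B (x \<cdot> e) y \<and> val g B (x' \<cdot> e) y)"

lemma fst_arrow: "f \<in> hom exC a b \<Longrightarrow> fst f = a"
  unfolding hom_exreg_iff by auto

lemma val_eq_definable:
  assumes f: "f \<in> hom exC a c" and g: "g \<in> hom exC b c"
  shows "definable (fst a) (fst b) (val_eq f g)"
  using definable_comp[OF val_definable[OF f] definable_converse[OF val_definable[OF g]]]
  unfolding val_eq_def[abs_def] fst_arrow[OF f] fst_arrow[OF g] .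

lemma val_eqI:
  assumes f: "f \<in> hom exC a c" and g: "g \<in> hom exC b c" and y: "val f A x y" "val g A x' y"
  shows "val_eq f g A x x'"
proof -
  note h = val_hom(1)[OF f y(1)] val_hom(1)[OF g y(2)]
  show ?thesis
    unfolding val_eq_def fst_arrow[OF f] fst_arrow[OF g]
    using cover_Idn[OF hom_Obj(1)[OF h(1)]] y h Cmp_Idn_right[OF h(1)] Cmp_Idn_right[OF h(2)] by metis
qed

lemma val_eqD:
  assumes f: "f \<in> hom exC a c" and g: "g \<in> hom exC b c" and eq: "val_eq f g A x x'" and y: "val f A x y"
  shows "val g A x' y"
proof -
  obtain B e z where x': "x' \<in> hom C A (fst b)" and e: "cover e B A" and z: "val f B (x \<cdot> e) z" "val g B (x' \<cdot> e) z"
    using eq unfolding val_eq_def fst_arrow[OF g] by blast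
  note eh = conjunct2[OF e]
  note ye = val_restrict[OF f y eh]
  have "val g B (x' \<cdot> e) (y \<cdot> e)"
    using val_cong_right[OF g z(2) val_unique[OF f z(1) ye] val_unique[OF f ye z(1)]] .
  then show ?thesis using val_local[OF g e x' val_hom(2)[OF f y]] by blast
qed

text \<open>The hypothesis concerns arrows, so it is applied to the points naming \<open>x\<close>
  and \<open>x'\<close>, whose order is the order of these elements.\<close>

lemma exreg_jointly_order_monoD:
  assumes j: "jointly_order_mono exC f g" and f: "f \<in> hom exC a b" and g: "g \<in> hom exC a c"
    and y: "val f A x y" "val f A x' y'" "le b A y y'"
    and z: "val g A x z" "val g A x' z'" "le c A z z'"
  shows "le a A x x'"
proof -
  note a = exreg_hom_Obj(1)[OF f] and b = exreg_hom_Obj(2)[OF f] and c = exreg_hom_Obj(2)[OF g]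
  note h = val_hom[OF f y(1)] val_hom[OF f y(2)] val_hom(2)[OF g z(1)] val_hom(2)[OF g z(2)]
  obtain p where p: "p \<in> hom exC (discrete A) a" "\<And>B u. u \<in> hom C B A \<Longrightarrow> val p B u (x \<cdot> u)"
    by (rule exreg_point[OF a h(1)]) (rule that)
  obtain p' where p': "p' \<in> hom exC (discrete A) a" "\<And>B u. u \<in> hom C B A \<Longrightarrow> val p' B u (x' \<cdot> u)"
    by (rule exreg_point[OF a h(3)]) (rule that)
  have 1: "f \<bullet> p \<sqsubseteq> f \<bullet> p'"
    using exreg_point_le[OF b exreg_Cmp(1)[OF p(1) f] exreg_Cmp(1)[OF p'(1) f]
        exreg_Cmp_point[OF f p y(1)] exreg_Cmp_point[OF f p' y(2)] h(2,4)] y(3) by blast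
  have 2: "g \<bullet> p \<sqsubseteq> g \<bullet> p'"
    using exreg_point_le[OF c exreg_Cmp(1)[OF p(1) g] exreg_Cmp(1)[OF p'(1) g]
        exreg_Cmp_point[OF g p z(1)] exreg_Cmp_point[OF g p' z(2)] h(5,6)] z(3) by blast
  have "Dom exC f = a" using exC.homD[OF f] by simp
  then have "p \<sqsubseteq> p'" using exC.jointly_order_monoD[OF j _ _ 1 2] p(1) p'(1) by simp
  then show ?thesis
    using exreg_point_le[OF a p(1) p'(1) p(2) p'(2) h(1,3)] by blast
qed

text \<open>\<open>K\<close> is the image of the tabulating span on underlying objects. It is closed
  under equivalence, and it decides membership in \<open>R\<close> at every test object by means of
  values alone, so a relation of the completion can be treated as a relation of
  \<open>C\<close>.\<close>

lemma exreg_relation: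
  assumes R: "relation exC x y R"
  obtains K where "relation C (fst x) (fst y) K"
    "\<And>A p p' q q'. relates x y K A p q \<Longrightarrow> le x A p p' \<Longrightarrow> le x A p' p \<Longrightarrow> le y A q q' \<Longrightarrow> le y A q' q \<Longrightarrow>
      relates x y K A p' q'"
    "\<And>z u v. u \<in> hom exC z x \<Longrightarrow> v \<in> hom exC z y \<Longrightarrow>
      exC.mem x y R z u v \<longleftrightarrow> (\<forall>A t p q. val u A t p \<longrightarrow> val v A t q \<longrightarrow> relates x y K A p q)"
proof -
  obtain r r0 r1 where r0: "r0 \<in> hom exC r x" and r1: "r1 \<in> hom exC r y"
    and jom: "jointly_order_mono exC r0 r1"
    and mem: "\<And>z u v. exC.mem x y R z u v \<longleftrightarrow> u \<in> hom exC z x \<and> v \<in> hom exC z y \<and>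
      (\<exists>w\<in>hom exC z r. r0 \<bullet> w = u \<and> r1 \<bullet> w = v)"
    by (rule exC.relation_tabulation[OF R]) (rule that)
  note x = exreg_hom_Obj(2)[OF r0] and y = exreg_hom_Obj(2)[OF r1] and r = exreg_hom_Obj(1)[OF r0]
  \<comment> \<open>Composing the converse graph of \<open>r0\<close> with the graph of
    \<open>r1\<close> yields the pairs that locally are values of both legs at one element
    \<open>s\<close>.\<close>
  obtain K where K: "relation C (fst x) (fst y) K" and memK: "relates x y K =
    (\<lambda>A p q. p \<in> hom C A (fst x) \<and> q \<in> hom C A (fst y) \<and>
      (\<exists>B e s. cover e B A \<and> val r0 B s (p \<cdot> e) \<and> val r1 B s (q \<cdot> e)))"
    using definable_comp[OF definable_converse[OF val_definable[OF r0]] val_definable[OF r1]]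
    unfolding definable_def by (elim exE conjE) (rule that)
  show ?thesis
  proof (rule that[OF K])
    fix A p p' q q'
    assume pq: "relates x y K A p q" and p: "le x A p p'" "le x A p' p" and q: "le y A q q'" "le y A q' q"
    obtain B e s where e: "cover e B A" and s: "val r0 B s (p \<cdot> e)" "val r1 B s (q \<cdot> e)"
      using pq unfolding memK by blast
    note eh = conjunct2[OF e]
    have "val r0 B s (p' \<cdot> e)" "val r1 B s (q' \<cdot> e)"
      using val_cong_right[OF r0 s(1) le_restrict[OF x p(1) eh] le_restrict[OF x p(2) eh]]
        val_cong_right[OF r1 s(2) le_restrict[OF y q(1) eh] le_restrict[OF y q(2) eh]] .
    then show "relates x y K A p' q'" unfolding memK using e le_hom(2)[OF p(1)] le_hom(2)[OF q(1)] by blast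
  next
    fix z u v assume u: "u \<in> hom exC z x" and v: "v \<in> hom exC z y"
    note z = exreg_hom_Obj(1)[OF u]
    show "exC.mem x y R z u v \<longleftrightarrow> (\<forall>A t p q. val u A t p \<longrightarrow> val v A t q \<longrightarrow> relates x y K A p q)"
    proof
      assume "exC.mem x y R z u v"
      then obtain w where w: "w \<in> hom exC z r" and uv: "r0 \<bullet> w = u" "r1 \<bullet> w = v"
        unfolding mem by blast
      show "\<forall>A t p q. val u A t p \<longrightarrow> val v A t q \<longrightarrow> relates x y K A p q"
      proof (intro allI impI)
        fix A t p q assume p: "val u A t p" and q: "val v A t q"
        note h = val_hom[OF u p] val_hom(2)[OF v q]
        obtain B e s where e: "cover e B A" and s: "val w B (t \<cdot> e) s" using val_total[OF w h(1)] .
        note eh = conjunct2[OF e]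
        have "val r0 B s (p \<cdot> e)" "val r1 B s (q \<cdot> e)"
          using val_CmpD[OF w r0 s, unfolded uv, OF val_restrict[OF u p eh]]
            val_CmpD[OF w r1 s, unfolded uv, OF val_restrict[OF v q eh]] .
        then show "relates x y K A p q" unfolding memK using e h(2,3) by blast
      qed
    next
      assume all: "\<forall>A t p q. val u A t p \<longrightarrow> val v A t q \<longrightarrow> relates x y K A p q"
      \<comment> \<open>The graph of the factorization through the tabulation: \<open>s\<close> must
        have the legs that \<open>u\<close> and \<open>v\<close> prescribe at \<open>t\<close>. It
        is locally total by the assumption on \<open>K\<close>, and monotone because the legs are
        jointly order-monomorphic.\<close>
      define G where "G A t s \<longleftrightarrow> val_eq u r0 A t s \<and> val_eq v r1 A t s" for A t s
      have def: "definable (fst z) (fst r) G"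
        unfolding G_def[abs_def]
        by (rule definable_conj[OF val_eq_definable[OF u r0] val_eq_definable[OF v r1]])
      have total: "\<exists>B e s. cover e B A \<and> G B (t \<cdot> e) s" if t: "t \<in> hom C A (fst z)" for A t
      proof -
        obtain B e p q where e: "cover e B A" "e \<in> hom C B A" and pq: "val u B (t \<cdot> e) p" "val v B (t \<cdot> e) q"
          using val_total2[OF u v t t] .
        obtain B' e' s where e': "cover e' B' B" and s: "val r0 B' s (p \<cdot> e')" "val r1 B' s (q \<cdot> e')"
          using all pq unfolding memK by blast
        note e'h = conjunct2[OF e']
        have "G B' ((t \<cdot> e) \<cdot> e') s"
          unfolding G_def using val_eqI[OF u r0 val_restrict[OF u pq(1) e'h] s(1)]
            val_eqI[OF v r1 val_restrict[OF v pq(2) e'h] s(2)] ..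
        then show ?thesis using cover_Cmp[OF e(1) e'] Cmp_assoc[OF e'h e(2) t] by metis
      qed
      obtain w where w: "w \<in> hom exC z r" and Gw: "\<And>A t s. G A t s \<Longrightarrow> val w A t s"
      proof (rule exreg_arrow_of_graph[OF z r def total])
        fix A t t' s s' assume G: "G A t s" "G A t' s'" and tt: "le z A t t'"
        note th = le_hom[OF tt]
        have sh: "s \<in> hom C A (fst r)" "s' \<in> hom C A (fst r)" using G definableD(1)[OF def] by blast+
        obtain B e p p' where e: "cover e B A" "e \<in> hom C B A" and p: "val u B (t \<cdot> e) p" "val u B (t' \<cdot> e) p'"
          using val_total2[OF u u th] .
        note th' = Cmp_hom[OF e(2) th(1)] Cmp_hom[OF e(2) th(2)]
        obtain B' e' q q' where e': "cover e' B' B" "e' \<in> hom C B' B"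
          and q: "val v B' ((t \<cdot> e) \<cdot> e') q" "val v B' ((t' \<cdot> e) \<cdot> e') q'"
          using val_total2[OF v v th'] .
        note p' = val_restrict[OF u p(1) e'(2)] val_restrict[OF u p(2) e'(2)]
        have G': "G B' ((t \<cdot> e) \<cdot> e') ((s \<cdot> e) \<cdot> e')" "G B' ((t' \<cdot> e) \<cdot> e') ((s' \<cdot> e) \<cdot> e')"
          using definableD(2)[OF def definableD(2)[OF def G(1) e(2)] e'(2)]
            definableD(2)[OF def definableD(2)[OF def G(2) e(2)] e'(2)] .
        note tt' = le_restrict[OF z le_restrict[OF z tt e(2)] e'(2)]
        have "le r B' ((s \<cdot> e) \<cdot> e') ((s' \<cdot> e) \<cdot> e')"
          by (rule exreg_jointly_order_monoD[OF jom r0 r1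
                val_eqD[OF u r0 conjunct1[OF G'(1)[unfolded G_def]] p'(1)]
                val_eqD[OF u r0 conjunct1[OF G'(2)[unfolded G_def]] p'(2)] val_mono[OF u p' tt']
                val_eqD[OF v r1 conjunct2[OF G'(1)[unfolded G_def]] q(1)]
                val_eqD[OF v r1 conjunct2[OF G'(2)[unfolded G_def]] q(2)] val_mono[OF v q tt']])
        then show "le r A s s'"
          using le_local[OF r e(1) sh le_local[OF r e'(1) Cmp_hom[OF e(2) sh(1)] Cmp_hom[OF e(2) sh(2)]]]
          by blast
      qed (assumption, rule that)
      \<comment> \<open>One argument for both triangles: any arrow out of \<open>r\<close> whose
        values agree with those of \<open>g\<close> along the graph gives \<open>g\<close> after
        \<open>w\<close>.\<close>
      have comp: "f \<bullet> w = g" if f: "f \<in> hom exC r c" and g: "g \<in> hom exC z c"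
        and eq: "\<And>A t s. G A t s \<Longrightarrow> val_eq g f A t s" for f g c
      proof (rule exreg_eqI[OF exreg_Cmp(1)[OF w f] g])
        note fw = exreg_Cmp(1)[OF w f] and c = exreg_hom_Obj(2)[OF f]
        fix A t a b assume a: "val (f \<bullet> w) A t a" and b: "val g A t b"
        note h = val_hom[OF g b] val_hom(2)[OF fw a]
        obtain B e s where e: "cover e B A" and s: "G B (t \<cdot> e) s" using total[OF h(1)] by blast
        note eh = conjunct2[OF e]
        have 1: "val f B s (a \<cdot> e)" using val_CmpD[OF w f Gw[OF s] val_restrict[OF fw a eh]] .
        have 2: "val f B s (b \<cdot> e)" using val_eqD[OF g f eq[OF s] val_restrict[OF g b eh]] .
        show "le c A a b \<and> le c A b a"
          using le_local[OF c e h(3,2) val_unique[OF f 1 2]] le_local[OF c e h(2,3) val_unique[OF f 2 1]] ..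
      qed
      have "r0 \<bullet> w = u" "r1 \<bullet> w = v"
        using comp[OF r0 u] comp[OF r1 v] unfolding G_def by blast+
      then show "exC.mem x y R z u v" unfolding mem using u v w by blast
    qed
  qed
qed

text \<open>Membership in \<open>E\<close> at an arbitrary object reduces to \<open>K\<close> on
  values, and \<open>K\<close> is in turn membership in \<open>E\<close> for points of discrete
  objects. The second fact transfers the congruence laws from \<open>E\<close> to \<open>K\<close>;
  the first identifies \<open>E\<close> with the comma relation of \<open>f\<close>, whose order
  test on composites is also a test of values by \<open>K\<close>.\<close>

lemma exreg_congruence_effective:
  assumes E: "congruence exC x E"
  shows "effective exC x E"
proof -
  have R: "relation exC x x E"
    and refl: "\<And>z u v. u \<in> hom exC z x \<Longrightarrow> v \<in> hom exC z x \<Longrightarrow> u \<sqsubseteq> v \<Longrightarrow> exC.mem x x E z u v"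
    and trans: "\<And>z u v w. exC.mem x x E z u v \<Longrightarrow> exC.mem x x E z v w \<Longrightarrow> exC.mem x x E z u w"
    using E unfolding exC.congruence_iff by blast+
  have x: "x \<in> Obj exC" using exC.relation_Obj[OF R] by simp
  obtain K where K: "relation C (fst x) (fst x) K"
    and cong: "\<And>A p p' q q'. relates x x K A p q \<Longrightarrow> le x A p p' \<Longrightarrow> le x A p' p \<Longrightarrow> le x A q q' \<Longrightarrow> le x A q' q \<Longrightarrow>
      relates x x K A p' q'"
    and mem: "\<And>z u v. u \<in> hom exC z x \<Longrightarrow> v \<in> hom exC z x \<Longrightarrow>
      exC.mem x x E z u v \<longleftrightarrow> (\<forall>A t p q. val u A t p \<longrightarrow> val v A t q \<longrightarrow> relates x x K A p q)"
    by (rule exreg_relation[OF R]) (rule that)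
  \<comment> \<open>Forward by evaluating at the identity of \<open>A\<close>. Backward, all values
    of the two points are equivalent to restrictions of \<open>p\<close> and \<open>q\<close>, which
    \<open>K\<close> tolerates by \<open>cong\<close>.\<close>
  have point: "exC.mem x x E (discrete A) f g \<longleftrightarrow> relates x x K A p q"
    if p: "p \<in> hom C A (fst x)" and q: "q \<in> hom C A (fst x)"
      and f: "f \<in> hom exC (discrete A) x" "\<And>B u. u \<in> hom C B A \<Longrightarrow> val f B u (p \<cdot> u)"
      and g: "g \<in> hom exC (discrete A) x" "\<And>B u. u \<in> hom C B A \<Longrightarrow> val g B u (q \<cdot> u)" for A p q f g
  proof
    have i: "Idn C A \<in> hom C A A" using Idn_hom[OF hom_Obj(1)[OF p]] .
    assume "exC.mem x x E (discrete A) f g"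
    then show "relates x x K A p q"
      using f(2)[OF i] g(2)[OF i] mem[OF f(1) g(1)] Cmp_Idn_right[OF p] Cmp_Idn_right[OF q] by simp
  next
    assume pq: "relates x x K A p q"
    show "exC.mem x x E (discrete A) f g"
      unfolding mem[OF f(1) g(1)]
    proof (intro allI impI)
      fix B u a b assume a: "val f B u a" and b: "val g B u b"
      have u: "u \<in> hom C B A" using val_hom(1)[OF f(1) a] by simp
      show "relates x x K B a b"
        using cong[OF mem_restrict[OF K pq u] val_unique[OF f(1) f(2)[OF u] a] val_unique[OF f(1) a f(2)[OF u]]
            val_unique[OF g(1) g(2)[OF u] b] val_unique[OF g(1) b g(2)[OF u]]] .
    qed
  qed
  define k where "k = (fst x, K)"
  have fk: "fst k = fst x" by (simp add: k_def)
  have lek: "le k = relates x x K" by (simp add: le_def k_def)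
  \<comment> \<open>Ordered elements name ordered points, which a congruence contains; so
    \<open>K\<close> contains the preorder of \<open>x\<close>. This makes the identity monotone and
    puts the order of \<open>C\<close> into \<open>K\<close>.\<close>
  have xk: "le k A p q" if pq: "le x A p q" for A p q
  proof -
    note h = le_hom[OF pq]
    obtain f where f: "f \<in> hom exC (discrete A) x" "\<And>B u. u \<in> hom C B A \<Longrightarrow> val f B u (p \<cdot> u)"
      by (rule exreg_point[OF x h(1)]) (rule that)
    obtain g where g: "g \<in> hom exC (discrete A) x" "\<And>B u. u \<in> hom C B A \<Longrightarrow> val g B u (q \<cdot> u)"
      by (rule exreg_point[OF x h(2)]) (rule that)
    have "f \<sqsubseteq> g" using exreg_point_le[OF x f(1) g(1) f(2) g(2) h] pq by blast
    then show ?thesis unfolding lek using point[OF h f g] refl[OF f(1) g(1)] by blast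
  qed
  have k: "k \<in> Obj exC"
    unfolding exreg_simps congruence_iff
  proof (intro conjI allI impI)
    show "relation C (fst k) (fst k) (snd k)" using K by (simp add: k_def)
    show "mem (fst k) (fst k) (snd k) A p q" if "p \<in> hom C A (fst k)" "q \<in> hom C A (fst k)" "p \<preceq> q" for A p q
      using xk[OF le_Leq[OF x]] that unfolding fk by (simp add: le_def k_def)
    show "mem (fst k) (fst k) (snd k) A p s"
      if "mem (fst k) (fst k) (snd k) A p q" "mem (fst k) (fst k) (snd k) A q s" for A p q s
    proof -
      have pq: "relates x x K A p q" and qs: "relates x x K A q s" using that by (simp_all add: k_def)
      have h: "p \<in> hom C A (fst x)" "q \<in> hom C A (fst x)" "s \<in> hom C A (fst x)"
        using mem_hom[OF pq] mem_hom[OF qs] by auto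
      obtain f where f: "f \<in> hom exC (discrete A) x" "\<And>B u. u \<in> hom C B A \<Longrightarrow> val f B u (p \<cdot> u)"
        by (rule exreg_point[OF x h(1)]) (rule that)
      obtain g where g: "g \<in> hom exC (discrete A) x" "\<And>B u. u \<in> hom C B A \<Longrightarrow> val g B u (q \<cdot> u)"
        by (rule exreg_point[OF x h(2)]) (rule that)
      obtain l where l: "l \<in> hom exC (discrete A) x" "\<And>B u. u \<in> hom C B A \<Longrightarrow> val l B u (s \<cdot> u)"
        by (rule exreg_point[OF x h(3)]) (rule that)
      have "exC.mem x x E (discrete A) f l"
        using trans point[OF h(1,2) f g] point[OF h(2,3) g l] pq qs by blast
      then show ?thesis using point[OF h(1,3) f l] by (simp add: k_def)
    qed
  qed
  have i: "Idn C (fst x) \<in> hom C (fst x) (fst k)" unfolding fk using Idn_hom[OF cobj_Obj[OF x]] .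
  have mono: "le k A (Idn C (fst x) \<cdot> p) (Idn C (fst x) \<cdot> q)" if "le x A p q" for A p q
    using xk[OF that] Cmp_Idn_left[OF le_hom(1)[OF that]] Cmp_Idn_left[OF le_hom(2)[OF that]] by simp
  obtain f where f: "f \<in> hom exC x k" and "\<And>A p. p \<in> hom C A (fst x) \<Longrightarrow> val f A p (Idn C (fst x) \<cdot> p)"
    by (rule exreg_arrow_of_map[OF x k i]) (erule mono, rule that)
  then have fv: "val f A p p" if "p \<in> hom C A (fst x)" for A p
    using that Cmp_Idn_left[OF that] by metis
  note comma = exC.comma_rel[OF f f]
  have "E = comma_rel exC f f"
  proof (rule exC.relation_eqI[OF R comma(1)])
    fix z u v
    \<comment> \<open>Since \<open>f\<close> does not move elements, the values of
      \<open>f \<bullet> u\<close> and \<open>f \<bullet> v\<close> are those of \<open>u\<close>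
      and \<open>v\<close> up to the preorder of \<open>k\<close>, which is
      \<open>K\<close>.\<close>
    have "(\<forall>A t p q. val u A t p \<longrightarrow> val v A t q \<longrightarrow> relates x x K A p q) \<longleftrightarrow> f \<bullet> u \<sqsubseteq> f \<bullet> v"
      (is "?l \<longleftrightarrow> ?r") if u: "u \<in> hom exC z x" and v: "v \<in> hom exC z x"
    proof
      note fu = exreg_Cmp(1)[OF u f] and fv' = exreg_Cmp(1)[OF v f]
      show ?l if r: ?r
      proof (intro allI impI)
        fix A t p q assume p: "val u A t p" and q: "val v A t q"
        show "relates x x K A p q"
          using exreg_leD[OF fu fv' r exreg_Cmp(2)[OF u f p fv[OF val_hom(2)[OF u p]]]
              exreg_Cmp(2)[OF v f q fv[OF val_hom(2)[OF v q]]]] unfolding lek .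
      qed
      assume l: ?l
      show ?r
      proof (rule exreg_leI[OF fu fv'])
        fix A t a b assume a: "val (f \<bullet> u) A t a" and b: "val (f \<bullet> v) A t b"
        note ah = val_hom[OF fu a] and bh = val_hom[OF fv' b]
        obtain B e p q where e: "cover e B A" "e \<in> hom C B A" and p: "val u B (t \<cdot> e) p" and q: "val v B (t \<cdot> e) q"
          using val_total2[OF u v ah(1) bh(1)] .
        have 1: "le k B (a \<cdot> e) p"
          using val_unique[OF f val_CmpD[OF u f p val_restrict[OF fu a e(2)]] fv[OF val_hom(2)[OF u p]]] .
        have 2: "le k B p q" using l p q unfolding lek by blast
        have 3: "le k B q (b \<cdot> e)"
          using val_unique[OF f fv[OF val_hom(2)[OF v q]] val_CmpD[OF v f q val_restrict[OF fv' b e(2)]]] .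
        show "le k A a b"
          by (rule le_local[OF k e(1) ah(2) bh(2) le_trans[OF k 1 le_trans[OF k 2 3]]])
      qed
    qed
    then show "exC.mem x x E z u v \<longleftrightarrow> exC.mem x x (comma_rel exC f f) z u v"
      unfolding comma(2) using mem[of u z v] exC.mem_hom by meson
  qed
  then show ?thesis unfolding effective_def using exC.homD[OF f] by blast
qed

lemma exreg_exact: "exact_category exC"
  by standard (rule exreg_congruence_effective)

end

theorem corollary4p17:
  fixes C :: "('o, 'a) poscat"
  assumes "regular_category C"
  shows "exact_category (exreg C)"
  using regular_category.exreg_exact[OF assms] .

end
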